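(* Suppose $\alpha$ is real, $\beta$ is real, and $p>0$. Then the operator $T$ defined on $H(\mathbb B_n)$ by $$Tf(z)=f(0)+\sum_{|m|>0}|m|^{(\beta-\alpha)/p}a_mz^m,\qquad f(z)=\sum_m a_mz^m,$$ maps $A^p_\alpha$ boundedly onto $A^p_\beta$.
   Context: Fix a positive integer $n$. $\mathbb B_n$ is the open unit ball of $\mathbb C^n$, $H(\mathbb B_n)$ the space of holomorphic functions in $\mathbb B_n$; $f(z)=\sum_m a_mz^m$ denotes the Taylor series over multi-indices $m=(m_1,\dots,m_n)$ of nonnegative integers, with $|m|=m_1+\cdots+m_n$ and $z^m=z_1^{m_1}\cdots z_n^{m_n}$. $dv$ is volume measure and $dv_\alpha(z)=(1-|z|^2)^\alpha dv(z)$ for real $\alpha$ (normalized to be a probability measure when $\alpha>-1$). The radial derivative is $Rf(z)=\sum_{k=1}^n z_k\frac{\partial f}{\partial z_k}(z)$, $R^k$ is its $k$-fold iterate, $R^0f=f$. For $p>0$ and real $\alpha$, $A^p_\alpha$ is the space of $f\in H(\mathbb B_n)$ such that, for a nonnegative integer $k$ with $pk+\alpha>-1$, $(1-|z|^2)^kR^kf(z)\in L^p(\mathbb B_n,dv_\alpha)$ (independent of the choice of such $k$). With $N$ the smallest nonnegative integer such that $pN+\alpha>-1$, boundedness refers to $$\|f\|_{p,\alpha}=|f(0)|+\left[\int_{\mathbb B_n}(1-|z|^2)^{pN}|R^Nf(z)|^p\,dv_\alpha(z)\right]^{1/p}.$$ *)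

theory Defs
  imports "HOL-Analysis.Analysis"
begin

definition partial_deriv :: "'n::finite \<Rightarrow> (complex^'n \<Rightarrow> complex) \<Rightarrow> complex^'n \<Rightarrow> complex" where
  "partial_deriv k f z = deriv (\<lambda>w. f (z + axis k w)) 0"

definition radial_deriv :: "(complex^'n::finite \<Rightarrow> complex) \<Rightarrow> complex^'n \<Rightarrow> complex" where
  "radial_deriv f z = (\<Sum>k\<in>UNIV. z $ k * partial_deriv k f z)"

text \<open>
  Holomorphic means complex differentiable, i.e. Frechet differentiable with a complex-linear
  derivative, at each point of the open unit ball. Functions on the ball are represented by total
  functions that are \<^const>\<open>undefined\<close> outside it, so that equality in the type is equality on the
  ball and images of function spaces can be compared as sets.
\<close>

definition hol_ball :: "(complex^'n::finite \<Rightarrow> complex) set" where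
  "hol_ball = {f \<in> extensional (ball 0 1).
     \<forall>z\<in>ball 0 1. \<exists>D. (f has_derivative D) (at z) \<and> (\<forall>c v. D (c *s v) = c * D v)}"

definition mi_order :: "('n::finite \<Rightarrow> nat) \<Rightarrow> nat" where
  "mi_order m = (\<Sum>k\<in>UNIV. m k)"

definition mi_power :: "complex^'n \<Rightarrow> ('n::finite \<Rightarrow> nat) \<Rightarrow> complex" where
  "mi_power z m = (\<Prod>k\<in>UNIV. (z $ k) ^ m k)"

text \<open>
  The coefficient \<open>a\<^sub>m\<close> is the mixed partial derivative of order \<open>m\<close> at the origin, divided by
  \<open>m!\<close>. The list enumerates the coordinates in some order, coordinate \<open>k\<close> occurring \<open>m k\<close> times;
  the order is immaterial for holomorphic functions, whose partial derivatives commute.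
\<close>

definition taylor_coeff :: "(complex^'n::finite \<Rightarrow> complex) \<Rightarrow> ('n \<Rightarrow> nat) \<Rightarrow> complex" where
  "taylor_coeff f m =
     foldr partial_deriv (SOME ks. \<forall>k. count_list ks k = m k) f 0 / (\<Prod>k\<in>UNIV. fact (m k))"

definition weighted_volume :: "real \<Rightarrow> (complex^'n::finite) measure" where
  "weighted_volume \<alpha> =
     density (restrict_space lborel (ball 0 1)) (\<lambda>z. ennreal ((1 - (norm z)\<^sup>2) powr \<alpha>))"

text \<open>The total mass is finite, and hence can be normalized to 1, exactly when \<open>\<alpha> > - 1\<close>.\<close>

definition v_measure :: "real \<Rightarrow> (complex^'n::finite) measure" where
  "v_measure \<alpha> =
     (let V = weighted_volume \<alpha> :: (complex^'n) measure in
      if \<alpha> > - 1 then scale_measure (inverse (emeasure V (space V))) V else V)"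

definition in_Lp :: "real \<Rightarrow> 'a measure \<Rightarrow> ('a \<Rightarrow> complex) \<Rightarrow> bool" where
  "in_Lp p M g \<longleftrightarrow> g \<in> borel_measurable M \<and> integrable M (\<lambda>x. cmod (g x) powr p)"

definition bergman_space :: "real \<Rightarrow> real \<Rightarrow> (complex^'n::finite \<Rightarrow> complex) set" where
  "bergman_space p \<alpha> = {f \<in> hol_ball. \<exists>k::nat. p * real k + \<alpha> > - 1 \<and>
     in_Lp p (v_measure \<alpha>) (\<lambda>z. of_real ((1 - (norm z)\<^sup>2) ^ k) * (radial_deriv ^^ k) f z)}"

definition bergman_index :: "real \<Rightarrow> real \<Rightarrow> nat" where
  "bergman_index p \<alpha> = (LEAST N. p * real N + \<alpha> > - 1)"

text \<open>For \<open>p < 1\<close> this is a quasi-norm rather than a norm.\<close>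

definition bergman_norm :: "real \<Rightarrow> real \<Rightarrow> (complex^'n::finite \<Rightarrow> complex) \<Rightarrow> real" where
  "bergman_norm p \<alpha> f =
     (let N = bergman_index p \<alpha> in
      cmod (f 0) +
      (\<integral>z. (1 - (norm z)\<^sup>2) powr (p * real N) * cmod ((radial_deriv ^^ N) f z) powr p
         \<partial>v_measure \<alpha>) powr (1 / p))"

definition T_op :: "real \<Rightarrow> real \<Rightarrow> real \<Rightarrow> (complex^'n::finite \<Rightarrow> complex) \<Rightarrow> complex^'n \<Rightarrow> complex" where
  "T_op p \<alpha> \<beta> f = (\<lambda>z\<in>ball 0 1.
     f 0 + (\<Sum>\<^sub>\<infinity>m\<in>{m. mi_order m > 0}.
       of_real (real (mi_order m) powr ((\<beta> - \<alpha>) / p)) * taylor_coeff f m * mi_power z m))"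

end

theory Submission
  imports Defs "HOL-Complex_Analysis.Complex_Analysis" "HOL-Real_Asymp.Real_Asymp"
begin

text \<open>
  Along the slices \<open>w \<mapsto> f (e\<^sup>w z)\<close> of a holomorphic function on the ball, the radial derivative
  \<open>R\<close> is \<open>d/dw\<close>, and on the Taylor expansion \<open>R\<close> multiplies \<open>a\<^sub>m\<close> by \<open>|m|\<close>. Hence, apart from
  constant terms, \<open>R\<^sup>l T f\<close> arises from \<open>R\<^sup>k f\<close> by the multiplier \<open>|m|\<^sup>t\<close> with
  \<open>t = l - k + (\<beta> - \<alpha>) / p\<close>, and the exponents of the weights satisfy \<open>p l + \<beta> - p t = p k + \<alpha>\<close>.
  The boundedness of \<open>T\<close> and the independence of the space from the choice of \<open>k\<close> are therefore
  instances of one inequality: if \<open>b > -1\<close>, \<open>g 0 = 0\<close> and \<open>D\<^sup>t\<close> multiplies the coefficients by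
  \<open>|m|\<^sup>t\<close>, then
    \<open>\<integral> (1 - |z|\<^sup>2)\<^sup>b |D\<^sup>t g|\<^sup>p dv \<le> C \<integral> (1 - |z|\<^sup>2)\<^sup>(\<^sup>b\<^sup>-\<^sup>p\<^sup>t\<^sup>) |g|\<^sup>p dv\<close>,
  which is \<open>weighted_integral_multiplier_vanishing\<close>. The operator \<open>T\<close> is onto because exchanging
  \<open>\<alpha>\<close> and \<open>\<beta>\<close> gives an operator of the same kind that inverts it (\<open>T_op_inverse\<close>).

  To prove the inequality, write \<open>D\<^sup>t = D\<^sup>-\<^sup>\<sigma> R\<^sup>k\<close> with an integer \<open>k \<ge> t + 1\<close> and \<open>\<sigma> = k - t\<close>, where
  \<open>D\<^sup>-\<^sup>\<sigma> g (z) = 1/\<Gamma>(\<sigma>) \<integral> u\<^sup>(\<^sup>\<sigma>\<^sup>-\<^sup>1\<^sup>) g (e\<^sup>-\<^sup>u z) du\<close> over \<open>u > 0\<close> (\<open>fractional_integral_bound\<close>).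
  Cauchy's inequality estimates \<open>R\<^sup>k g\<close> at a point of a slice by \<open>|g|\<close> on a square of size comparable
  to the distance from the boundary, and the value of \<open>|g|\<^sup>p\<close> at a point is at most a constant times
  its mean over a square, for every \<open>p > 0\<close> (\<open>weak_mean_value\<close>). Estimating the integral over the ray
  by a supremum costs only a factor \<open>(1 - |z|)\<^sup>-\<^sup>\<epsilon>\<close> with \<open>\<epsilon>\<close> as small as desired, and it makes all exponents
  \<open>p\<close> alike. The result is a pointwise bound of \<open>|D\<^sup>t g (z)|\<^sup>p\<close> by an integral of \<open>|g (e\<^sup>w z)|\<^sup>p\<close> over
  those \<open>w\<close> for which \<open>e\<^sup>w\<close> lies in a nontangential region (\<open>multiplier_pointwise_bound\<close>).

  This bound is then integrated over \<open>z\<close>. After exchanging the integrals, the dilation \<open>z \<mapsto> e\<^sup>w z\<close>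
  changes Lebesgue measure by a bounded factor (\<open>nn_integral_complex_dilation_le\<close>), the imaginary
  part of \<open>w\<close> contributes the width of the region, and the real part leaves a one-dimensional
  integral of a power larger than \<open>-1\<close> (\<open>integral_region_integral_le\<close>).
\<close>

no_notation fps_nth (infixl "$" 75)

section \<open>Power series in several variables\<close>

lemma norm_vector_smult_complex: "norm (l *s z) = cmod l * norm (z :: complex^'n::finite)"
  by (simp add: norm_vec_def L2_set_def norm_mult power_mult_distrib flip: sum_distrib_left)
     (simp add: real_sqrt_mult)

lemma mi_power_smult: "mi_power (l *s z) m = l ^ mi_order m * mi_power z m"
  by (simp add: mi_power_def mi_order_def power_mult_distrib prod.distrib power_sum)

lemma cmod_mi_power: "cmod (mi_power z m) = (\<Prod>k\<in>UNIV. cmod (z $ k) ^ m k)"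
  by (simp add: mi_power_def norm_power flip: prod_norm)

lemma mi_power_mono:
  assumes "\<And>k. cmod (z $ k) \<le> cmod (y $ k)"
  shows "cmod (mi_power z m) \<le> cmod (mi_power y m)"
  unfolding cmod_mi_power by (intro prod_mono conjI power_mono assms) auto

lemma mi_order_eq_0_iff: "mi_order m = 0 \<longleftrightarrow> m = (\<lambda>_. 0)"
  by (auto simp: mi_order_def)

lemma mi_power_zero_vector: "mi_power (0 :: complex^'n::finite) m = (if m = (\<lambda>_. 0) then 1 else 0)"
  by (auto simp: mi_power_def fun_eq_iff prod_zero_iff intro!: prod_zero)

lemma mi_power_zero_index [simp]: "mi_power z (\<lambda>_. 0) = 1"
  by (simp add: mi_power_def)

text \<open>
  Only values in the ball count, because functions on the ball are represented by total functions.
  The sum over multi-indices is unconditional, hence absolutely convergent.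
\<close>

definition mseries :: "(('n::finite \<Rightarrow> nat) \<Rightarrow> complex) \<Rightarrow> (complex^'n \<Rightarrow> complex) \<Rightarrow> bool" where
  "mseries c f \<longleftrightarrow> (\<forall>z\<in>ball 0 1. ((\<lambda>m. c m * mi_power z m) has_sum f z) UNIV)"

text \<open>
  The growth that a multiplier depending on \<open>|m|\<close> may have without shrinking the ball of convergence.
\<close>

definition subexponential :: "(nat \<Rightarrow> real) \<Rightarrow> bool" where
  "subexponential \<phi> \<longleftrightarrow> (\<forall>t>1. \<exists>K. \<forall>j. \<bar>\<phi> j\<bar> \<le> K * t ^ j)"

lemma subexponential_powr: "subexponential (\<lambda>j. real j powr s)"
  unfolding subexponential_def
proof (intro allI impI)
  fix t :: real assume t: "1 < t"
  have "(\<lambda>j. real j powr s / t ^ j) \<longlonglongrightarrow> 0" using t by real_asymp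
  then have "Bseq (\<lambda>j. real j powr s / t ^ j)" using convergentI convergent_imp_Bseq by blast
  then obtain K where "\<And>j. norm (real j powr s / t ^ j) \<le> K" unfolding Bseq_def by blast
  then have "\<bar>real j powr s\<bar> \<le> K * t ^ j" for j
    using t by (simp add: field_simps)
  then show "\<exists>K. \<forall>j. \<bar>real j powr s\<bar> \<le> K * t ^ j" by blast
qed

lemma subexponential_of_nat: "subexponential real"
proof -
  have "(\<lambda>j. real j powr 1) = real" by auto
  then show ?thesis using subexponential_powr[of 1] by simp
qed

text \<open>
  The series still converges at \<open>t y\<close> for some \<open>t > 1\<close>; the geometric factor gained there absorbs
  the multiplier.
\<close>

lemma mseries_summable_subexponential:
  assumes c: "mseries c f" and y: "y \<in> ball 0 1" and \<phi>: "subexponential \<phi>"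
  shows "(\<lambda>m. norm (of_real (\<phi> (mi_order m)) * c m * mi_power y m)) summable_on UNIV"
proof -
  define t where "t = 2 / (1 + norm y)"
  have ny: "0 \<le> norm y" "norm y < 1" using y by auto
  have t: "t > 1" "t * norm y < 1" using ny by (auto simp: t_def field_simps add_pos_nonneg)
  obtain K where K: "\<And>j. \<bar>\<phi> j\<bar> \<le> K * t ^ j" using \<phi> t unfolding subexponential_def by blast
  have "of_real t *s y \<in> ball 0 1" using t by (simp add: norm_vector_smult_complex)
  then have "(\<lambda>m. norm (c m * mi_power (of_real t *s y) m)) summable_on UNIV"
    using c unfolding mseries_def by (intro summable_on_iff_abs_summable_on_complex[THEN iffD1] has_sum_imp_summable) blast
  then have s: "(\<lambda>m. K * norm (c m * mi_power (of_real t *s y) m)) summable_on UNIV"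
    by (rule summable_on_cmult_right)
  show ?thesis
  proof (rule summable_on_comparison_test[OF s])
    fix m :: "'a \<Rightarrow> nat"
    have "norm (of_real (\<phi> (mi_order m)) * c m * mi_power y m) = \<bar>\<phi> (mi_order m)\<bar> * norm (c m * mi_power y m)"
      by (simp add: norm_mult)
    also have "\<dots> \<le> K * t ^ mi_order m * norm (c m * mi_power y m)"
      by (intro mult_right_mono K) auto
    also have "\<dots> = K * norm (c m * mi_power (of_real t *s y) m)"
      using t by (simp add: mi_power_smult norm_mult norm_power)
    finally show "norm (of_real (\<phi> (mi_order m)) * c m * mi_power y m) \<le> K * norm (c m * mi_power (of_real t *s y) m)" .
  qed auto
qed

lemma mseries_multiplier:
  assumes "mseries c f" "subexponential \<phi>"
    and "\<And>z. z \<in> ball 0 1 \<Longrightarrow> g z = (\<Sum>\<^sub>\<infinity>m. of_real (\<phi> (mi_order m)) * c m * mi_power z m)"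
  shows "mseries (\<lambda>m. of_real (\<phi> (mi_order m)) * c m) g"
  unfolding mseries_def
proof
  fix z :: "complex^'a" assume z: "z \<in> ball 0 1"
  show "((\<lambda>m. of_real (\<phi> (mi_order m)) * c m * mi_power z m) has_sum g z) UNIV"
    unfolding assms(3)[OF z]
    by (rule has_sum_infsum[OF abs_summable_summable[OF mseries_summable_subexponential[OF assms(1) z assms(2)]]])
qed

lemma has_sum_finite_sum:
  fixes f :: "'k \<Rightarrow> 'i \<Rightarrow> 'b::{topological_comm_monoid_add}"
  assumes "\<And>k. k \<in> K \<Longrightarrow> (f k has_sum l k) A"
  shows "((\<lambda>i. \<Sum>k\<in>K. f k i) has_sum (\<Sum>k\<in>K. l k)) A"
  using assms by (induction K rule: infinite_finite_induct) (auto intro: has_sum_add)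

text \<open>
  Termwise differentiation under a Weierstrass bound for the derivatives. Enumerating the index set
  reduces it to the corresponding statement for sequences.
\<close>

lemma has_derivative_infsum_dominated:
  fixes F :: "'i::countable \<Rightarrow> 'a::real_normed_vector \<Rightarrow> 'b::banach"
  assumes inf: "infinite (UNIV :: 'i set)"
    and S: "convex S" "x \<in> S"
    and der: "\<And>i x. x \<in> S \<Longrightarrow> (F i has_derivative F' i x) (at x within S)"
    and bd: "\<And>i x h. x \<in> S \<Longrightarrow> norm (F' i x h) \<le> M i * norm h"
    and M: "M summable_on UNIV"
    and f: "\<And>x. x \<in> S \<Longrightarrow> ((\<lambda>i. F i x) has_sum f x) UNIV"
  shows "(f has_derivative (\<lambda>h. \<Sum>\<^sub>\<infinity>i. F' i x h)) (at x within S)"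
proof -
  obtain e :: "nat \<Rightarrow> 'i" where e: "bij_betw e UNIV UNIV"
    using bij_betw_from_nat_into[OF countableI_type inf] by blast
  have re: "((\<lambda>n. g (e n)) has_sum l) UNIV \<longleftrightarrow> (g has_sum l) UNIV" for l and g :: "'i \<Rightarrow> 'b"
    by (rule has_sum_reindex_bij_betw[OF e])
  have Ms: "summable (\<lambda>n. M (e n))"
    by (rule summable_on_imp_summable) (rule summable_on_reindex_bij_betw[OF e, THEN iffD2, OF M])
  have abss: "(\<lambda>i. F' i y h) summable_on UNIV" if "y \<in> S" for y h :: 'a
  proof (rule abs_summable_summable[OF summable_on_comparison_test])
    show "(\<lambda>i. M i * norm h) summable_on UNIV" by (rule summable_on_cmult_left[OF M])
  qed (use bd that in auto)
  have sF': "(\<lambda>n. F' (e n) y h) sums (\<Sum>\<^sub>\<infinity>i. F' i y h)" if "y \<in> S" for y h :: 'a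
    by (rule has_sum_imp_sums) (rule re[of "\<lambda>i. F' i y h", THEN iffD2, OF has_sum_infsum[OF abss[OF that]]])
  have sF: "(\<lambda>n. F (e n) y) sums f y" if "y \<in> S" for y
    by (rule has_sum_imp_sums) (rule re[of "\<lambda>i. F i y", THEN iffD2, OF f[OF that]])
  have Mn: "0 \<le> M i * norm h" for i and h :: 'a using bd[OF S(2), of i h] norm_ge_zero order_trans by blast
  have "\<exists>g. \<forall>y\<in>S. (\<lambda>n. F (e n) y) sums g y \<and> (g has_derivative (\<lambda>h. \<Sum>\<^sub>\<infinity>i. F' i y h)) (at y within S)"
  proof (rule has_derivative_series[where f = "\<lambda>n. F (e n)" and f' = "\<lambda>n. F' (e n)"
      and g' = "\<lambda>y h. \<Sum>\<^sub>\<infinity>i. F' i y h", OF S(1) _ _ S(2) sF[OF S(2)]])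
    fix r :: real assume r: "r > 0"
    from suminf_exist_split[OF r Ms] obtain N where N: "\<And>n. n \<ge> N \<Longrightarrow> norm (\<Sum>i. M (e (i + n))) < r" by blast
    show "\<forall>\<^sub>F n in sequentially. \<forall>y\<in>S. \<forall>h. norm ((\<Sum>i<n. F' (e i) y h) - (\<Sum>\<^sub>\<infinity>i. F' i y h)) \<le> r * norm h"
      unfolding eventually_sequentially
    proof (intro exI[of _ N] allI impI ballI)
      fix n and y h :: 'a assume n: "N \<le> n" and y: "y \<in> S"
      have sm: "summable (\<lambda>i. M (e (i + n)) * norm h)"
        using Ms by (intro summable_mult2) (subst summable_iff_shift, assumption)
      have "(\<Sum>\<^sub>\<infinity>i. F' i y h) - (\<Sum>i<n. F' (e i) y h) = (\<Sum>i. F' (e (i + n)) y h)"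
        using suminf_minus_initial_segment[where k = n, OF sums_summable[OF sF'[OF y, of h]]] sums_unique[OF sF'[OF y, of h]] by simp
      then have "norm ((\<Sum>i<n. F' (e i) y h) - (\<Sum>\<^sub>\<infinity>i. F' i y h)) = norm (\<Sum>i. F' (e (i + n)) y h)"
        by (metis norm_minus_commute)
      also have "\<dots> \<le> (\<Sum>i. M (e (i + n)) * norm h)"
        by (rule norm_suminf_le[OF _ sm]) (rule bd[OF y])
      also have "\<dots> = (\<Sum>i. M (e (i + n))) * norm h"
        using Ms by (intro suminf_mult2[symmetric]) (subst summable_iff_shift, assumption)
      also have "\<dots> \<le> r * norm h" using N[OF n] by (intro mult_right_mono) auto
      finally show "norm ((\<Sum>i<n. F' (e i) y h) - (\<Sum>\<^sub>\<infinity>i. F' i y h)) \<le> r * norm h" .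
    qed
  qed (use der in auto)
  then obtain g where g: "\<And>y. y \<in> S \<Longrightarrow> (\<lambda>n. F (e n) y) sums g y"
     "\<And>y. y \<in> S \<Longrightarrow> (g has_derivative (\<lambda>h. \<Sum>\<^sub>\<infinity>i. F' i y h)) (at y within S)" by blast
  have "g y = f y" if "y \<in> S" for y using sums_unique2[OF g(1) sF] that by blast
  then show ?thesis by (intro has_derivative_transform[OF S(2) _ g(2)[OF S(2)]]) simp
qed

lemma mi_power_remove: "mi_power z m = (z $ k) ^ m k * (\<Prod>j\<in>UNIV - {k}. (z $ j) ^ m j)"
  unfolding mi_power_def by (rule prod.remove) auto

lemma mi_power_upd: "mi_power z (m(k := i)) = (z $ k) ^ i * (\<Prod>j\<in>UNIV - {k}. (z $ j) ^ m j)"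
  by (subst mi_power_remove[of _ _ k]) (auto intro!: prod.cong)

lemma mi_power_decrement:
  assumes "m k \<noteq> 0"
  shows "z $ k * mi_power z (m(k := m k - 1)) = mi_power z m"
proof -
  have "z $ k * (z $ k) ^ (m k - 1) = (z $ k) ^ m k" using assms by (metis power_eq_if)
  then show ?thesis unfolding mi_power_upd mi_power_remove[of z m k] by (simp only: mult.assoc[symmetric])
qed

lemma mi_power_has_derivative:
  "((\<lambda>z. mi_power z m) has_derivative
    (\<lambda>v. \<Sum>k\<in>UNIV. v $ k * (of_nat (m k) * mi_power z (m(k := m k - 1))))) (at z within S)"
proof -
  have eq: "(\<lambda>z. mi_power z m) = (\<lambda>z. \<Prod>k\<in>UNIV. (z $ k) ^ m k)" by (rule ext) (rule mi_power_def)
  show ?thesis unfolding eq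
  proof (rule has_derivative_eq_rhs)
    show "((\<lambda>z. \<Prod>k\<in>UNIV. (z $ k) ^ m k) has_derivative
      (\<lambda>v. \<Sum>k\<in>UNIV. (of_nat (m k) * v $ k * (z $ k) ^ (m k - 1)) * (\<Prod>j\<in>UNIV - {k}. (z $ j) ^ m j))) (at z within S)"
      by (intro has_derivative_prod has_derivative_power bounded_linear.has_derivative[OF bounded_linear_vec_nth] has_derivative_ident)
    show "(\<lambda>v. \<Sum>k\<in>UNIV. (of_nat (m k) * v $ k * (z $ k) ^ (m k - 1)) * (\<Prod>j\<in>UNIV - {k}. (z $ j) ^ m j))
      = (\<lambda>v. \<Sum>k\<in>UNIV. v $ k * (of_nat (m k) * mi_power z (m(k := m k - 1))))"
      by (intro ext sum.cong refl) (simp add: mi_power_upd)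
  qed
qed

lemma infinite_UNIV_multi_index: "infinite (UNIV :: ('n::finite \<Rightarrow> nat) set)"
proof
  assume "finite (UNIV :: ('n \<Rightarrow> nat) set)"
  then have "finite (range (\<lambda>(j::nat) (_::'n). j))" by (rule finite_subset[rotated]) simp
  moreover have "inj (\<lambda>(j::nat) (_::'n). j)" by (auto simp: inj_def fun_eq_iff)
  ultimately show False using finite_imageD infinite_UNIV_nat by blast
qed

text \<open>
  The point \<open>y\<close> is the corner of a polydisc inside the ball that contains a neighbourhood of \<open>z\<close>.
  Absolute convergence at \<open>y\<close> dominates all terms, and the margin \<open>\<eta>\<close> pays for derivatives.
\<close>

lemma ball_dominating_radii:
  fixes z :: "complex^'n::finite"
  assumes "z \<in> ball 0 1"
  obtains \<eta> y where "\<eta> > 0" "y \<in> ball (0 :: complex^'n) 1" "\<And>k. y $ k = of_real (cmod (z $ k) + \<eta>)"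
proof
  \<comment> \<open>The vector all of whose coordinates are \<open>\<eta>\<close> has norm at most \<open>(1 - norm z) / 2\<close>.\<close>
  define \<eta> where "\<eta> = (1 - norm z) / (2 * CARD('n))"
  show "\<eta> > 0" using assms by (simp add: \<eta>_def)
  define y :: "complex^'n" where "y = (\<chi> k. of_real (cmod (z $ k) + \<eta>))"
  show "y $ k = of_real (cmod (z $ k) + \<eta>)" for k by (simp add: y_def)
  have "y = (\<chi> k. of_real (cmod (z $ k))) + (\<chi> k. of_real \<eta>)" by (simp add: y_def vec_eq_iff)
  then have "norm y \<le> norm ((\<chi> k. of_real (cmod (z $ k))) :: complex^'n) + norm ((\<chi> k. of_real \<eta>) :: complex^'n)"
    by (simp only: norm_triangle_ineq)
  also have "norm ((\<chi> k. of_real (cmod (z $ k))) :: complex^'n) = norm z" by (simp add: norm_vec_def)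
  finally have 1: "norm y \<le> norm z + norm ((\<chi> k. of_real \<eta>) :: complex^'n)" .
  have "norm ((\<chi> k. of_real \<eta>) :: complex^'n) \<le> (\<Sum>k\<in>(UNIV::'n set). \<eta>)"
    unfolding norm_vec_def using \<open>\<eta> > 0\<close> by (intro order_trans[OF L2_set_le_sum]) auto
  also have "\<dots> = (1 - norm z) / 2" by (simp add: \<eta>_def)
  finally have 2: "norm ((\<chi> k. of_real \<eta>) :: complex^'n) \<le> (1 - norm z) / 2" .
  have "norm y \<le> norm z + (1 - norm z) / 2" by (rule order_trans[OF 1 add_left_mono[OF 2]])
  moreover have "norm z < 1" using assms by simp
  ultimately have "norm y < 1" by (simp add: field_simps)
  then show "y \<in> ball 0 1" by simp
qed

lemma mi_order_ge: "m k \<le> mi_order m"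
  unfolding mi_order_def by (rule member_le_sum) auto

text \<open>
  Lowering one exponent means division by a coordinate, and all coordinates of \<open>y\<close> are at least \<open>\<eta>\<close>.
\<close>

lemma norm_dmi_power_le:
  assumes y: "\<And>k. cmod (z $ k) \<le> cmod (y $ k)" and \<eta>: "\<And>k. \<eta> \<le> cmod (y $ k)" "\<eta> > 0"
  shows "cmod (of_nat (m k) * mi_power z (m(k := m k - 1))) \<le> real (mi_order m) * cmod (mi_power y m) / \<eta>"
proof (cases "m k = 0")
  case False
  have "cmod (mi_power z (m(k := m k - 1))) \<le> cmod (mi_power y (m(k := m k - 1)))" by (rule mi_power_mono[OF y])
  also have "\<dots> = cmod (y $ k) * cmod (mi_power y (m(k := m k - 1))) / cmod (y $ k)"
    using order.strict_trans2[OF \<eta>(2) \<eta>(1)[of k]] by simp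
  also have "cmod (y $ k) * cmod (mi_power y (m(k := m k - 1))) = cmod (mi_power y m)"
    using mi_power_decrement[of m k y, OF False] by (metis norm_mult)
  also have "cmod (mi_power y m) / cmod (y $ k) \<le> cmod (mi_power y m) / \<eta>"
    using \<eta> by (intro divide_left_mono mult_pos_pos) (simp_all add: order.strict_trans2[OF \<eta>(2) \<eta>(1)[of k]] del: zero_less_norm_iff)
  finally have *: "cmod (mi_power z (m(k := m k - 1))) \<le> cmod (mi_power y m) / \<eta>" .
  have "real (m k) * cmod (mi_power z (m(k := m k - 1))) \<le> real (mi_order m) * (cmod (mi_power y m) / \<eta>)"
    by (rule mult_mono[OF _ *]) (auto simp: mi_order_ge)
  then show ?thesis by (simp add: norm_mult)
qed (use \<eta> in auto)

lemma mseries_partial_summable: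
  fixes c :: "('n::finite \<Rightarrow> nat) \<Rightarrow> complex"
  assumes c: "mseries c f" and z: "z \<in> ball 0 1"
  shows "(\<lambda>m. c m * (of_nat (m k) * mi_power z (m(k := m k - 1)))) summable_on UNIV"
proof -
  obtain \<eta> y where \<eta>: "\<eta> > 0" and y: "y \<in> ball (0 :: complex^'n) 1" "\<And>k. y $ k = of_real (cmod (z $ k) + \<eta>)"
    by (rule ball_dominating_radii[OF z]) (rule that)
  have s: "(\<lambda>m. norm (of_real (real (mi_order m)) * c m * mi_power y m) * (1 / \<eta>)) summable_on UNIV"
    by (intro summable_on_cmult_left mseries_summable_subexponential[OF c y(1)] subexponential_of_nat)
  show ?thesis
  proof (rule abs_summable_summable[OF summable_on_comparison_test[OF s]])
    fix m
    have "cmod (of_nat (m k) * mi_power z (m(k := m k - 1))) \<le> real (mi_order m) * cmod (mi_power y m) / \<eta>"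
      using \<eta> by (intro norm_dmi_power_le) (auto simp: y(2) simp del: of_real_add)
    then have "norm (c m) * cmod (of_nat (m k) * mi_power z (m(k := m k - 1))) \<le> norm (c m) * (real (mi_order m) * cmod (mi_power y m) / \<eta>)"
      by (intro mult_left_mono) auto
    then show "norm (c m * (of_nat (m k) * mi_power z (m(k := m k - 1)))) \<le> norm (of_real (real (mi_order m)) * c m * mi_power y m) * (1 / \<eta>)"
      by (simp add: norm_mult mult_ac)
  qed auto
qed

lemma mseries_has_derivative:
  fixes c :: "('n::finite \<Rightarrow> nat) \<Rightarrow> complex"
  assumes c: "mseries c f" and z: "z \<in> ball 0 1"
  shows "(f has_derivative (\<lambda>v. \<Sum>k\<in>UNIV. v $ k *
     (\<Sum>\<^sub>\<infinity>m. c m * (of_nat (m k) * mi_power z (m(k := m k - 1)))))) (at z)"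
proof -
  obtain \<eta> y where \<eta>: "\<eta> > 0" and y: "y \<in> ball (0 :: complex^'n) 1" "\<And>k. y $ k = of_real (cmod (z $ k) + \<eta>)"
    by (rule ball_dominating_radii[OF z]) (rule that)
  define S where "S = ball z \<eta> \<inter> ball 0 1"
  have S: "open S" "convex S" "z \<in> S" using z \<eta> by (auto simp: S_def convex_Int)
  let ?d = "\<lambda>x k m. of_nat (m k) * mi_power x (m(k := m k - 1))"
  define M where "M m = norm (of_real (real (mi_order m)) * c m * mi_power y m) * (1 / \<eta>) * CARD('n)" for m
  have "(f has_derivative (\<lambda>h. \<Sum>\<^sub>\<infinity>m. c m * (\<Sum>k\<in>UNIV. h $ k * ?d z k m))) (at z within S)"
  proof (rule has_derivative_infsum_dominated[OF infinite_UNIV_multi_index S(2,3), where M = M])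
    show "M summable_on UNIV" unfolding M_def
      by (intro summable_on_cmult_left mseries_summable_subexponential[OF c y(1)] subexponential_of_nat)
    show "((\<lambda>m. c m * mi_power x m) has_sum f x) UNIV" if "x \<in> S" for x
      using c that by (auto simp: mseries_def S_def)
    show "((\<lambda>x. c m * mi_power x m) has_derivative (\<lambda>h. c m * (\<Sum>k\<in>UNIV. h $ k * ?d x k m))) (at x within S)" for m x
      by (intro has_derivative_mult_right mi_power_has_derivative)
    fix m and x h :: "complex^'n" assume x: "x \<in> S"
    have xy: "cmod (x $ k) \<le> cmod (y $ k)" for k
    proof -
      have "cmod (x $ k) \<le> cmod (z $ k) + cmod ((x - z) $ k)"
        using norm_triangle_ineq[of "z $ k" "(x - z) $ k"] by simp
      also have "cmod ((x - z) $ k) \<le> \<eta>"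
        using x Finite_Cartesian_Product.norm_nth_le[of "x - z" k] by (auto simp: S_def dist_norm norm_minus_commute)
      finally show ?thesis using \<eta> by (simp add: y(2) del: of_real_add)
    qed
    have "norm (\<Sum>k\<in>UNIV. h $ k * ?d x k m) \<le> (\<Sum>k\<in>(UNIV::'n set). norm h * (real (mi_order m) * cmod (mi_power y m) / \<eta>))"
    proof (rule sum_norm_le)
      fix k
      show "norm (h $ k * ?d x k m) \<le> norm h * (real (mi_order m) * cmod (mi_power y m) / \<eta>)"
        unfolding norm_mult[of "h $ k"] using \<eta>
        by (intro mult_mono norm_dmi_power_le[OF xy] Finite_Cartesian_Product.norm_nth_le) (auto simp: y(2) simp del: of_real_add)
    qed
    then have "norm (c m) * norm (\<Sum>k\<in>UNIV. h $ k * ?d x k m) \<le> norm (c m) * (\<Sum>k\<in>(UNIV::'n set). norm h * (real (mi_order m) * cmod (mi_power y m) / \<eta>))"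
      by (rule mult_left_mono) auto
    then show "norm (c m * (\<Sum>k\<in>UNIV. h $ k * ?d x k m)) \<le> M m * norm h"
      by (simp add: M_def norm_mult mult_ac)
  qed
  moreover have "(\<Sum>\<^sub>\<infinity>m. c m * (\<Sum>k\<in>UNIV. h $ k * ?d z k m)) = (\<Sum>k\<in>UNIV. h $ k * (\<Sum>\<^sub>\<infinity>m. c m * ?d z k m))" for h
  proof -
    have "((\<lambda>m. \<Sum>k\<in>UNIV. h $ k * (c m * ?d z k m)) has_sum (\<Sum>k\<in>UNIV. h $ k * (\<Sum>\<^sub>\<infinity>m. c m * ?d z k m))) UNIV"
      using mseries_partial_summable[OF c z]
      by (intro has_sum_finite_sum has_sum_cmult_right has_sum_infsum)
    moreover have "c m * (\<Sum>k\<in>UNIV. h $ k * ?d z k m) = (\<Sum>k\<in>UNIV. h $ k * (c m * ?d z k m))" for m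
      unfolding sum_distrib_left by (intro sum.cong refl mult.left_commute)
    ultimately show ?thesis by (intro infsumI) simp
  qed
  ultimately show ?thesis by (simp only: at_within_open[OF S(3,1)])
qed

lemma has_derivative_imp_partial_deriv:
  fixes f :: "complex^'n::finite \<Rightarrow> complex"
  assumes "(f has_derivative D) (at z)" "\<And>c v. D (c *s v) = c * D v"
  shows "((\<lambda>w. f (z + axis k w)) has_field_derivative D (axis k 1)) (at 0)" "partial_deriv k f z = D (axis k 1)"
proof -
  have ax: "axis k w = w *s axis k (1::complex)" for w by (simp add: vec_eq_iff axis_def)
  have "linear (\<lambda>w::complex. axis k w :: complex^'n)"
    by (rule linearI) (simp_all add: vec_eq_iff axis_def)
  then have bl: "bounded_linear (\<lambda>w::complex. axis k w :: complex^'n)"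
    by (simp add: linear_conv_bounded_linear)
  have "((\<lambda>w. z + axis k w) has_derivative (\<lambda>w. axis k w)) (at 0)"
    by (rule has_derivative_eq_rhs[OF has_derivative_add[OF has_derivative_const bounded_linear.has_derivative[OF bl has_derivative_ident]]])
       auto
  moreover have "(f has_derivative D) (at (z + axis k 0) within range (\<lambda>w. z + axis k w))"
  proof -
    have ax0: "axis k (0::complex) = (0 :: complex^'n)" by (simp add: vec_eq_iff axis_def)
    show ?thesis unfolding ax0 add_0_right by (rule has_derivative_at_withinI[OF assms(1)])
  qed
  ultimately have "((\<lambda>w. f (z + axis k w)) has_derivative (\<lambda>w. D (axis k w))) (at 0)"
    using has_derivative_in_compose[of "\<lambda>w. z + axis k w" _ 0 UNIV f D] by simp
  moreover have "(\<lambda>w. D (axis k w)) = (*) (D (axis k 1))"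
  proof (rule ext)
    fix w
    have "D (axis k w) = D (w *s axis k 1)" by (rule arg_cong[OF ax])
    also have "\<dots> = w * D (axis k 1)" by (rule assms(2))
    finally show "D (axis k w) = D (axis k 1) * w" by (simp only: mult.commute)
  qed
  ultimately show 1: "((\<lambda>w. f (z + axis k w)) has_field_derivative D (axis k 1)) (at 0)"
    by (simp add: has_field_derivative_def)
  show "partial_deriv k f z = D (axis k 1)" unfolding partial_deriv_def by (rule DERIV_imp_deriv[OF 1])
qed

lemma mseries_partial_deriv_eq:
  assumes c: "mseries c f" and z: "z \<in> ball 0 1"
  shows "partial_deriv k f z = (\<Sum>\<^sub>\<infinity>m. c m * (of_nat (m k) * mi_power z (m(k := m k - 1))))"
proof -
  have "partial_deriv k f z = (\<Sum>j\<in>UNIV. axis k 1 $ j * (\<Sum>\<^sub>\<infinity>m. c m * (of_nat (m j) * mi_power z (m(j := m j - 1)))))"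
    by (rule has_derivative_imp_partial_deriv(2)[OF mseries_has_derivative[OF c z]])
       (simp add: sum_distrib_left mult_ac)
  also have "\<dots> = (\<Sum>j\<in>UNIV. if j = k then (\<Sum>\<^sub>\<infinity>m. c m * (of_nat (m j) * mi_power z (m(j := m j - 1)))) else 0)"
    by (intro sum.cong) (auto simp: axis_def)
  finally show ?thesis by simp
qed

text \<open>
  The radial derivative is the derivative at \<open>z\<close> in the direction \<open>z\<close>. This is why it becomes
  \<open>d/dw\<close> along \<open>w \<mapsto> e\<^sup>w z\<close>.
\<close>

lemma mseries_has_derivative_radial:
  assumes c: "mseries c f" and z: "z \<in> ball 0 1"
  obtains D where "(f has_derivative D) (at z)" "\<And>c v. D (c *s v) = c * D v" "D z = radial_deriv f z"
proof
  show "(f has_derivative (\<lambda>v. \<Sum>k\<in>UNIV. v $ k * partial_deriv k f z)) (at z)"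
    using mseries_has_derivative[OF c z] unfolding mseries_partial_deriv_eq[OF c z] .
qed (auto simp: radial_deriv_def sum_distrib_left mult_ac)

lemma mseries_partial_deriv:
  fixes c :: "('n::finite \<Rightarrow> nat) \<Rightarrow> complex"
  assumes c: "mseries c f"
  shows "mseries (\<lambda>m. of_nat (Suc (m k)) * c (m(k := Suc (m k)))) (partial_deriv k f)"
  unfolding mseries_def
proof
  fix z :: "complex^'n" assume z: "z \<in> ball 0 1"
  let ?h = "\<lambda>m::'n \<Rightarrow> nat. m(k := Suc (m k))"
  let ?F = "\<lambda>m. c m * (of_nat (m k) * mi_power z (m(k := m k - 1)))"
  have "(?F has_sum partial_deriv k f z) UNIV"
    using mseries_partial_summable[OF c z] by (simp add: mseries_partial_deriv_eq[OF c z])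
  then have "(?F has_sum partial_deriv k f z) (range ?h)"
  proof (rule has_sum_cong_neutral[THEN iffD1, rotated -1])
    fix m assume m: "m \<in> UNIV - range ?h"
    have "m k = 0"
    proof (rule ccontr)
      assume "m k \<noteq> 0"
      then have "m = ?h (m(k := m k - 1))" by (auto simp: fun_eq_iff)
      with m show False by blast
    qed
    then show "?F m = 0" by simp
  qed auto
  moreover have "inj ?h"
  proof (rule injI)
    fix a b :: "'n \<Rightarrow> nat" assume *: "?h a = ?h b"
    have "a j = b j" for j using fun_cong[OF *, of j] by (cases "j = k") auto
    then show "a = b" by blast
  qed
  ultimately have "((?F \<circ> ?h) has_sum partial_deriv k f z) UNIV" by (simp add: has_sum_reindex)
  moreover have "?F \<circ> ?h = (\<lambda>m. of_nat (Suc (m k)) * c (?h m) * mi_power z m)"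
    by (auto simp: fun_eq_iff mult_ac)
  ultimately show "((\<lambda>m. of_nat (Suc (m k)) * c (?h m) * mi_power z m) has_sum partial_deriv k f z) UNIV"
    by simp
qed

lemma mseries_radial_deriv:
  fixes c :: "('n::finite \<Rightarrow> nat) \<Rightarrow> complex"
  assumes c: "mseries c f"
  shows "mseries (\<lambda>m. of_nat (mi_order m) * c m) (radial_deriv f)"
  unfolding mseries_def
proof
  fix z :: "complex^'n" assume z: "z \<in> ball 0 1"
  have "((\<lambda>m. \<Sum>k\<in>UNIV. z $ k * (c m * (of_nat (m k) * mi_power z (m(k := m k - 1))))) has_sum radial_deriv f z) UNIV"
    unfolding radial_deriv_def using mseries_partial_summable[OF c z]
    by (intro has_sum_finite_sum has_sum_cmult_right) (simp add: mseries_partial_deriv_eq[OF c z])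
  moreover have "(\<Sum>k\<in>UNIV. z $ k * (c m * (of_nat (m k) * mi_power z (m(k := m k - 1))))) = of_nat (mi_order m) * c m * mi_power z m" for m
  proof -
    have "z $ k * (c m * (of_nat (m k) * mi_power z (m(k := m k - 1)))) = of_nat (m k) * (c m * mi_power z m)" for k
    proof (cases "m k")
      case (Suc i)
      then have "z $ k * mi_power z (m(k := m k - 1)) = mi_power z m"
        by (intro mi_power_decrement) simp
      then show ?thesis by (metis mult.left_commute)
    qed auto
    then show ?thesis by (simp only: mi_order_def of_nat_sum sum_distrib_right mult.assoc)
  qed
  ultimately show "((\<lambda>m. of_nat (mi_order m) * c m * mi_power z m) has_sum radial_deriv f z) UNIV"
    by simp
qed

lemma mseries_radial_deriv_funpow:
  "mseries c f \<Longrightarrow> mseries (\<lambda>m. of_nat (mi_order m) ^ j * c m) ((radial_deriv ^^ j) f)"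
  by (induction j) (auto dest: mseries_radial_deriv simp: mult.assoc)

lemma mseries_at_0:
  fixes c :: "('n::finite \<Rightarrow> nat) \<Rightarrow> complex"
  assumes "mseries c f" shows "f 0 = c (\<lambda>_. 0)"
proof -
  have "((\<lambda>m. c m * mi_power 0 m) has_sum f 0) UNIV" using assms by (simp add: mseries_def)
  then have "((\<lambda>m. c m * mi_power 0 m) has_sum f 0) {\<lambda>_. 0}"
    by (rule has_sum_cong_neutral[THEN iffD1, rotated -1]) (auto simp: mi_power_zero_vector)
  then show ?thesis using has_sum_unique has_sum_finite[of "{\<lambda>_. 0}" "\<lambda>m. c m * mi_power (0::complex^'n) m"] by fastforce
qed

text \<open>
  Each partial derivative shifts the coefficients and contributes one factor of the quotient of
  factorials; at the origin only the term with \<open>m = 0\<close> remains.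
\<close>

lemma mseries_foldr_partial_deriv:
  assumes "mseries c f"
  shows "mseries (\<lambda>m. (\<Prod>k\<in>UNIV. fact (m k + count_list ks k) / fact (m k)) * c (\<lambda>k. m k + count_list ks k))
    (foldr partial_deriv ks f)"
proof (induction ks)
  case (Cons a ks)
  let ?c = "\<lambda>m. (\<Prod>k\<in>UNIV. fact (m k + count_list ks k) / fact (m k)) * c (\<lambda>k. m k + count_list ks k)"
  have "of_nat (Suc (m a)) * ?c (m(a := Suc (m a))) = (\<Prod>k\<in>UNIV. fact (m k + count_list (a # ks) k) / fact (m k)) * c (\<lambda>k. m k + count_list (a # ks) k)" for m
  proof -
    have "(\<lambda>k. (m(a := Suc (m a))) k + count_list ks k) = (\<lambda>k. m k + count_list (a # ks) k)" by auto
    moreover have "of_nat (Suc (m a)) * (\<Prod>k\<in>UNIV. fact ((m(a := Suc (m a))) k + count_list ks k) / fact ((m(a := Suc (m a))) k)) =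
       (\<Prod>k\<in>UNIV. fact (m k + count_list (a # ks) k) / fact (m k) :: complex)"
      by (subst (1 2) prod.remove[of UNIV a]) (simp_all del: of_nat_Suc)
    ultimately show ?thesis by (simp only: mult.assoc[symmetric])
  qed
  then show ?case using mseries_partial_deriv[OF Cons.IH, of a] by simp
qed (use assms in simp)

text \<open>
  Uniqueness of the expansion: whatever power series represents \<open>f\<close>, its coefficients are recovered
  by iterated partial derivatives at the origin.
\<close>

lemma mseries_taylor_coeff:
  fixes c :: "('n::finite \<Rightarrow> nat) \<Rightarrow> complex"
  assumes "mseries c f" shows "taylor_coeff f m = c m"
proof -
  define ks where "ks = (SOME ks. \<forall>k. count_list ks k = m k)"
  obtain M where "count M = m" using multiset_eqI by (metis count_Abs_multiset finite_code)
  moreover obtain xs where "mset xs = M" using ex_mset by blast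
  ultimately have "\<exists>ks. \<forall>k. count_list ks k = m k" by (metis count_mset)
  then have ks: "\<forall>k. count_list ks k = m k" unfolding ks_def by (rule someI_ex)
  have "foldr partial_deriv ks f 0 = (\<Prod>k\<in>UNIV. fact (m k)) * c m"
    using mseries_at_0[OF mseries_foldr_partial_deriv[OF assms, of ks]] ks by simp
  then show ?thesis unfolding taylor_coeff_def ks_def[symmetric] by simp
qed

section \<open>Taylor expansion of holomorphic functions on the ball\<close>

lemma axis_add: "axis k (a + b) = axis k a + (axis k b :: complex^'n::finite)"
  by (simp add: vec_eq_iff axis_def)

lemma norm_axis_complex [simp]: "norm (axis k w :: complex^'n::finite) = cmod w"
proof -
  have "(\<Sum>j\<in>UNIV. (cmod ((axis k w :: complex^'n) $ j))\<^sup>2) = (\<Sum>j\<in>UNIV. if j = k then (cmod w)\<^sup>2 else 0)"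
    by (intro sum.cong) (auto simp: axis_def)
  then show ?thesis by (simp add: norm_vec_def L2_set_def)
qed

lemma continuous_on_axis: "continuous_on S (\<lambda>w::complex. axis k w :: complex^'n::finite)"
proof -
  have "linear (\<lambda>w::complex. axis k w :: complex^'n)"
    by (rule linearI) (simp_all add: vec_eq_iff axis_def)
  then show ?thesis by (simp add: linear_continuous_on linear_conv_bounded_linear)
qed

definition coordinate_disc :: "complex^'n::finite \<Rightarrow> 'n \<Rightarrow> complex set" where
  "coordinate_disc z k = {w. z + axis k w \<in> ball 0 1}"

lemma open_coordinate_disc: "open (coordinate_disc z k)"
proof -
  have "open ((\<lambda>w. z + axis k w) -` ball 0 1)"
    by (rule open_vimage[OF open_ball continuous_on_add[OF continuous_on_const continuous_on_axis]])
  then show ?thesis by (simp add: coordinate_disc_def vimage_def)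
qed

text \<open>
  A class that contains the holomorphic functions and is visibly stable under partial derivatives,
  so that the expansion can be built one variable at a time. Local boundedness is what makes
  Cauchy's inequalities uniform in the other variables.
\<close>

definition separately_holomorphic :: "(complex^'n::finite \<Rightarrow> complex) \<Rightarrow> bool" where
  "separately_holomorphic f \<longleftrightarrow>
     (\<forall>z\<in>ball 0 1. \<forall>k. (\<lambda>w. f (z + axis k w)) field_differentiable at 0) \<and>
     (\<forall>z\<in>ball 0 1. \<exists>e>0. \<exists>M. \<forall>y\<in>ball z e. cmod (f y) \<le> M)"

lemma separately_holomorphic_has_deriv:
  assumes f: "separately_holomorphic f" and w: "w \<in> coordinate_disc z k"
  shows "((\<lambda>w. f (z + axis k w)) has_field_derivative partial_deriv k f (z + axis k w)) (at w)"
proof -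
  have "(\<lambda>v. f ((z + axis k w) + axis k v)) field_differentiable at 0"
    using f w unfolding separately_holomorphic_def coordinate_disc_def by blast
  then have "((\<lambda>v. f ((z + axis k w) + axis k v)) has_field_derivative partial_deriv k f (z + axis k w)) (at 0)"
    unfolding partial_deriv_def by (simp add: DERIV_deriv_iff_field_differentiable)
  moreover have "(\<lambda>v. f ((z + axis k w) + axis k v)) = (\<lambda>v. f (z + axis k (v + w)))"
    by (simp add: axis_add add_ac)
  ultimately show ?thesis using DERIV_shift[of "\<lambda>w. f (z + axis k w)" "partial_deriv k f (z + axis k w)" 0 w]
    by simp
qed

lemma separately_holomorphic_on_disc:
  assumes "separately_holomorphic f"
  shows "(\<lambda>w. f (z + axis k w)) holomorphic_on coordinate_disc z k"
  using separately_holomorphic_has_deriv[OF assms]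
  by (metis holomorphic_on_open open_coordinate_disc)

lemma higher_deriv_coordinate:
  assumes hol: "\<And>j. separately_holomorphic ((partial_deriv k ^^ j) f)" and w: "w \<in> coordinate_disc z k"
  shows "(deriv ^^ j) (\<lambda>w. f (z + axis k w)) w = (partial_deriv k ^^ j) f (z + axis k w)"
  using w
proof (induction j arbitrary: w)
  case (Suc j)
  have "eventually (\<lambda>u. u \<in> coordinate_disc z k) (nhds w)"
    using open_coordinate_disc Suc.prems by (rule eventually_nhds_in_open)
  then have "eventually (\<lambda>u. (deriv ^^ j) (\<lambda>w. f (z + axis k w)) u = (partial_deriv k ^^ j) f (z + axis k u)) (nhds w)"
    by (rule eventually_mono) (rule Suc.IH)
  then have "deriv ((deriv ^^ j) (\<lambda>w. f (z + axis k w))) w = deriv (\<lambda>u. (partial_deriv k ^^ j) f (z + axis k u)) w"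
    by (rule deriv_cong_ev) simp
  then show ?case using DERIV_imp_deriv[OF separately_holomorphic_has_deriv[OF hol Suc.prems]] by simp
qed simp

text \<open>
  The second derivative is bounded by Cauchy's inequality, and Taylor's formula of first order gives
  the rate of convergence of the difference quotients in terms of the supremum of \<open>h\<close> only.
\<close>

lemma difference_quotient_bound:
  assumes h: "h holomorphic_on ball 0 (2*r)" and M: "\<And>w. w \<in> ball 0 (2*r) \<Longrightarrow> cmod (h w) \<le> M"
    and t: "cmod t \<le> r / 2" "t \<noteq> 0" and r: "r > 0"
  shows "cmod ((h t - h 0) / t - deriv h 0) \<le> 8 * M / r\<^sup>2 * cmod t"
proof -
  let ?S = "ball (0::complex) (2*r)"
  define F where "F i = (deriv ^^ i) h" for i
  have bd: "cmod (F 2 w) \<le> 8 * M / r\<^sup>2" if w: "w \<in> cball 0 (r/2)" for w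
  proof -
    have sub: "cball w (r/2) \<subseteq> ?S"
    proof
      fix x assume "x \<in> cball w (r/2)"
      then show "x \<in> ?S" using w r norm_triangle_ineq[of "x - w" w] by (simp add: dist_norm norm_minus_commute)
    qed
    have "norm ((deriv ^^ 2) h w) \<le> fact 2 * M / (r/2)^2"
    proof (rule Cauchy_inequality)
      show "h holomorphic_on ball w (r/2)" using h sub holomorphic_on_subset ball_subset_cball by blast
      show "continuous_on (cball w (r/2)) h" using h sub holomorphic_on_subset holomorphic_on_imp_continuous_on by blast
      show "norm (h x) \<le> M" if "norm (w - x) = r/2" for x using that sub by (intro M) (auto simp: dist_norm)
    qed (use r in auto)
    then show ?thesis by (simp add: F_def field_simps)
  qed
  have "cmod (F 0 t - (\<Sum>i\<le>1. F i 0 * (t - 0) ^ i / fact i)) \<le> 8 * M / r\<^sup>2 * cmod (t - 0) ^ Suc 1 / fact 1"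
  proof (rule complex_Taylor[where S = "cball 0 (r/2)"])
    fix i and x :: complex assume x: "x \<in> cball 0 (r/2)"
    have "F i holomorphic_on ?S" unfolding F_def by (rule holomorphic_higher_deriv[OF h open_ball])
    moreover have "x \<in> ?S" using x r by auto
    ultimately show "(F i has_field_derivative F (Suc i) x) (at x within cball 0 (r/2))"
      unfolding F_def by (simp add: holomorphic_derivI has_field_derivative_at_within)
  qed (use bd t r in \<open>auto simp: numeral_2_eq_2\<close>)
  then have *: "cmod (h t - h 0 - deriv h 0 * t) \<le> 8 * M / r\<^sup>2 * (cmod t * cmod t)"
    by (simp add: F_def algebra_simps)
  have "(h t - h 0) / t - deriv h 0 = (h t - h 0 - deriv h 0 * t) / t" using t by (simp add: field_simps)
  then have "cmod ((h t - h 0) / t - deriv h 0) = cmod (h t - h 0 - deriv h 0 * t) / cmod t" by (simp add: norm_divide)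
  also have "\<dots> \<le> 8 * M / r\<^sup>2 * (cmod t * cmod t) / cmod t" using * by (rule divide_right_mono) simp
  finally show ?thesis using t by simp
qed

text \<open>
  In direction \<open>l\<close>, the partial derivative in direction \<open>k\<close> is a uniform limit of holomorphic
  difference quotients, with a rate that depends only on a local bound of \<open>f\<close>.
\<close>

lemma separately_holomorphic_partial_deriv:
  fixes f :: "complex^'n::finite \<Rightarrow> complex"
  assumes f: "separately_holomorphic f"
  shows "separately_holomorphic (partial_deriv k f)"
proof -
  have *: "(\<forall>l. (\<lambda>w. partial_deriv k f (z + axis l w)) field_differentiable at 0) \<and>
      (\<exists>e>0. \<exists>M. \<forall>y\<in>ball z e. cmod (partial_deriv k f y) \<le> M)" if z: "z \<in> ball 0 1" for z
  proof -
    obtain e0 M where e0: "e0 > 0" "\<And>y. y \<in> ball z e0 \<Longrightarrow> cmod (f y) \<le> M"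
      using f z unfolding separately_holomorphic_def by blast
    define r where "r = min e0 (1 - norm z) / 4"
    have r: "r > 0" using e0 z by (simp add: r_def)
    have in_ball: "y \<in> ball 0 1 \<and> cmod (f y) \<le> M" if "dist z y < 4 * r" for y
    proof
      have "dist 0 y \<le> dist 0 z + dist z y" by (rule dist_triangle)
      then show "y \<in> ball 0 1" using that by (simp add: r_def)
      show "cmod (f y) \<le> M" using that by (intro e0) (simp add: r_def)
    qed
    have near: "(y + axis k w) \<in> ball 0 1 \<and> cmod (f (y + axis k w)) \<le> M" if "dist z y < 2 * r" "w \<in> ball 0 (2*r)" for y w
    proof (rule in_ball)
      have "dist z (y + axis k w) \<le> dist z y + dist y (y + axis k w)" by (rule dist_triangle)
      then show "dist z (y + axis k w) < 4 * r" using that by (simp add: dist_norm)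
    qed
    have hol: "(\<lambda>w. f (y + axis k w)) holomorphic_on ball 0 (2*r)" if "dist z y < 2 * r" for y
      using near[OF that] by (intro holomorphic_on_subset[OF separately_holomorphic_on_disc[OF f, of y k]])
        (auto simp: coordinate_disc_def)
    have dq: "cmod ((f (y + axis k t) - f y) / t - partial_deriv k f y) \<le> 8 * M / r\<^sup>2 * cmod t"
      if "dist z y < 2 * r" "cmod t \<le> r/2" "t \<noteq> 0" for y t
    proof -
      have ax0: "axis k (0::complex) = (0 :: complex^'n)" by (simp add: vec_eq_iff axis_def)
      show ?thesis
        using difference_quotient_bound[OF hol[OF that(1)] _ that(2,3) r, of M] near[OF that(1)]
        unfolding partial_deriv_def by (simp only: ax0 add_0_right)
    qed
    have bdd: "cmod (partial_deriv k f y) \<le> M / r" if "y \<in> ball z r" for y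
    proof -
      have d: "dist z y < 2 * r" using that r by simp
      have "norm ((deriv ^^ 1) (\<lambda>w. f (y + axis k w)) 0) \<le> fact 1 * M / r ^ 1"
      proof (rule Cauchy_inequality)
        show "(\<lambda>w. f (y + axis k w)) holomorphic_on ball 0 r"
          using r by (intro holomorphic_on_subset[OF hol[OF d]]) auto
        show "continuous_on (cball 0 r) (\<lambda>w. f (y + axis k w))"
          using r by (intro holomorphic_on_imp_continuous_on holomorphic_on_subset[OF hol[OF d]]) auto
        show "cmod (f (y + axis k x)) \<le> M" if "norm (0 - x) = r" for x
          using near[OF d, of x] that r by auto
      qed (use r in auto)
      then show ?thesis by (simp add: partial_deriv_def)
    qed
    have "(\<lambda>w. partial_deriv k f (z + axis l w)) field_differentiable at 0" for l
    proof -
      obtain N where N: "1 / real (Suc N) < r / 2" using r nat_approx_posE by (metis half_gt_zero)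
      define t where "t n = (1 / of_nat (Suc (n + N)) :: complex)" for n
      have t0: "t n \<noteq> 0" for n unfolding t_def by (simp del: of_nat_Suc)
      have tb: "cmod (t n) = 1 / real (Suc (n + N))" for n unfolding t_def by (simp add: norm_divide del: of_nat_Suc)
      have t: "cmod (t n) \<le> r / 2" for n
      proof -
        have "1 / real (Suc (n + N)) \<le> 1 / real (Suc N)" by (simp add: frac_le)
        then show ?thesis using N tb by simp
      qed
      have tlim: "(\<lambda>n. 8 * M / r\<^sup>2 * cmod (t n)) \<longlonglongrightarrow> 0"
      proof -
        have "(\<lambda>n. 1 / real (Suc (n + N))) \<longlonglongrightarrow> 0"
          using LIMSEQ_ignore_initial_segment[OF lim_inverse_n', of "Suc N"] by simp
        then show ?thesis unfolding tb by (intro tendsto_mult_right_zero)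
      qed
      have dz: "dist z (z + axis l w) < r" if "w \<in> ball 0 r" for w :: complex using that by (simp add: dist_norm)
      have "(\<lambda>w. partial_deriv k f (z + axis l w)) holomorphic_on ball 0 r"
      proof (rule holomorphic_uniform_sequence[OF open_ball])
        fix n
        have 1: "(\<lambda>w. f (z + axis l w)) holomorphic_on ball 0 r"
        proof (rule holomorphic_on_subset[OF separately_holomorphic_on_disc[OF f, of z l]])
          show "ball 0 r \<subseteq> coordinate_disc z l" 
            using dz in_ball r by (fastforce simp: coordinate_disc_def)
        qed
        have 2: "(\<lambda>w. f (z + axis k (t n) + axis l w)) holomorphic_on ball 0 r"
        proof (rule holomorphic_on_subset[OF separately_holomorphic_on_disc[OF f, of _ l]])
          show "ball 0 r \<subseteq> coordinate_disc (z + axis k (t n)) l"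
          proof
            fix w :: complex assume w: "w \<in> ball 0 r"
            have "(z + axis l w) + axis k (t n) \<in> ball 0 1"
              using near[of "z + axis l w" "t n"] dz[OF w] t[of n] r by simp
            then show "w \<in> coordinate_disc (z + axis k (t n)) l"
              by (simp add: coordinate_disc_def add_ac)
          qed
        qed
        show "(\<lambda>w. (f (z + axis k (t n) + axis l w) - f (z + axis l w)) / t n) holomorphic_on ball 0 r"
          using t0 by (intro holomorphic_intros 1 2) auto
      next
        fix x :: complex assume x: "x \<in> ball 0 r"
        obtain d where d: "d > 0" "cball x d \<subseteq> ball 0 r" using x open_ball open_contains_cball by blast
        have "uniform_limit (cball x d) (\<lambda>n w. (f (z + axis k (t n) + axis l w) - f (z + axis l w)) / t n)
           (\<lambda>w. partial_deriv k f (z + axis l w)) sequentially"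
          unfolding uniform_limit_iff
        proof (intro allI impI)
          fix e :: real assume "e > 0"
          then have "eventually (\<lambda>n. 8 * M / r\<^sup>2 * cmod (t n) < e) sequentially"
            using order_tendstoD(2)[OF tlim] by blast
          then show "\<forall>\<^sub>F n in sequentially. \<forall>w\<in>cball x d. dist ((f (z + axis k (t n) + axis l w) - f (z + axis l w)) / t n)
             (partial_deriv k f (z + axis l w)) < e"
          proof (rule eventually_mono, intro ballI)
            fix n w assume n: "8 * M / r\<^sup>2 * cmod (t n) < e" and "w \<in> cball x d"
            then have "w \<in> ball 0 r" using d by blast
            then have "dist z (z + axis l w) < 2 * r" using dz r by fastforce
            from order.strict_trans1[OF dq[OF this t[of n] t0[of n]] n]
            show "dist ((f (z + axis k (t n) + axis l w) - f (z + axis l w)) / t n) (partial_deriv k f (z + axis l w)) < e"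
              unfolding dist_norm by (simp only: add.assoc add.commute[of "axis k (t n)"])
          qed
        qed
        with d show "\<exists>d>0. cball x d \<subseteq> ball 0 r \<and> uniform_limit (cball x d)
             (\<lambda>n w. (f (z + axis k (t n) + axis l w) - f (z + axis l w)) / t n)
             (\<lambda>w. partial_deriv k f (z + axis l w)) sequentially" by blast
      qed
      then show ?thesis using r by (simp add: holomorphic_on_imp_differentiable_at)
    qed
    with bdd r show ?thesis by blast
  qed
  then show ?thesis unfolding separately_holomorphic_def by blast
qed

lemma separately_holomorphic_funpow:
  "separately_holomorphic f \<Longrightarrow> separately_holomorphic ((partial_deriv k ^^ j) f)"
  by (induction j) (auto intro: separately_holomorphic_partial_deriv)

lemma hol_ball_separately_holomorphic:
  assumes "f \<in> hol_ball" shows "separately_holomorphic f"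
  unfolding separately_holomorphic_def
proof (intro conjI ballI allI)
  fix z :: "complex^'a" assume "z \<in> ball 0 1"
  then obtain D where D: "(f has_derivative D) (at z)" "\<And>c v. D (c *s v) = c * D v"
    using assms unfolding hol_ball_def by blast
  show "(\<lambda>w. f (z + axis k w)) field_differentiable at 0" for k
    using has_derivative_imp_partial_deriv(1)[OF D] field_differentiable_def by blast
  have "isCont f z" using D(1) has_derivative_continuous by blast
  then obtain e where e: "e > 0" "\<And>y. dist y z < e \<Longrightarrow> dist (f y) (f z) < 1"
    unfolding continuous_at_eps_delta by (metis zero_less_one)
  show "\<exists>e>0. \<exists>M. \<forall>y\<in>ball z e. cmod (f y) \<le> M"
  proof (intro exI conjI ballI)
    fix y assume "y \<in> ball z e"
    then have "dist (f y) (f z) < 1" using e by (simp add: dist_commute)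
    then show "cmod (f y) \<le> cmod (f z) + 1" using norm_triangle_ineq[of "f y - f z" "f z"] by (simp add: dist_norm)
  qed (fact e(1))
qed

lemma separately_holomorphic_bounded:
  fixes f :: "complex^'n::finite \<Rightarrow> complex"
  assumes f: "separately_holomorphic f" and "\<rho> < 1"
  obtains M where "\<And>z. z \<in> cball 0 \<rho> \<Longrightarrow> cmod (f z) \<le> M"
proof -
  \<comment> \<open>Cover the compact ball by finitely many balls on which \<open>f\<close> is bounded.\<close>
  have "\<forall>z\<in>cball 0 \<rho>. \<exists>e. e > 0 \<and> (\<exists>M. \<forall>y\<in>ball z e. cmod (f y) \<le> M)"
    using f assms(2) unfolding separately_holomorphic_def by auto
  then obtain e where e: "\<And>z. z \<in> cball 0 \<rho> \<Longrightarrow> e z > 0 \<and> (\<exists>M. \<forall>y\<in>ball z (e z). cmod (f y) \<le> M)"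
    by metis
  then obtain M where M: "\<And>z y. z \<in> cball 0 \<rho> \<Longrightarrow> y \<in> ball z (e z) \<Longrightarrow> cmod (f y) \<le> M z" by metis
  have cov: "cball 0 \<rho> \<subseteq> (\<Union>z\<in>cball 0 \<rho>. ball z (e z))" using e by fastforce
  obtain Z where Z: "Z \<subseteq> cball 0 \<rho>" "finite Z" "cball 0 \<rho> \<subseteq> (\<Union>z\<in>Z. ball z (e z))"
    by (rule compactE_image[OF compact_cball _ cov]) auto
  show ?thesis
  proof
    fix y :: "complex^'n" assume "y \<in> cball 0 \<rho>"
    then obtain z where z: "z \<in> Z" "y \<in> ball z (e z)" using Z by blast
    then have "cmod (f y) \<le> M z" using M Z by blast
    also have "M z \<le> \<bar>M z\<bar>" by simp
    also have "\<bar>M z\<bar> \<le> (\<Sum>z\<in>Z. \<bar>M z\<bar>)" using z Z by (intro member_le_sum) auto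
    finally show "cmod (f y) \<le> (\<Sum>z\<in>Z. \<bar>M z\<bar>)" .
  qed
qed

text \<open>
  An infinite sum without limit has the value \<open>0\<close>, whereas the product formula gives the nonzero
  value \<open>\<Prod> 1 / (1 - q k)\<close>; so the family must be summable.
\<close>

lemma geometric_multi_index_summable:
  fixes q :: "'n::finite \<Rightarrow> real"
  assumes "\<And>k. 0 \<le> q k" "\<And>k. q k < 1"
  shows "(\<lambda>m. \<Prod>k\<in>UNIV. q k ^ m k) summable_on UNIV"
proof (rule ccontr)
  assume "\<not> ?thesis"
  then have 0: "(\<Sum>\<^sub>\<infinity>m. \<Prod>k\<in>UNIV. q k ^ m k) = 0" by (rule infsum_not_exists)
  have s: "((^) (q k) has_sum (1 / (1 - q k))) UNIV" for k
    using geometric_sums[of "q k"] assms[of k] by (intro sums_nonneg_imp_has_sum) auto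
  have "(\<Sum>\<^sub>\<infinity>m\<in>PiE UNIV (\<lambda>_. UNIV). \<Prod>k\<in>UNIV. q k ^ m k) = (\<Prod>k\<in>UNIV. \<Sum>\<^sub>\<infinity>j. q k ^ j)"
    using s assms by (intro infsum_prod_PiE_abs) (auto intro: has_sum_imp_summable[OF s])
  also have "\<dots> = (\<Prod>k\<in>UNIV. 1 / (1 - q k))" using infsumI[OF s] by simp
  also have "\<dots> \<noteq> 0" using assms(2) by (simp add: less_imp_neq[OF assms(2), symmetric])
  finally show False using 0 by simp
qed

text \<open>
  On the hyperplane \<open>z $ k = 0\<close> the coordinate disc is a disc about the origin, so the power
  series in the coordinate \<open>k\<close> converges up to the boundary of the ball.
\<close>

lemma norm_axis_add_Pythagoras:
  fixes z :: "complex^'n::finite" and w :: complex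
  assumes "z $ k = 0" shows "(norm (z + axis k w))\<^sup>2 = (norm z)\<^sup>2 + (cmod w)\<^sup>2"
proof -
  have "(\<Sum>j\<in>UNIV. (cmod ((z + axis k w) $ j))\<^sup>2) = (\<Sum>j\<in>UNIV. (cmod (z $ j))\<^sup>2 + (if j = k then (cmod w)\<^sup>2 else 0))"
    using assms by (intro sum.cong) (auto simp: axis_def)
  also have "\<dots> = (\<Sum>j\<in>UNIV. (cmod (z $ j))\<^sup>2) + (cmod w)\<^sup>2" by (simp add: sum.distrib)
  finally show ?thesis by (simp add: norm_vec_def L2_set_def sum_nonneg)
qed

lemma coordinate_power_series:
  fixes f :: "complex^'n::finite \<Rightarrow> complex"
  assumes f: "separately_holomorphic f" and z: "z $ k = 0" "z + axis k w \<in> ball 0 1"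
  shows "(\<lambda>j. (partial_deriv k ^^ j) f z / fact j * w ^ j) sums f (z + axis k w)"
proof -
  define R where "R = sqrt (1 - (norm z)\<^sup>2)"
  have "(norm (z + axis k w))\<^sup>2 < 1" using z(2) by (simp add: power_less_one_iff abs_square_less_1)
  then have zR: "(norm z)\<^sup>2 + (cmod w)\<^sup>2 < 1" by (simp only: norm_axis_add_Pythagoras[OF z(1)])
  have disc: "coordinate_disc z k = ball 0 R"
  proof -
    have "z + axis k u \<in> ball 0 1 \<longleftrightarrow> u \<in> ball 0 R" for u
    proof -
      have "z + axis k u \<in> ball 0 1 \<longleftrightarrow> (norm (z + axis k u))\<^sup>2 < 1" by (simp add: power_less_one_iff abs_square_less_1)
      also have "\<dots> \<longleftrightarrow> (cmod u)\<^sup>2 < 1 - (norm z)\<^sup>2" by (simp only: norm_axis_add_Pythagoras[OF z(1)]) auto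
      also have "\<dots> \<longleftrightarrow> cmod u < R"
        unfolding R_def by (metis abs_norm_cancel real_sqrt_abs real_sqrt_less_iff)
      finally show ?thesis by simp
    qed
    then show ?thesis unfolding coordinate_disc_def by (intro set_eqI) (simp only: mem_Collect_eq)
  qed
  have w: "w \<in> ball 0 R" using z(2) unfolding disc[symmetric] coordinate_disc_def by blast
  then have R: "0 < R" using order.strict_trans1[OF norm_ge_zero, of w R] by simp
  have ax0: "axis k (0::complex) = (0 :: complex^'n)" by (simp add: vec_eq_iff axis_def)
  have 0: "0 \<in> coordinate_disc z k" using R disc by simp
  have "(\<lambda>j. (deriv ^^ j) (\<lambda>w. f (z + axis k w)) 0 / fact j * (w - 0) ^ j) sums f (z + axis k w)"
    using separately_holomorphic_on_disc[OF f, of z k] unfolding disc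
    by (rule holomorphic_power_series[OF _ w])
  then show ?thesis
    by (simp only: higher_deriv_coordinate[OF separately_holomorphic_funpow[OF f] 0] ax0 add_0_right diff_zero)
qed

lemma norm_le_of_components:
  fixes x y :: "complex^'n::finite"
  assumes "\<And>k. cmod (x $ k) \<le> cmod (y $ k)" shows "norm x \<le> norm y"
  unfolding norm_vec_def by (intro L2_set_mono assms) auto

text \<open>
  An expansion of the restriction of \<open>f\<close> to the coordinate subspace of \<open>S\<close>. The last clause states
  Cauchy's inequalities on polydiscs in that subspace: they are what carries absolute convergence
  through the induction on \<open>S\<close>. The radii are the moduli of the coordinates of \<open>r\<close>.
\<close>

definition expansion_on :: "'n set \<Rightarrow> (complex^'n::finite \<Rightarrow> complex) \<Rightarrow> (('n \<Rightarrow> nat) \<Rightarrow> complex) \<Rightarrow> bool" where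
  "expansion_on S f c \<longleftrightarrow>
     (\<forall>m. c m \<noteq> 0 \<longrightarrow> (\<forall>k. k \<notin> S \<longrightarrow> m k = 0)) \<and>
     (\<forall>z\<in>ball 0 1. (\<forall>k. k \<notin> S \<longrightarrow> z $ k = 0) \<longrightarrow> ((\<lambda>m. c m * mi_power z m) has_sum f z) UNIV) \<and>
     (\<forall>M r. r \<in> ball 0 1 \<and> (\<forall>k. r $ k \<noteq> 0) \<and>
        (\<forall>z. (\<forall>k. k \<notin> S \<longrightarrow> z $ k = 0) \<and> (\<forall>k. cmod (z $ k) \<le> cmod (r $ k)) \<longrightarrow> cmod (f z) \<le> M) \<longrightarrow>
        (\<forall>m. cmod (c m) * cmod (mi_power r m) \<le> M))"

lemma expansion_onI:
  assumes "\<And>m k. c m \<noteq> 0 \<Longrightarrow> k \<notin> S \<Longrightarrow> m k = 0"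
    and "\<And>z. z \<in> ball 0 1 \<Longrightarrow> (\<And>k. k \<notin> S \<Longrightarrow> z $ k = 0) \<Longrightarrow> ((\<lambda>m. c m * mi_power z m) has_sum f z) UNIV"
    and "\<And>M r m. r \<in> ball 0 1 \<Longrightarrow> (\<And>k. r $ k \<noteq> 0) \<Longrightarrow>
        (\<And>z. (\<And>k. k \<notin> S \<Longrightarrow> z $ k = 0) \<Longrightarrow> (\<And>k. cmod (z $ k) \<le> cmod (r $ k)) \<Longrightarrow> cmod (f z) \<le> M) \<Longrightarrow>
        cmod (c m) * cmod (mi_power r m) \<le> M"
  shows "expansion_on S f c"
  unfolding expansion_on_def
  by (intro conjI allI impI ballI assms; (elim conjE)?) (simp_all add: assms(3))

lemma expansion_on_support:
  assumes "expansion_on S f c" "c m \<noteq> 0" "k \<notin> S" shows "m k = 0"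
  using assms unfolding expansion_on_def by simp

lemma expansion_on_has_sum:
  assumes "expansion_on S f c" "z \<in> ball 0 1" "\<And>k. k \<notin> S \<Longrightarrow> z $ k = 0"
  shows "((\<lambda>m. c m * mi_power z m) has_sum f z) UNIV"
  using assms unfolding expansion_on_def by simp

lemma expansion_on_bound:
  assumes c: "expansion_on S f c" and r: "r \<in> ball 0 1" "\<And>k. r $ k \<noteq> 0"
    and M: "\<And>z. \<forall>k. k \<notin> S \<longrightarrow> z $ k = 0 \<Longrightarrow> \<forall>k. cmod (z $ k) \<le> cmod (r $ k) \<Longrightarrow> cmod (f z) \<le> M"
  shows "cmod (c m) * cmod (mi_power r m) \<le> M"
proof -
  have "r \<in> ball 0 1 \<and> (\<forall>k. r $ k \<noteq> 0) \<and>
        (\<forall>z. (\<forall>k. k \<notin> S \<longrightarrow> z $ k = 0) \<and> (\<forall>k. cmod (z $ k) \<le> cmod (r $ k)) \<longrightarrow> cmod (f z) \<le> M)"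
    using r M by auto
  then show ?thesis using c[unfolded expansion_on_def, THEN conjunct2, THEN conjunct2, rule_format, of r M m] by fast
qed

text \<open>
  Expand in the coordinate \<open>k\<close> at \<open>z $ k = 0\<close>, then each coefficient \<open>\<partial>\<^sub>k\<^sup>j f / j!\<close> in the coordinates
  of \<open>S\<close>. The inequalities of Cauchy in one variable and those for \<open>S\<close> multiply to those for
  \<open>insert k S\<close>; these make the double series absolutely convergent, so that it may be rearranged into
  a series over multi-indices.
\<close>

lemma expansion_on_insert:
  fixes f :: "complex^'n::finite \<Rightarrow> complex"
  assumes k: "k \<notin> S" and f: "separately_holomorphic f"
    and C: "\<And>j. expansion_on S ((partial_deriv k ^^ j) f) (C j)"
  shows "expansion_on (insert k S) f (\<lambda>m. C (m k) (m(k := 0)) / fact (m k))"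
proof -
  define c where "c = (\<lambda>m. C (m k) (m(k := 0)) / fact (m k))"
  have supp: "\<forall>m. c m \<noteq> 0 \<longrightarrow> (\<forall>l. l \<notin> insert k S \<longrightarrow> m l = 0)"
  proof (intro allI impI)
    fix m l assume *: "c m \<noteq> 0" "l \<notin> insert k S"
    then have "C (m k) (m(k := 0)) \<noteq> 0" by (auto simp: c_def)
    then have "(m(k := 0)) l = 0" using *(2) by (intro expansion_on_support[OF C[of "m k"]]) blast+
    then show "m l = 0" using *(2) by auto
  qed
  have bound: "cmod (c m) * cmod (mi_power r m) \<le> M"
    if r: "r \<in> ball 0 1" "\<And>l. r $ l \<noteq> 0"
      and M: "\<And>z. (\<And>l. l \<notin> insert k S \<Longrightarrow> z $ l = 0) \<Longrightarrow> (\<And>l. cmod (z $ l) \<le> cmod (r $ l)) \<Longrightarrow> cmod (f z) \<le> M" for M r m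
  proof -
    define j where "j = m k"
    define \<rho> where "\<rho> = cmod (r $ k)"
    have \<rho>: "\<rho> > 0" using r(2) by (simp add: \<rho>_def)
    have "cmod ((partial_deriv k ^^ j) f z) \<le> fact j * M / \<rho> ^ j"
      if z: "\<forall>l. l \<notin> S \<longrightarrow> z $ l = 0" "\<forall>l. cmod (z $ l) \<le> cmod (r $ l)" for z
    proof -
      have zk: "z $ k = 0" using z(1) k by blast
      have comp: "cmod ((z + axis k w) $ l) \<le> cmod (r $ l)" if "w \<in> cball 0 \<rho>" for w :: complex and l
        using that z(2) zk by (cases "l = k") (auto simp: axis_def \<rho>_def)
      have sub: "cball 0 \<rho> \<subseteq> coordinate_disc z k"
      proof
        fix w :: complex assume "w \<in> cball 0 \<rho>"
        then have "norm (z + axis k w) \<le> norm r" by (intro norm_le_of_components comp)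
        then show "w \<in> coordinate_disc z k" using r(1) by (simp add: coordinate_disc_def)
      qed
      have 0: "0 \<in> coordinate_disc z k" using sub \<rho> by auto
      have ax0: "axis k (0::complex) = (0 :: complex^'n)" by (simp add: vec_eq_iff axis_def)
      have hol: "(\<lambda>w. f (z + axis k w)) holomorphic_on cball 0 \<rho>"
        using separately_holomorphic_on_disc[OF f] sub holomorphic_on_subset by blast
      have "norm ((deriv ^^ j) (\<lambda>w. f (z + axis k w)) 0) \<le> fact j * M / \<rho> ^ j"
      proof (rule Cauchy_inequality)
        show "(\<lambda>w. f (z + axis k w)) holomorphic_on ball 0 \<rho>" using hol ball_subset_cball holomorphic_on_subset by blast
        show "continuous_on (cball 0 \<rho>) (\<lambda>w. f (z + axis k w))" by (rule holomorphic_on_imp_continuous_on[OF hol])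
        fix w :: complex assume "norm (0 - w) = \<rho>"
        then have w: "w \<in> cball 0 \<rho>" by simp
        show "cmod (f (z + axis k w)) \<le> M"
          using z(1) by (intro M comp[OF w]) (auto simp: axis_def)
      qed (use \<rho> in auto)
      then show ?thesis
        by (simp only: higher_deriv_coordinate[OF separately_holomorphic_funpow[OF f] 0] ax0 add_0_right)
    qed
    then have "cmod (C j (m(k := 0))) * cmod (mi_power r (m(k := 0))) \<le> fact j * M / \<rho> ^ j"
      by (intro expansion_on_bound[OF C[of j] r])
    then have "cmod (C j (m(k := 0))) * cmod (mi_power r (m(k := 0))) / fact j * \<rho> ^ j \<le> M"
      using \<rho> by (simp add: field_simps)
    moreover have "cmod (mi_power r m) = \<rho> ^ j * cmod (mi_power r (m(k := 0)))"
      unfolding mi_power_upd mi_power_remove[of r m k] by (simp add: norm_mult norm_power \<rho>_def j_def)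
    ultimately show ?thesis by (simp add: c_def j_def[symmetric] norm_divide mult_ac)
  qed
  have sum: "((\<lambda>m. c m * mi_power z m) has_sum f z) UNIV"
    if z: "z \<in> ball 0 1" "\<And>l. l \<notin> insert k S \<Longrightarrow> z $ l = 0" for z
  proof -
    obtain \<eta> r where \<eta>: "\<eta> > 0" and r: "r \<in> ball (0 :: complex^'n) 1" "\<And>l. r $ l = of_real (cmod (z $ l) + \<eta>)"
      by (rule ball_dominating_radii[OF z(1)]) (rule that)
    have cr: "cmod (r $ l) = cmod (z $ l) + \<eta>" for l using \<eta> by (simp add: r(2) del: of_real_add)
    have rpos: "cmod (r $ l) > 0" for l unfolding cr using \<eta> by (simp add: add_nonneg_pos)
    obtain M where M: "\<And>z. z \<in> cball 0 (norm r) \<Longrightarrow> cmod (f z) \<le> M"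
      by (rule separately_holomorphic_bounded[OF f, of "norm r"]) (use r(1) in auto)
    define q where "q l = cmod (z $ l) / cmod (r $ l)" for l
    have q: "0 \<le> q l" "q l < 1" for l using \<eta> rpos[of l] by (auto simp: q_def cr field_simps)
    have cb: "cmod (c m) * cmod (mi_power r m) \<le> M" for m
    proof (rule bound[OF r(1)])
      show "r $ l \<noteq> 0" for l using rpos[of l] by auto
      show "cmod (f x) \<le> M" if "\<And>l. cmod (x $ l) \<le> cmod (r $ l)" for x
        by (rule M) (simp add: norm_le_of_components that)
    qed
    have summ: "(\<lambda>m. c m * mi_power z m) summable_on UNIV"
    proof (rule abs_summable_summable[OF summable_on_comparison_test])
      show "(\<lambda>m. M * (\<Prod>l\<in>UNIV. q l ^ m l)) summable_on UNIV"
        by (intro summable_on_cmult_right geometric_multi_index_summable q)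
      fix m
      have "cmod (mi_power z m) = cmod (mi_power r m) * (\<Prod>l\<in>UNIV. q l ^ m l)"
        unfolding cmod_mi_power prod.distrib[symmetric] power_mult_distrib[symmetric]
        by (intro prod.cong refl arg_cong2[where f = power]) (use rpos in \<open>auto simp: q_def\<close>)
      then have "norm (c m * mi_power z m) = (cmod (c m) * cmod (mi_power r m)) * (\<Prod>l\<in>UNIV. q l ^ m l)"
        by (simp add: norm_mult)
      also have "\<dots> \<le> M * (\<Prod>l\<in>UNIV. q l ^ m l)" using q by (intro mult_right_mono cb prod_nonneg) auto
      finally show "norm (c m * mi_power z m) \<le> M * (\<Prod>l\<in>UNIV. q l ^ m l)" .
    qed auto
    then obtain s where s: "((\<lambda>m. c m * mi_power z m) has_sum s) UNIV" by (auto simp: summable_on_def)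
    define z' where "z' = z - axis k (z $ k)"
    have z'k: "z' $ k = 0" and z'l: "\<And>l. l \<noteq> k \<Longrightarrow> z' $ l = z $ l" by (auto simp: z'_def axis_def)
    have zz': "z = z' + axis k (z $ k)" by (simp add: z'_def)
    have "norm z' \<le> norm z" by (intro norm_le_of_components) (metis z'k z'l norm_ge_zero norm_zero order_refl)
    then have z'b: "z' \<in> ball 0 1" using z(1) by simp
    define G where "G = (\<lambda>(j, m). (z $ k) ^ j / fact j * (C j m * mi_power z' m))"
    \<comment> \<open>The double series over \<open>(j, m)\<close> with \<open>m k = 0\<close> is the series over multi-indices in disguise.\<close>
    define \<phi> where "\<phi> m = (m k, m(k := 0))" for m :: "'n \<Rightarrow> nat"
    have inj: "inj \<phi>"
    proof (rule injI)
      fix a b assume *: "\<phi> a = \<phi> b"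
      then have **: "a k = b k" "a(k := 0) = b(k := 0)" unfolding \<phi>_def by blast+
      have "a l = b l" for l
        using **(1) fun_cong[OF **(2), of l] by (cases "l = k") (simp_all only: fun_upd_apply if_False)
      then show "a = b" by blast
    qed
    have "G \<circ> \<phi> = (\<lambda>m. c m * mi_power z m)"
    proof
      fix m
      have "mi_power z m = (z $ k) ^ m k * mi_power z' (m(k := 0))"
        unfolding mi_power_upd mi_power_remove[of z m k] using z'l by (auto intro!: prod.cong)
      then show "(G \<circ> \<phi>) m = c m * mi_power z m" by (simp add: G_def \<phi>_def c_def)
    qed
    then have "(G has_sum s) (range \<phi>)" using s has_sum_reindex[OF inj, of G s] by simp
    moreover have G0: "G x = 0" if x: "x \<in> UNIV \<times> UNIV - range \<phi>" for x
    proof -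
      obtain j m where jm: "x = (j, m)" by fastforce
      have "m k \<noteq> 0"
      proof
        assume "m k = 0"
        then have "\<phi> (m(k := j)) = (j, m)" by (auto simp: \<phi>_def fun_eq_iff)
        then show False using x jm by (metis DiffD2 rangeI)
      qed
      then have "C j m = 0" using expansion_on_support[OF C[of j] _ k, of m] by metis
      then show ?thesis by (simp add: G_def jm)
    qed
    moreover have "(G has_sum s) (range \<phi>) \<longleftrightarrow> (G has_sum s) (UNIV \<times> UNIV)"
      by (rule has_sum_cong_neutral[OF G0]) auto
    ultimately have G: "(G has_sum s) (UNIV \<times> UNIV)" by blast
    have "((\<lambda>m. G (j, m)) has_sum ((z $ k) ^ j / fact j * (partial_deriv k ^^ j) f z')) UNIV" for j
    proof -
      have "((\<lambda>m. C j m * mi_power z' m) has_sum (partial_deriv k ^^ j) f z') UNIV"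
      proof (rule expansion_on_has_sum[OF C[of j] z'b])
        fix l assume "l \<notin> S"
        then show "z' $ l = 0" using z(2)[of l] z'k z'l[of l] by (cases "l = k") auto
      qed
      then show ?thesis unfolding G_def prod.case by (rule has_sum_cmult_right)
    qed
    then have "((\<lambda>j. (z $ k) ^ j / fact j * (partial_deriv k ^^ j) f z') has_sum s) UNIV"
      by (rule has_sum_SigmaD[OF G])
    then have 1: "(\<lambda>j. (z $ k) ^ j / fact j * (partial_deriv k ^^ j) f z') sums s" by (rule has_sum_imp_sums)
    have "(\<lambda>j. (partial_deriv k ^^ j) f z' / fact j * (z $ k) ^ j) sums f (z' + axis k (z $ k))"
      using z(1) zz' by (intro coordinate_power_series[OF f z'k]) simp
    then have "s = f z" using sums_unique2[OF 1] zz' by (simp add: mult_ac)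
    then show ?thesis using s by simp
  qed
  show ?thesis unfolding c_def[symmetric]
  proof (rule expansion_onI)
    show "m l = 0" if "c m \<noteq> 0" "l \<notin> insert k S" for m l using supp that by blast
  qed (fact sum bound)+
qed

lemma separately_holomorphic_expansion:
  fixes f :: "complex^'n::finite \<Rightarrow> complex"
  assumes "finite S" "separately_holomorphic f"
  shows "\<exists>c. expansion_on S f c"
  using assms
proof (induction S arbitrary: f rule: finite_induct)
  case empty
  let ?c = "\<lambda>m. if m = (\<lambda>_. 0) then f 0 else 0"
  have "((\<lambda>m. ?c m * mi_power 0 m) has_sum f 0) UNIV"
    by (rule has_sum_cong_neutral[THEN iffD1, of _ "{\<lambda>_. 0}"])
       (auto simp: mi_power_zero_vector has_sum_finite_iff)
  moreover have "z = 0" if "\<forall>k. z $ k = 0" for z :: "complex^'n" using that by (simp add: vec_eq_iff)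
  ultimately have "expansion_on {} f ?c"
  proof (intro expansion_onI)
    fix M and r :: "complex^'n" and m
    assume "\<And>z. (\<And>k. k \<notin> {} \<Longrightarrow> z $ k = 0) \<Longrightarrow> (\<And>k. cmod (z $ k) \<le> cmod (r $ k)) \<Longrightarrow> cmod (f z) \<le> M"
    from this[of 0] have "cmod (f 0) \<le> M" by simp
    then show "cmod (?c m) * cmod (mi_power r m) \<le> M"
      using order_trans[OF norm_ge_zero] by auto
  qed (auto split: if_splits)
  then show ?case by blast
next
  case (insert k S)
  have "\<forall>j. \<exists>c. expansion_on S ((partial_deriv k ^^ j) f) c"
    using insert.IH separately_holomorphic_funpow[OF insert.prems] by blast
  then obtain C where "\<And>j. expansion_on S ((partial_deriv k ^^ j) f) (C j)" by metis
  from expansion_on_insert[OF insert.hyps(2) insert.prems this] show ?case by blast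
qed

theorem hol_ball_mseries:
  fixes f :: "complex^'n::finite \<Rightarrow> complex"
  assumes "f \<in> hol_ball" shows "mseries (taylor_coeff f) f"
proof -
  obtain c where "expansion_on UNIV f c"
    using separately_holomorphic_expansion[OF finite hol_ball_separately_holomorphic[OF assms]] by blast
  then have c: "mseries c f" by (simp add: expansion_on_def mseries_def)
  moreover have "taylor_coeff f = c" by (rule ext) (rule mseries_taylor_coeff[OF c])
  ultimately show ?thesis by simp
qed

section \<open>Averages over squares in the plane\<close>

text \<open>
  The area integral in Cartesian coordinates. The iterated form suits squares, whose sides sweep out
  the plane in one coordinate at a time.
\<close>

definition plane_integral :: "(complex \<Rightarrow> ennreal) \<Rightarrow> ennreal" where
  "plane_integral F = (\<integral>\<^sup>+x. \<integral>\<^sup>+y. F (Complex x y) \<partial>lborel \<partial>lborel)"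

definition square :: "complex \<Rightarrow> real \<Rightarrow> complex set" where
  "square v r = {w. \<bar>Re (w - v)\<bar> \<le> r \<and> \<bar>Im (w - v)\<bar> \<le> r}"

lemma square_eq_cbox: "square v r = cbox (v - Complex r r) (v + Complex r r)"
  by (auto simp: square_def in_cbox_complex_iff)

lemma measurable_Complex: "(\<lambda>(x, y). Complex x y) \<in> borel_measurable (borel \<Otimes>\<^sub>M borel)"
proof -
  have "(\<lambda>z::real \<times> real. Complex (fst z) (snd z)) \<in> borel_measurable borel"
    by (intro borel_measurable_continuous_onI continuous_on_Complex continuous_intros)
  then show ?thesis by (simp add: borel_prod case_prod_beta')
qed

lemma plane_integral_mono: "(\<And>w. F w \<le> G w) \<Longrightarrow> plane_integral F \<le> plane_integral G"
  unfolding plane_integral_def by (intro nn_integral_mono)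

lemma measurable_plane:
  assumes [measurable]: "F \<in> borel_measurable borel"
  shows "(\<lambda>(x, y). F (Complex x y)) \<in> borel_measurable (borel \<Otimes>\<^sub>M borel)"
proof -
  have "F \<circ> (\<lambda>(x, y). Complex x y) \<in> borel_measurable (borel \<Otimes>\<^sub>M borel)"
    by (rule measurable_comp[OF measurable_Complex assms])
  then show ?thesis by (simp add: o_def case_prod_beta')
qed

lemma measurable_plane2:
  assumes "F \<in> borel_measurable borel"
  shows "(\<lambda>y. F (Complex x y)) \<in> borel_measurable borel" "(\<lambda>y. F (Complex y x)) \<in> borel_measurable borel"
  by (rule measurable_compose[OF _ assms], intro borel_measurable_continuous_onI continuous_on_Complex continuous_intros)+

lemma plane_integral_cmult:
  assumes [measurable]: "F \<in> borel_measurable borel"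
  shows "plane_integral (\<lambda>w. c * F w) = c * plane_integral F"
proof -
  note [measurable] = measurable_plane[OF assms] measurable_plane2[OF assms]
  show ?thesis unfolding plane_integral_def
    by (simp add: nn_integral_cmult)
qed

lemma plane_integral_translate:
  assumes [measurable]: "F \<in> borel_measurable borel"
  shows "plane_integral (\<lambda>w. F (v + w)) = plane_integral F"
proof -
  note [measurable] = measurable_plane[OF assms] measurable_plane2[OF assms]
  have "plane_integral F = (\<integral>\<^sup>+x. (\<integral>\<^sup>+y. F (Complex x (Im v + 1 * y)) \<partial>lborel) \<partial>lborel)"
    unfolding plane_integral_def
    by (rule nn_integral_cong) (subst nn_integral_real_affine[where c = 1 and t = "Im v"], auto)
  also have "\<dots> = (\<integral>\<^sup>+x. (\<integral>\<^sup>+y. F (Complex (Re v + 1 * x) (Im v + 1 * y)) \<partial>lborel) \<partial>lborel)"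
    by (subst nn_integral_real_affine[where c = 1 and t = "Re v"]) auto
  also have "\<dots> = plane_integral (\<lambda>w. F (v + w))"
    unfolding plane_integral_def by (intro nn_integral_cong arg_cong[where f = F]) (simp add: complex_eq_iff)
  finally show ?thesis by simp
qed

lemma plane_integral_rotate_quarter:
  assumes [measurable]: "F \<in> borel_measurable borel"
  shows "plane_integral (\<lambda>w. F (\<i> * w)) = plane_integral F"
proof -
  note [measurable] = measurable_plane[OF assms] measurable_plane2[OF assms]
  have "plane_integral F = (\<integral>\<^sup>+y. \<integral>\<^sup>+x. F (Complex x y) \<partial>lborel \<partial>lborel)"
    unfolding plane_integral_def by (rule lborel_pair.Fubini'[symmetric]) simp
  also have "\<dots> = (\<integral>\<^sup>+y. \<integral>\<^sup>+x. F (Complex (0 + (-1) * x) y) \<partial>lborel \<partial>lborel)"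
    by (rule nn_integral_cong) (subst nn_integral_real_affine[where c = "-1" and t = 0], auto)
  also have "\<dots> = plane_integral (\<lambda>w. F (\<i> * w))"
    unfolding plane_integral_def by (intro nn_integral_cong arg_cong[where f = F]) (simp add: complex_eq_iff)
  finally show ?thesis by simp
qed

lemma plane_integral_rotate:
  assumes F: "F \<in> borel_measurable borel" and u: "u \<in> {1, \<i>, -1, -\<i>}"
  shows "plane_integral (\<lambda>w. F (v + u * w)) = plane_integral F"
proof -
  have m: "(\<lambda>w. G (c * w)) \<in> borel_measurable borel" if "G \<in> borel_measurable borel" for c and G :: "complex \<Rightarrow> ennreal"
    using that by measurable
  have m': "(\<lambda>w. F (v + w)) \<in> borel_measurable borel" using F by measurable
  have q: "plane_integral (\<lambda>w. G (c * \<i> * w)) = plane_integral (\<lambda>w. G (c * w))" if "G \<in> borel_measurable borel" for c G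
    using plane_integral_rotate_quarter[OF m[OF that, of c]] by (simp add: mult.assoc)
  have "plane_integral (\<lambda>w. G (u * w)) = plane_integral G" if "G \<in> borel_measurable borel" for G
    using q[OF that, of 1] q[OF that, of \<i>] q[OF that, of "-1"] u by auto
  from this[OF m'] plane_integral_translate[OF F, of v] show ?thesis by simp
qed

text \<open>
  The length estimate for a segment, with the integrand kept under the integral sign.
\<close>

lemma norm_contour_integral_linepath_le:
  assumes "continuous_on (closed_segment a b) f" "(f has_contour_integral I) (linepath a b)"
  shows "ennreal (norm I) \<le> (\<integral>\<^sup>+x. indicator {0..1} x * ennreal (norm (f (linepath a b x)) * norm (b - a)) \<partial>lborel)"
proof -
  let ?g = "\<lambda>x. f (linepath a b x) * (b - a)"
  have I: "(?g has_integral I) {0..1}" using assms(2) by (simp add: has_contour_integral_linepath)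
  have "continuous_on {0..1} (\<lambda>x. f (linepath a b x))"
    by (rule continuous_on_compose2[OF assms(1) continuous_on_linepath]) (auto simp: linepath_in_path)
  then have c: "continuous_on {0..1} (\<lambda>x. norm (?g x))" by (intro continuous_intros)
  then have J: "((\<lambda>x. norm (?g x)) has_integral (integral {0..1} (\<lambda>x. norm (?g x)))) {0..1}"
    by (intro integrable_integral integrable_continuous_interval) simp
  have "norm I \<le> integral {0..1} (\<lambda>x. norm (?g x))"
    using integral_norm_bound_integral[of ?g "{0..1}" "\<lambda>x. norm (?g x)"] I J
    by (metis has_integral_integrable integral_unique order_refl)
  also have "ennreal (integral {0..1} (\<lambda>x. norm (?g x))) = (\<integral>\<^sup>+x. ennreal (indicator {0..1} x * norm (?g x)) \<partial>lborel)"
    using nn_integral_has_integral_lebesgue[OF _ J] by simp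
  finally have "ennreal (norm I) \<le> (\<integral>\<^sup>+x. ennreal (indicator {0..1} x * norm (?g x)) \<partial>lborel)"
    by (simp add: ennreal_leI)
  also have "\<dots> = (\<integral>\<^sup>+x. indicator {0..1} x * ennreal (norm (f (linepath a b x)) * norm (b - a)) \<partial>lborel)"
    by (intro nn_integral_cong) (auto simp: norm_mult indicator_def)
  finally show ?thesis .
qed

text \<open>
  Cauchy's formula on the boundary of the square with centre \<open>v\<close> and half side \<open>t\<close>. Its four sides
  are the rotations by \<open>u\<close> of the segment from \<open>t - i t\<close> to \<open>t + i t\<close>, of length \<open>2 t\<close> and at distance
  at least \<open>t\<close> from \<open>v\<close>.
\<close>

lemma cauchy_square_bound:
  assumes h: "h holomorphic_on square v t" and t: "t > 0"
  shows "ennreal (cmod (h v)) \<le> (\<Sum>u\<in>{1, \<i>, -1, -\<i>}.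
      \<integral>\<^sup>+x. indicator {0..1} x * ennreal (cmod (h (v + u * Complex t (t * (2 * x - 1))))) \<partial>lborel)"
proof -
  define a where "a u = v + u * Complex t (-t)" for u
  define b where "b u = v + u * Complex t t" for u
  define g where "g w = h w / (w - v)" for w
  define S where "S u = (\<integral>\<^sup>+x. indicator {0..1} x * ennreal (cmod (h (v + u * Complex t (t * (2 * x - 1))))) \<partial>lborel)" for u
  let ?U = "{1, \<i>, -1, -\<i>}"
  have lp: "linepath (a u) (b u) x = v + u * Complex t (t * (2 * x - 1))" for u x
    by (simp add: a_def b_def linepath_def complex_eq_iff algebra_simps)
  have far: "w \<in> square v t \<and> t \<le> cmod (w - v)" if u: "u \<in> ?U" and w: "w \<in> closed_segment (a u) (b u)" for u w
  proof -
    from w obtain x where x: "x \<in> {0..1}" "w = linepath (a u) (b u) x"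
      by (metis imageE linepath_image_01)
    have wv: "w - v = u * Complex t (t * (2 * x - 1))" using x lp by simp
    have "\<bar>t * (2 * x - 1)\<bar> \<le> t * 1" using x t by (subst abs_mult) (intro mult_mono, auto)
    then have ab: "\<bar>t * (2 * x - 1)\<bar> \<le> t" by simp
    have "t \<le> cmod (w - v)"
    proof -
      have "cmod u = 1" using u by auto
      then have "cmod (w - v) = cmod (Complex t (t * (2 * x - 1)))" unfolding wv by (simp add: norm_mult)
      then show ?thesis using abs_Re_le_cmod[of "Complex t (t * (2 * x - 1))"] t by simp
    qed
    moreover have "w \<in> square v t" using u ab t unfolding square_def mem_Collect_eq wv by auto
    ultimately show ?thesis by blast
  qed
  have cont: "continuous_on (closed_segment (a u) (b u)) g" if "u \<in> ?U" for u
    unfolding g_def using far[OF that] t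
    by (intro continuous_intros continuous_on_subset[OF holomorphic_on_imp_continuous_on[OF h]]) fastforce+
  define I where "I u = contour_integral (linepath (a u) (b u)) g" for u
  have hI: "(g has_contour_integral I u) (linepath (a u) (b u))" if "u \<in> ?U" for u
    unfolding I_def by (intro has_contour_integral_integral contour_integrable_continuous_linepath cont that)
  have corners: "b (-\<i>) = a 1" "b 1 = a \<i>" "b \<i> = a (-1)" "b (-1) = a (-\<i>)"
    by (simp_all add: a_def b_def complex_eq_iff)
  let ?\<gamma> = "rectpath (v - Complex t t) (v + Complex t t)"
  have rect: "?\<gamma> = linepath (a (-\<i>)) (b (-\<i>)) +++ linepath (a 1) (b 1) +++ linepath (a \<i>) (b \<i>) +++ linepath (a (-1)) (b (-1))"
    unfolding rectpath_def Let_def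
    by (intro arg_cong2[where f = "(+++)"] arg_cong2[where f = linepath]) (auto simp: a_def b_def complex_eq_iff)
  have 1: "(g has_contour_integral (I (-\<i>) + (I 1 + (I \<i> + I (-1))))) ?\<gamma>"
    unfolding rect by (intro has_contour_integral_join hI valid_path_join valid_path_linepath) (auto simp: corners)
  have vin: "v \<in> box (v - Complex t t) (v + Complex t t)" using t by (auto simp: in_box_complex_iff)
  have 2: "(g has_contour_integral (2 * pi * \<i> * winding_number ?\<gamma> v * h v)) ?\<gamma>"
    unfolding g_def
  proof (rule Cauchy_integral_formula_convex_simple[where S = "square v t"])
    show "v \<in> interior (square v t)" unfolding square_eq_cbox interior_cbox by (rule vin)
    show "path_image ?\<gamma> \<subseteq> square v t - {v}"
    proof -
      have "path_image ?\<gamma> \<subseteq> square v t" unfolding square_eq_cbox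
        using t by (intro path_image_rectpath_subset_cbox) auto
      moreover have "v \<notin> path_image ?\<gamma>"
        using path_image_rectpath_inter_box[of "v - Complex t t" "v + Complex t t"] vin t by auto
      ultimately show ?thesis by blast
    qed
  qed (use h in \<open>auto simp: square_eq_cbox\<close>)
  have eq: "I (-\<i>) + (I 1 + (I \<i> + I (-1))) = 2 * pi * \<i> * h v"
    using contour_integral_unique[OF 1] contour_integral_unique[OF 2] winding_number_rectpath[OF vin] by simp
  have Ib: "ennreal (cmod (I u)) \<le> 2 * S u" if u: "u \<in> ?U" for u
  proof -
    have "ennreal (cmod (I u)) \<le> (\<integral>\<^sup>+x. indicator {0..1} x * ennreal (norm (g (linepath (a u) (b u) x)) * norm (b u - a u)) \<partial>lborel)"
      by (rule norm_contour_integral_linepath_le[OF cont[OF u] hI[OF u]])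
    also have "\<dots> \<le> (\<integral>\<^sup>+x. 2 * (indicator {0..1} x * ennreal (cmod (h (v + u * Complex t (t * (2 * x - 1)))))) \<partial>lborel)"
    proof (rule nn_integral_mono)
      fix x :: real
      have ba: "norm (b u - a u) = 2 * t"
      proof -
        have "b u - a u = u * (\<i> * (2 * t))" by (simp add: a_def b_def complex_eq_iff algebra_simps)
        then show ?thesis using u t by (auto simp: norm_mult)
      qed
      show "indicator {0..1} x * ennreal (norm (g (linepath (a u) (b u) x)) * norm (b u - a u))
         \<le> 2 * (indicator {0..1} x * ennreal (cmod (h (v + u * Complex t (t * (2 * x - 1))))))"
      proof (cases "x \<in> {0..1}")
        case True
        let ?w = "linepath (a u) (b u) x"
        have d: "t \<le> cmod (?w - v)" using far[OF u, of ?w] True by (metis linepath_in_path)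
        have "norm (g ?w) * norm (b u - a u) = cmod (h ?w) * 2 * (t / cmod (?w - v))"
          by (simp add: g_def norm_divide ba)
        also have "\<dots> \<le> cmod (h ?w) * 2 * 1" using d t by (intro mult_left_mono) (auto simp: divide_le_eq)
        finally show ?thesis using True unfolding lp
          by (simp add: ennreal_mult'[symmetric] ennreal_leI mult.commute flip: ennreal_numeral)
      qed simp
    qed
    also have "\<dots> = 2 * S u"
    proof -
      have "(\<lambda>x. indicator {0..1} x * cmod (h (v + u * Complex t (t * (2 * x - 1))))) \<in> borel_measurable borel"
      proof -
        have "continuous_on {0..1} (\<lambda>x. h (linepath (a u) (b u) x))"
          by (rule continuous_on_compose2[OF holomorphic_on_imp_continuous_on[OF h] continuous_on_linepath])
            (use far[OF u] in \<open>auto simp: linepath_in_path\<close>)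
        then have "(\<lambda>x. indicator {0..1} x *\<^sub>R cmod (h (linepath (a u) (b u) x))) \<in> borel_measurable borel"
          by (intro borel_measurable_continuous_on_indicator continuous_intros) auto
        then show ?thesis by (simp add: lp)
      qed
      then have "(\<lambda>x. ennreal (indicator {0..1} x * cmod (h (v + u * Complex t (t * (2 * x - 1)))))) \<in> borel_measurable borel"
        by measurable
      moreover have "(\<lambda>x. ennreal (indicator {0..1} x * cmod (h (v + u * Complex t (t * (2 * x - 1)))))) =
         (\<lambda>x. indicator {0..1} x * ennreal (cmod (h (v + u * Complex t (t * (2 * x - 1))))))"
        by (auto simp: indicator_def)
      ultimately show ?thesis unfolding S_def by (intro nn_integral_cmult) simp
    qed
    finally show ?thesis .
  qed
  have "2 * cmod (h v) \<le> 2 * pi * cmod (h v)" using pi_ge_two by (intro mult_right_mono) auto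
  also have "\<dots> = cmod (I (-\<i>) + (I 1 + (I \<i> + I (-1))))" unfolding eq by (simp add: norm_mult)
  also have "\<dots> \<le> cmod (I (-\<i>)) + (cmod (I 1) + (cmod (I \<i>) + cmod (I (-1))))"
    by (intro order_trans[OF norm_triangle_ineq] add_left_mono order_refl)
  finally have "ennreal (2 * cmod (h v)) \<le> ennreal (cmod (I (-\<i>))) + (ennreal (cmod (I 1)) + (ennreal (cmod (I \<i>)) + ennreal (cmod (I (-1)))))"
    by (simp add: ennreal_leI flip: ennreal_plus)
  also have "\<dots> \<le> 2 * S (-\<i>) + (2 * S 1 + (2 * S \<i> + 2 * S (-1)))"
    by (intro add_mono Ib) auto
  also have "\<dots> = 2 * (\<Sum>u\<in>?U. S u)" by (simp add: complex_eq_iff distrib_left add_ac)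
  finally have "2 * ennreal (cmod (h v)) \<le> 2 * (\<Sum>u\<in>?U. S u)" by (simp add: ennreal_mult)
  then show ?thesis unfolding S_def by (simp add: ennreal_mult_le_mult_iff)
qed

lemma measurable_indicator_square:
  assumes "continuous_on (square v r) f"
  shows "(\<lambda>w. indicator (square v r) w * ennreal (f w)) \<in> borel_measurable borel"
proof -
  have "(\<lambda>w. indicator (square v r) w *\<^sub>R f w) \<in> borel_measurable borel"
    using assms by (intro borel_measurable_continuous_on_indicator) (auto simp: square_eq_cbox)
  then have "(\<lambda>w. ennreal (indicator (square v r) w *\<^sub>R f w)) \<in> borel_measurable borel" by simp
  also have "(\<lambda>w. ennreal (indicator (square v r) w *\<^sub>R f w)) = (\<lambda>w. indicator (square v r) w * ennreal (f w))"
    by (auto simp: indicator_def)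
  finally show ?thesis .
qed

text \<open>
  As \<open>t\<close> runs from \<open>0\<close> to \<open>\<rho>\<close>, each side of the square of half side \<open>t\<close> sweeps out a wedge of the
  full square, so averaging Cauchy's formula over \<open>t\<close> produces an area integral.
\<close>

lemma square_mean_value:
  assumes h: "h holomorphic_on square v \<rho>" and \<rho>: "\<rho> > 0"
  shows "ennreal (cmod (h v) * \<rho>\<^sup>2) \<le> 4 * plane_integral (\<lambda>w. indicator (square v \<rho>) w * ennreal (cmod (h w)))"
proof -
  let ?U = "{1, \<i>, -1, -\<i>} :: complex set"
  define F where "F w = indicator (square v \<rho>) w * ennreal (cmod (h w))" for w
  have F: "F \<in> borel_measurable borel" unfolding F_def
    by (intro measurable_indicator_square continuous_on_norm holomorphic_on_imp_continuous_on h)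
  have Fu: "(\<lambda>w. F (v + u * w)) \<in> borel_measurable borel" for u
    by (rule measurable_compose[OF _ F]) simp
  have slice: "indicator {0..\<rho>} t * ennreal (2 * t * cmod (h v)) \<le> (\<Sum>u\<in>?U. \<integral>\<^sup>+y. F (v + u * Complex t y) \<partial>lborel)" for t
  proof (cases "t \<in> {0<..\<rho>}")
    case True
    then have t: "t > 0" "t \<le> \<rho>" by auto
    have sub: "square v t \<subseteq> square v \<rho>" using t by (auto simp: square_def)
    have "ennreal (cmod (h v)) \<le> (\<Sum>u\<in>?U. \<integral>\<^sup>+x. F (v + u * Complex t (- t + 2 * t * x)) \<partial>lborel)"
    proof (rule order_trans[OF cauchy_square_bound[OF holomorphic_on_subset[OF h sub] t(1)]], intro sum_mono nn_integral_mono)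
      fix u x assume u: "u \<in> ?U"
      show "indicator {0..1} x * ennreal (cmod (h (v + u * Complex t (t * (2 * x - 1))))) \<le> F (v + u * Complex t (- t + 2 * t * x))"
      proof (cases "x \<in> {0..1}")
        case True
        have eq: "t * (2 * x - 1) = - t + 2 * t * x" by (simp add: algebra_simps)
        have "\<bar>t * (2 * x - 1)\<bar> \<le> t * 1" using True t by (subst abs_mult) (intro mult_mono, auto)
        then have "v + u * Complex t (t * (2 * x - 1)) \<in> square v \<rho>" using u t by (auto simp: square_def)
        then show ?thesis using True unfolding F_def eq by simp
      qed simp
    qed
    then have "ennreal (2 * t) * ennreal (cmod (h v)) \<le> ennreal (2 * t) * (\<Sum>u\<in>?U. \<integral>\<^sup>+x. F (v + u * Complex t (- t + 2 * t * x)) \<partial>lborel)"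
      by (rule mult_left_mono) simp
    also have "\<dots> = (\<Sum>u\<in>?U. \<bar>2 * t\<bar> * (\<integral>\<^sup>+x. F (v + u * Complex t (- t + 2 * t * x)) \<partial>lborel))"
      using t by (simp only: sum_distrib_left abs_of_pos[OF mult_pos_pos[OF zero_less_numeral t(1)]])
    also have "\<dots> = (\<Sum>u\<in>?U. \<integral>\<^sup>+y. F (v + u * Complex t y) \<partial>lborel)"
      using t by (intro sum.cong refl nn_integral_real_affine[symmetric] measurable_plane2(1)[OF Fu]) auto
    finally show ?thesis using t by (simp add: ennreal_mult)
  qed (auto simp: indicator_def)
  have "ennreal (cmod (h v) * \<rho>\<^sup>2) = (\<integral>\<^sup>+t. indicator {0..\<rho>} t * ennreal (2 * t * cmod (h v)) \<partial>lborel)"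
  proof -
    have "((\<lambda>t. 2 * t * cmod (h v)) has_integral (\<rho>\<^sup>2 * cmod (h v) - 0\<^sup>2 * cmod (h v))) {0..\<rho>}"
      using \<rho> by (intro fundamental_theorem_of_calculus)
        (auto intro!: derivative_eq_intros simp flip: has_real_derivative_iff_has_vector_derivative)
    from nn_integral_has_integral_lebesgue[OF _ this]
    have "(\<integral>\<^sup>+t. ennreal (indicator {0..\<rho>} t * (2 * t * cmod (h v))) \<partial>lborel) = ennreal (\<rho>\<^sup>2 * cmod (h v))" by simp
    moreover have "ennreal (indicator {0..\<rho>} t * (2 * t * cmod (h v))) = indicator {0..\<rho>} t * ennreal (2 * t * cmod (h v))" for t
      by (auto simp: indicator_def)
    ultimately show ?thesis by (simp add: mult.commute)
  qed
  also have "\<dots> \<le> (\<integral>\<^sup>+t. (\<Sum>u\<in>?U. \<integral>\<^sup>+y. F (v + u * Complex t y) \<partial>lborel) \<partial>lborel)"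
    by (intro nn_integral_mono slice)
  also have "\<dots> = (\<Sum>u\<in>?U. \<integral>\<^sup>+t. \<integral>\<^sup>+y. F (v + u * Complex t y) \<partial>lborel \<partial>lborel)"
    using measurable_plane[OF Fu] by (intro nn_integral_sum) (auto intro!: lborel.borel_measurable_nn_integral)
  also have "\<dots> = (\<Sum>u\<in>?U. plane_integral F)"
    unfolding plane_integral_def by (intro sum.cong refl plane_integral_rotate[OF F, unfolded plane_integral_def])
  also have "\<dots> = 4 * plane_integral F" by (simp add: complex_eq_iff)
  finally show ?thesis unfolding F_def .
qed

text \<open>
  For \<open>p \<le> 1\<close> the mean of \<open>|h|\<close> is at most the mean of \<open>|h|\<^sup>p\<close> times a power of the supremum of \<open>|h|\<close>.
  To control this supremum, consider the point \<open>v\<close> where \<open>(r - d w)\<^sup>(\<^sup>2\<^sup>/\<^sup>p\<^sup>) |h w|\<close> attains its maximum \<open>A\<close>,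
  \<open>d\<close> being the distance from the centre in the maximum norm. On the square about \<open>v\<close> that reaches half
  way to the boundary, \<open>|h|\<close> is at most a constant times its value at \<open>v\<close>; the mean value estimate
  there turns into a bound of \<open>A\<^sup>p\<close> in which all powers of the size cancel.
\<close>

lemma weak_mean_value_le_1:
  assumes h: "h holomorphic_on square v0 r" and r: "r > 0" and p: "0 < p" "p \<le> 1"
  shows "ennreal (cmod (h v0) powr p * r\<^sup>2) \<le>
    ennreal (4 * 2 powr (2 / p)) * plane_integral (\<lambda>w. indicator (square v0 r) w * ennreal (cmod (h w) powr p))"
proof -
  let ?Q = "square v0 r"
  define J where "J = plane_integral (\<lambda>w. indicator ?Q w * ennreal (cmod (h w) powr p))"
  define d where "d w = max \<bar>Re (w - v0)\<bar> \<bar>Im (w - v0)\<bar>" for w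
  define \<phi> where "\<phi> w = (r - d w) powr (2 / p) * cmod (h w)" for w
  have ch: "continuous_on ?Q h" by (rule holomorphic_on_imp_continuous_on[OF h])
  have cp: "continuous_on ?Q (\<lambda>w. cmod (h w) powr p)"
    by (rule continuous_on_powr'[OF continuous_on_norm[OF ch] continuous_on_const]) (use p in auto)
  have dQ: "w \<in> ?Q \<longleftrightarrow> d w \<le> r" for w by (auto simp: square_def d_def)
  have c\<phi>: "continuous_on ?Q \<phi>" unfolding \<phi>_def d_def
    using p dQ by (intro continuous_intros ch continuous_on_powr') (auto simp: d_def)
  have "compact ?Q" unfolding square_eq_cbox by (rule compact_cbox)
  moreover have "v0 \<in> ?Q" using r by (simp add: square_def)
  then have "?Q \<noteq> {}" by blast
  ultimately have "\<exists>v\<in>?Q. \<forall>w\<in>?Q. \<phi> w \<le> \<phi> v" using c\<phi> by (rule continuous_attains_sup)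
  then obtain v where v: "v \<in> ?Q" "\<And>w. w \<in> ?Q \<Longrightarrow> \<phi> w \<le> \<phi> v" by blast
  define A where "A = \<phi> v"
  have v0: "r powr (2 / p) * cmod (h v0) \<le> A" using v(2)[of v0] r dQ[of v0] by (auto simp: \<phi>_def d_def A_def)
  have A0: "0 \<le> A" by (simp add: A_def \<phi>_def)
  have main: "ennreal (A powr p) \<le> ennreal (4 * 2 powr (2 / p)) * J"
  proof (cases "A = 0")
    case False
    then have A: "A > 0" using A0 by simp
    \<comment> \<open>Half of the distance from \<open>v\<close> to the boundary of the square, so that \<open>r - d w \<ge> \<rho>\<close> near \<open>v\<close>.\<close>
    define \<rho> where "\<rho> = (r - d v) / 2"
    have "d v < r" using A v(1) dQ[of v] by (cases "d v = r") (auto simp: A_def \<phi>_def)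
    then have \<rho>: "\<rho> > 0" by (simp add: \<rho>_def)
    have near: "r - d w \<ge> \<rho>" if "w \<in> square v \<rho>" for w
    proof -
      have "\<bar>Re (w - v0)\<bar> \<le> \<bar>Re (w - v)\<bar> + \<bar>Re (v - v0)\<bar>" "\<bar>Im (w - v0)\<bar> \<le> \<bar>Im (w - v)\<bar> + \<bar>Im (v - v0)\<bar>" by auto
      moreover have "\<bar>Re (v - v0)\<bar> \<le> d v" "\<bar>Im (v - v0)\<bar> \<le> d v" by (auto simp: d_def)
      moreover have "\<bar>Re (w - v)\<bar> \<le> \<rho>" "\<bar>Im (w - v)\<bar> \<le> \<rho>" using that by (auto simp: square_def)
      ultimately have "d w \<le> \<rho> + d v" unfolding d_def[of w] by linarith
      then show ?thesis by (simp add: \<rho>_def field_simps)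
    qed
    have sub: "square v \<rho> \<subseteq> ?Q" using near \<rho> dQ by fastforce
    \<comment> \<open>An upper bound for \<open>|h|\<^sup>(\<^sup>1\<^sup>-\<^sup>p\<^sup>)\<close> on the smaller square.\<close>
    define c where "c = (A * \<rho> powr (- 2 / p)) powr (1 - p)"
    have c: "c > 0" using A \<rho> by (simp add: c_def)
    have hb: "cmod (h w) \<le> cmod (h w) powr p * c" if w: "w \<in> square v \<rho>" for w
    proof (cases "h w = 0")
      case False
      have "\<rho> powr (2 / p) * cmod (h w) \<le> (r - d w) powr (2 / p) * cmod (h w)"
        using near[OF w] \<rho> p by (intro mult_right_mono powr_mono2) auto
      also have "\<dots> \<le> A" using v(2)[of w] sub w by (auto simp: \<phi>_def A_def)
      finally have "cmod (h w) \<le> A * \<rho> powr (- 2 / p)"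
        using \<rho> by (simp add: powr_minus_divide field_simps)
      then have "cmod (h w) powr (1 - p) \<le> c" unfolding c_def using p by (intro powr_mono2) auto
      then have "cmod (h w) powr p * cmod (h w) powr (1 - p) \<le> cmod (h w) powr p * c" by (intro mult_left_mono) auto
      then show ?thesis using False by (simp flip: powr_add)
    qed simp
    have "ennreal (cmod (h v) * \<rho>\<^sup>2) \<le> 4 * plane_integral (\<lambda>w. indicator (square v \<rho>) w * ennreal (cmod (h w)))"
      by (rule square_mean_value[OF holomorphic_on_subset[OF h sub] \<rho>])
    also have "\<dots> \<le> 4 * plane_integral (\<lambda>w. ennreal c * (indicator ?Q w * ennreal (cmod (h w) powr p)))"
    proof (intro mult_left_mono plane_integral_mono)
      fix w
      show "indicator (square v \<rho>) w * ennreal (cmod (h w)) \<le> ennreal c * (indicator ?Q w * ennreal (cmod (h w) powr p))"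
        using sub hb[of w] c by (auto simp: indicator_def ennreal_mult'[symmetric] mult.commute intro!: ennreal_leI)
    qed simp
    also have "\<dots> = 4 * (ennreal c * J)" unfolding J_def
      by (subst plane_integral_cmult[OF measurable_indicator_square[OF cp]]) (rule refl)
    finally have *: "ennreal (cmod (h v) * \<rho>\<^sup>2) \<le> 4 * (ennreal c * J)" .
    have hv: "cmod (h v) = A * (2 * \<rho>) powr (- 2 / p)"
    proof -
      have "2 * \<rho> = r - d v" by (simp add: \<rho>_def)
      then show ?thesis using \<rho> by (simp add: A_def \<phi>_def powr_minus_divide)
    qed
    have "cmod (h v) * \<rho>\<^sup>2 * 2 powr (2 / p) = c * A powr p"
    proof -
      have "c * A powr p = A powr (1 - p) * A powr p * \<rho> powr ((- 2 / p) * (1 - p))"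
        using A \<rho> by (simp add: c_def powr_mult powr_powr)
      also have "A powr (1 - p) * A powr p = A" using A by (simp flip: powr_add)
      also have "(- 2 / p) * (1 - p) = - 2 / p + 2" using p by (simp add: field_simps)
      also have "\<rho> powr (- 2 / p + 2) = \<rho> powr (- 2 / p) * \<rho>\<^sup>2" using \<rho> by (simp only: powr_add powr_numeral)
      finally show ?thesis using \<rho> unfolding hv by (simp add: powr_mult powr_minus field_simps)
    qed
    then have "ennreal c * ennreal (A powr p) = ennreal (2 powr (2 / p)) * ennreal (cmod (h v) * \<rho>\<^sup>2)"
      using c by (simp add: ennreal_mult'[symmetric] mult.commute)
    also have "\<dots> \<le> ennreal (2 powr (2 / p)) * (4 * (ennreal c * J))" by (intro mult_left_mono *) simp
    also have "\<dots> = ennreal c * (ennreal (4 * 2 powr (2 / p)) * J)"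
      by (simp add: ennreal_mult' mult_ac)
    finally show ?thesis using c by (simp add: ennreal_mult_le_mult_iff)
  qed (use p in simp)
  have "cmod (h v0) powr p * r\<^sup>2 = (r powr (2 / p) * cmod (h v0)) powr p"
    using r p by (simp add: powr_mult powr_powr)
  also have "\<dots> \<le> A powr p" using v0 p by (intro powr_mono2) auto
  finally show ?thesis using main order_trans[OF ennreal_leI] unfolding J_def by blast
qed

text \<open>
  Apply the case \<open>p / k \<le> 1\<close> to the holomorphic function \<open>h\<^sup>k\<close>.
\<close>

theorem weak_mean_value:
  assumes p: "(p::real) > 0"
  obtains C :: real where "C > 0"
    "\<And>h v r. h holomorphic_on square v r \<Longrightarrow> r > 0 \<Longrightarrow>
      ennreal (cmod (h v) powr p * r\<^sup>2) \<le> ennreal C * plane_integral (\<lambda>w. indicator (square v r) w * ennreal (cmod (h w) powr p))"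
proof -
  obtain k :: nat where k: "p \<le> real k" using real_arch_simple by blast
  then have k0: "k > 0" using p by (cases k) auto
  have pk: "0 < p / k" "p / k \<le> 1" using p k k0 by auto
  show ?thesis
  proof (rule that)
    show "4 * 2 powr (2 / (p / k)) > (0::real)" by simp
    fix h v r assume h: "h holomorphic_on square v r" and r: "(r::real) > 0"
    have eq: "cmod (h w ^ k) powr (p / k) = cmod (h w) powr p" for w
    proof -
      have "cmod (h w ^ k) = cmod (h w) powr real k" using k0 by (cases "h w = 0") (simp_all add: norm_power powr_realpow)
      then show ?thesis using k0 by (simp add: powr_powr)
    qed
    have "(\<lambda>w. h w ^ k) holomorphic_on square v r" by (intro holomorphic_intros h)
    from weak_mean_value_le_1[OF this r pk] show "ennreal (cmod (h v) powr p * r\<^sup>2) \<le> ennreal (4 * 2 powr (2 / (p / k))) *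
        plane_integral (\<lambda>w. indicator (square v r) w * ennreal (cmod (h w) powr p))"
      unfolding eq .
  qed
qed

section \<open>Integration over complex dilations\<close>

lemma nn_integral_lborel_translate:
  fixes F :: "'a::euclidean_space \<Rightarrow> ennreal"
  assumes [measurable]: "F \<in> borel_measurable borel"
  shows "(\<integral>\<^sup>+x. F (c + x) \<partial>lborel) = (\<integral>\<^sup>+x. F x \<partial>lborel)"
proof -
  have "(\<integral>\<^sup>+x. F x \<partial>lborel) = (\<integral>\<^sup>+x. F x \<partial>(distr lborel borel ((+) c)))" by (simp add: lborel_distr_plus)
  also have "\<dots> = (\<integral>\<^sup>+x. F (c + x) \<partial>lborel)" by (subst nn_integral_distr) auto
  finally show ?thesis by simp
qed

text \<open>
  The argument for uniqueness of Haar measure. Lebesgue measure and its image under \<open>T\<close> are both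
  invariant under translations, so the double integral of \<open>1\<^sub>B(x) G(x + T z)\<close> can be evaluated in two
  ways by Tonelli's theorem, where \<open>B\<close> is the symmetric unit ball.
\<close>

lemma nn_integral_lborel_linear_image:
  fixes T :: "'a::euclidean_space \<Rightarrow> 'a" and G :: "'a \<Rightarrow> ennreal"
  assumes T: "linear T" "surj T" and G [measurable]: "G \<in> borel_measurable borel"
  shows "emeasure lborel (ball (0::'a) 1) * (\<integral>\<^sup>+z. G (T z) \<partial>lborel) =
     emeasure lborel (T -` ball 0 1) * (\<integral>\<^sup>+x. G x \<partial>lborel)"
proof -
  let ?B = "ball (0::'a) 1"
  have Tm [measurable]: "T \<in> borel_measurable borel"
    using T(1) by (intro borel_measurable_continuous_onI linear_continuous_on) (simp add: linear_conv_bounded_linear)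
  have [measurable]: "(indicator ?B :: 'a \<Rightarrow> ennreal) \<in> borel_measurable borel"
    by (intro borel_measurable_indicator) simp
  have inv: "(\<integral>\<^sup>+z. F (y + T z) \<partial>lborel) = (\<integral>\<^sup>+z. F (T z) \<partial>lborel)"
    if [measurable]: "F \<in> borel_measurable borel" for F :: "'a \<Rightarrow> ennreal" and y
  proof -
    obtain x where x: "y = T x" using T(2) by (metis surjD)
    have "(\<integral>\<^sup>+z. F (y + T z) \<partial>lborel) = (\<integral>\<^sup>+z. F (T (x + z)) \<partial>lborel)"
      by (simp add: x linear_add[OF T(1)])
    also have "\<dots> = (\<integral>\<^sup>+z. F (T z) \<partial>lborel)"
      by (rule nn_integral_lborel_translate[where F = "\<lambda>z. F (T z)"]) measurable
    finally show ?thesis .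
  qed
  have "emeasure lborel ?B * (\<integral>\<^sup>+z. G (T z) \<partial>lborel) = (\<integral>\<^sup>+x. indicator ?B x * (\<integral>\<^sup>+z. G (T z) \<partial>lborel) \<partial>lborel)"
    by (subst nn_integral_multc) auto
  also have "\<dots> = (\<integral>\<^sup>+x. (\<integral>\<^sup>+z. indicator ?B x * G (x + T z) \<partial>lborel) \<partial>lborel)"
    by (intro nn_integral_cong) (simp add: nn_integral_cmult inv)
  also have "\<dots> = (\<integral>\<^sup>+z. (\<integral>\<^sup>+x. indicator ?B x * G (x + T z) \<partial>lborel) \<partial>lborel)"
    by (rule lborel_pair.Fubini'[symmetric]) measurable
  also have "\<dots> = (\<integral>\<^sup>+z. (\<integral>\<^sup>+x. indicator ?B (- T z + x) * G x \<partial>lborel) \<partial>lborel)"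
  proof (rule nn_integral_cong)
    fix z
    have "(\<integral>\<^sup>+x. indicator ?B (- T z + x) * G ((- T z + x) + T z) \<partial>lborel) = (\<integral>\<^sup>+x. indicator ?B x * G (x + T z) \<partial>lborel)"
      by (rule nn_integral_lborel_translate[where F = "\<lambda>x. indicator ?B x * G (x + T z)"]) measurable
    then show "(\<integral>\<^sup>+x. indicator ?B x * G (x + T z) \<partial>lborel) = (\<integral>\<^sup>+x. indicator ?B (- T z + x) * G x \<partial>lborel)" by simp
  qed
  also have "\<dots> = (\<integral>\<^sup>+x. (\<integral>\<^sup>+z. indicator ?B (- T z + x) * G x \<partial>lborel) \<partial>lborel)"
    by (rule lborel_pair.Fubini') measurable
  also have "\<dots> = (\<integral>\<^sup>+x. emeasure lborel (T -` ?B) * G x \<partial>lborel)"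
  proof (rule nn_integral_cong)
    fix x
    have "(\<integral>\<^sup>+z. indicator ?B (- T z + x) * G x \<partial>lborel) = (\<integral>\<^sup>+z. indicator ?B (- T z + x) \<partial>lborel) * G x"
      by (rule nn_integral_multc) measurable
    also have "(\<integral>\<^sup>+z. indicator ?B (- T z + x) \<partial>lborel) = (\<integral>\<^sup>+z. indicator ?B (- x + T z) \<partial>lborel)"
    proof (rule nn_integral_cong)
      fix z
      have "norm (- T z + x) = norm (- x + T z)" by (metis minus_add_distrib minus_minus norm_minus_cancel add.commute)
      then show "(indicator ?B (- T z + x) :: ennreal) = indicator ?B (- x + T z)" by (simp add: indicator_def)
    qed
    also have "\<dots> = (\<integral>\<^sup>+z. indicator ?B (T z) \<partial>lborel)" by (rule inv) measurable
    also have "\<dots> = (\<integral>\<^sup>+z. indicator (T -` ?B) z \<partial>lborel)" by (simp add: indicator_def)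
    also have "\<dots> = emeasure lborel (T -` ?B)"
      using measurable_sets[OF Tm, of ?B] by (intro nn_integral_indicator) simp
    finally show "(\<integral>\<^sup>+z. indicator ?B (- T z + x) * G x \<partial>lborel) = emeasure lborel (T -` ?B) * G x" .
  qed
  also have "\<dots> = emeasure lborel (T -` ?B) * (\<integral>\<^sup>+x. G x \<partial>lborel)"
    by (rule nn_integral_cmult) measurable
  finally show ?thesis .
qed

text \<open>
  The factor is the volume of the ball of radius \<open>1 / |l|\<close> relative to the unit ball, which decreases
  in \<open>|l|\<close>.
\<close>

lemma nn_integral_complex_dilation_le:
  fixes \<delta> :: real
  assumes "\<delta> > 0"
  obtains C :: real where "C > 0"
    "\<And>l (G :: complex^'n::finite \<Rightarrow> ennreal). G \<in> borel_measurable borel \<Longrightarrow> cmod l \<ge> \<delta> \<Longrightarrow>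
      (\<integral>\<^sup>+z. G (l *s z) \<partial>lborel) \<le> ennreal C * (\<integral>\<^sup>+z. G z \<partial>lborel)"
proof -
  define V where "V r = unit_ball_vol (DIM(complex^'n)) * r ^ DIM(complex^'n)" for r
  have V: "emeasure lborel (ball (0::complex^'n) r) = ennreal (V r)" if "r \<ge> 0" for r
    unfolding V_def by (rule emeasure_ball[OF that])
  have Vp: "V r > 0" if "r > 0" for r using that by (simp add: V_def)
  show ?thesis
  proof (rule that)
    show "V (1/\<delta>) / V 1 > 0" using Vp assms by simp
    fix l and G :: "complex^'n \<Rightarrow> ennreal"
    assume G [measurable]: "G \<in> borel_measurable borel" and l: "cmod l \<ge> \<delta>"
    have l0: "l \<noteq> 0" using l assms by auto
    have lin: "linear (\<lambda>z::complex^'n. l *s z)" by (rule linearI) (simp_all add: vec_eq_iff algebra_simps)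
    have "z = l *s (inverse l *s z)" for z :: "complex^'n" using l0 by (simp add: vec_eq_iff)
    then have surj: "surj (\<lambda>z::complex^'n. l *s z)" by (metis surjI)
    have "emeasure lborel ((\<lambda>z::complex^'n. l *s z) -` ball 0 1) \<le> emeasure lborel (ball (0::complex^'n) (1/\<delta>))"
    proof (rule emeasure_mono)
      show "(\<lambda>z. l *s z) -` ball 0 1 \<subseteq> ball (0::complex^'n) (1/\<delta>)"
      proof
        fix z :: "complex^'n" assume "z \<in> (\<lambda>z. l *s z) -` ball 0 1"
        then have "cmod l * norm z < 1" by (simp add: norm_vector_smult_complex)
        moreover have "\<delta> * norm z \<le> cmod l * norm z" using l by (intro mult_right_mono) auto
        ultimately show "z \<in> ball 0 (1/\<delta>)" using assms by (simp add: field_simps)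
      qed
    qed simp
    then have "ennreal (V 1) * (\<integral>\<^sup>+z. G (l *s z) \<partial>lborel) \<le> ennreal (V (1/\<delta>)) * (\<integral>\<^sup>+z. G z \<partial>lborel)"
      using nn_integral_lborel_linear_image[OF lin surj G] V[of 1] V[of "1/\<delta>"] assms
      by (simp add: mult_right_mono)
    also have "ennreal (V (1/\<delta>)) = ennreal (V 1) * ennreal (V (1/\<delta>) / V 1)"
      using Vp[of 1] Vp[of "1/\<delta>"] assms by (simp add: ennreal_mult[symmetric])
    finally have "ennreal (V 1) * (\<integral>\<^sup>+z. G (l *s z) \<partial>lborel) \<le> ennreal (V 1) * (ennreal (V (1/\<delta>) / V 1) * (\<integral>\<^sup>+z. G z \<partial>lborel))"
      by (simp add: mult.assoc)
    then show "(\<integral>\<^sup>+z. G (l *s z) \<partial>lborel) \<le> ennreal (V (1/\<delta>) / V 1) * (\<integral>\<^sup>+z. G z \<partial>lborel)"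
      using Vp[of 1] by (simp add: ennreal_mult_le_mult_iff)
  qed
qed

lemma plane_integral_eq_pair:
  assumes [measurable]: "F \<in> borel_measurable borel"
  shows "plane_integral F = (\<integral>\<^sup>+q. F (Complex (fst q) (snd q)) \<partial>lborel)"
proof -
  have "plane_integral F = (\<integral>\<^sup>+q. (case q of (x, y) \<Rightarrow> F (Complex x y)) \<partial>(lborel \<Otimes>\<^sub>M lborel))"
    unfolding plane_integral_def using measurable_plane[OF assms]
    by (subst lborel.nn_integral_fst[symmetric]) auto
  then show ?thesis by (simp add: lborel_prod case_prod_beta')
qed

lemma one_minus_exp_neg_bounds:
  assumes "0 < v" "v \<le> (1::real)" shows "v / 2 \<le> 1 - exp (- v)" "1 - exp (- v) \<le> v"
proof -
  show "1 - exp (- v) \<le> v" using exp_ge_add_one_self[of "-v"] by simp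
  have "1 + v \<le> exp v" by (rule exp_ge_add_one_self)
  then have "exp (- v) \<le> 1 / (1 + v)" using assms by (simp add: exp_minus divide_simps)
  also have "1 / (1 + v) \<le> 1 - v / 2" using assms by (simp add: field_simps)
  finally show "v / 2 \<le> 1 - exp (- v)" by simp
qed

lemma powr_comparable:
  fixes a d t \<kappa> :: real
  assumes "t / d \<le> a" "a \<le> t" "t > 0" "d > 0"
  shows "a powr \<kappa> \<le> max 1 (d powr (- \<kappa>)) * t powr \<kappa>"
proof (cases "\<kappa> \<ge> 0")
  case True
  have "a \<ge> 0" using order_trans[OF _ assms(1), of 0] assms(3,4) by simp
  then have "a powr \<kappa> \<le> 1 * t powr \<kappa>" using True assms by (simp add: powr_mono2)
  also have "\<dots> \<le> max 1 (d powr (- \<kappa>)) * t powr \<kappa>" by (intro mult_right_mono) auto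
  finally show ?thesis .
next
  case False
  then have "a powr \<kappa> \<le> (t / d) powr \<kappa>" using assms by (intro powr_mono2') auto
  also have "\<dots> = d powr (- \<kappa>) * t powr \<kappa>" using assms by (simp add: powr_divide powr_minus_divide)
  also have "\<dots> \<le> max 1 (d powr (- \<kappa>)) * t powr \<kappa>" by (intro mult_right_mono) auto
  finally show ?thesis .
qed

text \<open>
  With \<open>v = x - ln s\<close>, the distance \<open>1 - e\<^sup>-\<^sup>x s = 1 - e\<^sup>-\<^sup>v\<close> is comparable to \<open>min v 1\<close>, and the condition on it
  becomes \<open>v \<le> 4 (1 - s)\<close> unless \<open>1 - s \<ge> 1/4\<close>. What remains is the integral of \<open>v\<^sup>\<kappa>\<close> over \<open>[0, 4 (1 - s)]\<close>.
\<close>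

lemma radial_slice_integral:
  fixes \<kappa> :: real
  assumes \<kappa>: "\<kappa> > -1"
  obtains C :: real where "C > 0"
    "\<And>s. 0 \<le> s \<Longrightarrow> s < 1 \<Longrightarrow> (\<integral>\<^sup>+x. (if -2 \<le> x \<and> x \<le> 1 \<and> exp (-x) * s < 1 \<and> 1 - exp (-x) * s \<le> 2 * (1 - s)
        then ennreal ((1 - exp (-x) * s) powr \<kappa>) else 0) \<partial>lborel) \<le> ennreal (C * (1 - s) powr (\<kappa> + 1))"
proof -
  define K where "K = max 1 (2 powr (- \<kappa>))"
  have K: "K \<ge> 1" by (simp add: K_def)
  define C where "C = K * 4 powr (\<kappa> + 1) * (1 / (\<kappa> + 1) + 3)"
  have C: "C \<ge> 3" "C > 0"
  proof -
    have "1 * 1 * 3 \<le> C" unfolding C_def using K \<kappa> by (intro mult_mono) (auto simp: ge_one_powr_ge_zero)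
    then show "C \<ge> 3" "C > 0" by auto
  qed
  show ?thesis
  proof (rule that[OF C(2)])
    fix s :: real assume s: "0 \<le> s" "s < 1"
    let ?f = "\<lambda>x. if -2 \<le> x \<and> x \<le> 1 \<and> exp (-x) * s < 1 \<and> 1 - exp (-x) * s \<le> 2 * (1 - s)
        then ennreal ((1 - exp (-x) * s) powr \<kappa>) else 0"
    show "(\<integral>\<^sup>+x. ?f x \<partial>lborel) \<le> ennreal (C * (1 - s) powr (\<kappa> + 1))"
    proof (cases "s = 0")
      case True
      have "(\<integral>\<^sup>+x. ?f x \<partial>lborel) \<le> (\<integral>\<^sup>+x. indicator {-2..1::real} x \<partial>lborel)"
        by (intro nn_integral_mono) (auto simp: True indicator_def)
      also have "\<dots> = ennreal 3" by simp
      also have "\<dots> \<le> ennreal (C * (1 - s) powr (\<kappa> + 1))" using C by (intro ennreal_leI) (simp add: True)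
      finally show ?thesis .
    next
      case False
      then have s0: "s > 0" using s by simp
      define \<rho> where "\<rho> = 1 - s"
      have \<rho>: "\<rho> > 0" using s by (simp add: \<rho>_def)
      define L where "L = - ln s"
      define g where "g v = ennreal (indicator {0..4*\<rho>} v * v powr \<kappa>)" for v
      define E where "E = (if 1/4 \<le> \<rho> then 1 else 0 :: real)"
      have gm [measurable]: "g \<in> borel_measurable borel" unfolding g_def by measurable
      have pw: "?f x \<le> ennreal K * (g (L + x) + ennreal E * indicator {-2..1::real} x)" for x
      proof (cases "-2 \<le> x \<and> x \<le> 1 \<and> exp (-x) * s < 1 \<and> 1 - exp (-x) * s \<le> 2 * (1 - s)")
        case True
        define v where "v = L + x"
        have ev: "exp (-x) * s = exp (- v)" using s0 by (simp add: v_def L_def exp_diff exp_minus field_simps)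
        have v: "v > 0" "1 - exp (- v) \<le> 2 * \<rho>" using True unfolding ev \<rho>_def by auto
        show ?thesis
        proof (cases "v \<le> 1")
          case v1: True
          note bd = one_minus_exp_neg_bounds[OF v(1) v1]
          have "v \<in> {0..4*\<rho>}" using bd v by auto
          moreover have "(1 - exp (- v)) powr \<kappa> \<le> K * v powr \<kappa>"
            unfolding K_def by (rule powr_comparable[OF bd v(1)]) simp
          ultimately have "ennreal ((1 - exp (- v)) powr \<kappa>) \<le> ennreal K * g v"
            unfolding g_def using K by (simp add: ennreal_mult'[symmetric] ennreal_leI)
          also have "\<dots> \<le> ennreal K * (g (L + x) + ennreal E * indicator {-2..1::real} x)"
            unfolding v_def by (intro mult_left_mono) auto
          finally show ?thesis using True ev by simp
        next
          case v1: False
          have "exp (- v) \<le> exp (- 1)" using v1 by simp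
          then have half: "1 / 2 \<le> 1 - exp (- v)" using one_minus_exp_neg_bounds(1)[of 1] by linarith
          then have E1: "E = 1" using v by (simp add: E_def)
          have "(1 - exp (- v)) powr \<kappa> \<le> K * 1 powr \<kappa>"
            unfolding K_def by (rule powr_comparable) (use half in auto)
          then have "ennreal ((1 - exp (- v)) powr \<kappa>) \<le> ennreal K * (ennreal E * indicator {-2..1::real} x)"
            using True by (simp add: E1 ennreal_leI)
          also have "\<dots> \<le> ennreal K * (g (L + x) + ennreal E * indicator {-2..1::real} x)"
            by (intro mult_left_mono) auto
          finally show ?thesis using True ev by simp
        qed
      qed (simp only: if_False, simp)
      have "(\<integral>\<^sup>+x. ?f x \<partial>lborel) \<le> (\<integral>\<^sup>+x. ennreal K * (g (L + x) + ennreal E * indicator {-2..1::real} x) \<partial>lborel)"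
        by (intro nn_integral_mono pw)
      also have "\<dots> = ennreal K * ((\<integral>\<^sup>+x. g (L + x) \<partial>lborel) + ennreal E * 3)"
        by (simp add: nn_integral_cmult nn_integral_add)
      also have "(\<integral>\<^sup>+x. g (L + x) \<partial>lborel) = (\<integral>\<^sup>+x. g x \<partial>lborel)"
        by (rule nn_integral_lborel_translate) measurable
      also have "\<dots> = ennreal ((4 * \<rho>) powr (\<kappa> + 1) / (\<kappa> + 1))"
        unfolding g_def using \<kappa> \<rho> by (intro nn_integral_has_integral_lebesgue has_integral_powr_from_0) auto
      also have "ennreal K * (ennreal ((4 * \<rho>) powr (\<kappa> + 1) / (\<kappa> + 1)) + ennreal E * 3) =
          ennreal (K * ((4 * \<rho>) powr (\<kappa> + 1) / (\<kappa> + 1) + E * 3))"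
        proof -
          have E: "ennreal E * 3 = ennreal (E * 3)" "E * 3 \<ge> 0" by (auto simp: E_def)
          have "(4 * \<rho>) powr (\<kappa> + 1) / (\<kappa> + 1) \<ge> 0" using \<kappa> by simp
          then show ?thesis using K E(2) unfolding E(1)
            by (simp only: ennreal_plus[symmetric] ennreal_mult'[symmetric] add_nonneg_nonneg)
        qed
      also have "\<dots> \<le> ennreal (C * \<rho> powr (\<kappa> + 1))"
      proof (rule ennreal_leI)
        have "E * 3 \<le> (4 * \<rho>) powr (\<kappa> + 1) * 3"
          using \<kappa> \<rho> by (auto simp: E_def ge_one_powr_ge_zero)
        then have "K * ((4 * \<rho>) powr (\<kappa> + 1) / (\<kappa> + 1) + E * 3) \<le> K * ((4 * \<rho>) powr (\<kappa> + 1) / (\<kappa> + 1) + (4 * \<rho>) powr (\<kappa> + 1) * 3)"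
          using K by (intro mult_left_mono add_left_mono) auto
        also have "\<dots> = C * \<rho> powr (\<kappa> + 1)" using \<rho> by (simp add: C_def powr_mult algebra_simps)
        finally show "K * ((4 * \<rho>) powr (\<kappa> + 1) / (\<kappa> + 1) + E * 3) \<le> C * \<rho> powr (\<kappa> + 1)" .
      qed
      finally show ?thesis by (simp add: \<rho>_def)
    qed
  qed
qed

text \<open>
  For \<open>s = |z|\<close>, the points \<open>e\<^sup>w z\<close> at which \<open>g\<close> influences the bound for \<open>D\<^sup>t g (z)\<close>. They are not much closer
  to the boundary than \<open>z\<close> and turn away from the ray through \<open>z\<close> by an angle of at most a multiple
  of their distance from the boundary. The factor \<open>20\<close> is large enough to admit all angles
  on the circle \<open>|e\<^sup>w| = 1/e\<close>.
\<close>

definition approach_region :: "real \<Rightarrow> complex \<Rightarrow> bool" where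
  "approach_region s w \<longleftrightarrow> -2 \<le> Re w \<and> Re w \<le> 1 \<and> exp (Re w) * s < 1 \<and>
     1 - s \<le> 2 * (1 - exp (Re w) * s) \<and> \<bar>Im w\<bar> \<le> 20 * (1 - exp (Re w) * s)"

definition region_integral :: "real \<Rightarrow> (complex^'n::finite \<Rightarrow> ennreal) \<Rightarrow> complex^'n \<Rightarrow> ennreal" where
  "region_integral \<gamma> G z = plane_integral (\<lambda>w. if approach_region (norm z) w
     then ennreal ((1 - exp (Re w) * norm z) powr \<gamma>) * G (exp w *s z) else 0)"

lemma continuous_on_smult_vec:
  fixes f :: "'a::topological_space \<Rightarrow> complex" and g :: "'a \<Rightarrow> complex^'n::finite"
  assumes "continuous_on S f" "continuous_on S g"
  shows "continuous_on S (\<lambda>x. f x *s g x)"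
  unfolding vector_scalar_mult_def by (intro continuous_intros assms)

lemma measurable_region_kernel:
  fixes a b n :: "'a \<Rightarrow> real" and G :: "'a \<Rightarrow> ennreal"
  assumes [measurable]: "a \<in> borel_measurable M" "b \<in> borel_measurable M" "n \<in> borel_measurable M" "G \<in> borel_measurable M"
  shows "(\<lambda>p. if -2 \<le> a p \<and> a p \<le> 1 \<and> n p < 1 \<and> exp (- a p) * n p < 1 \<and>
        1 - exp (- a p) * n p \<le> 2 * (1 - n p) \<and> \<bar>b p\<bar> \<le> 20 * (1 - n p)
        then ennreal ((1 - exp (- a p) * n p) powr \<kappa>) * (ennreal ((1 - n p) powr \<gamma>) * G p) else 0) \<in> borel_measurable M"
  by measurable

text \<open>
  Exchange the integrals and substitute \<open>y = e\<^sup>w z\<close>. For fixed \<open>y\<close> with \<open>\<rho> = 1 - |y|\<close>, the imaginary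
  part of \<open>w\<close> ranges over an interval of length \<open>40 \<rho>\<close> and the integral over the real part is at most a
  constant times \<open>\<rho>\<^sup>(\<^sup>\<kappa>\<^sup>+\<^sup>1\<^sup>)\<close>, which explains the gain of \<open>2\<close> in the exponent.
\<close>

lemma integral_region_integral_le:
  fixes \<kappa> \<gamma> :: real
  assumes \<kappa>: "\<kappa> > -1"
  obtains C :: real where "C > 0"
    "\<And>G :: complex^'n::finite \<Rightarrow> ennreal. G \<in> borel_measurable borel \<Longrightarrow>
      (\<integral>\<^sup>+z. indicator (ball 0 1) z * (ennreal ((1 - norm z) powr \<kappa>) * region_integral \<gamma> G z) \<partial>lborel)
      \<le> ennreal C * (\<integral>\<^sup>+z. indicator (ball 0 1) z * (ennreal ((1 - norm z) powr (\<gamma> + \<kappa> + 2)) * G z) \<partial>lborel)"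
proof -
  obtain C1 :: real where C1: "C1 > 0"
    "\<And>l (G :: complex^'n \<Rightarrow> ennreal). G \<in> borel_measurable borel \<Longrightarrow> cmod l \<ge> exp (-2) \<Longrightarrow>
      (\<integral>\<^sup>+z. G (l *s z) \<partial>lborel) \<le> ennreal C1 * (\<integral>\<^sup>+z. G z \<partial>lborel)"
    using nn_integral_complex_dilation_le[of "exp (-2)"] by (metis exp_gt_zero)
  obtain C2 :: real where C2: "C2 > 0"
    "\<And>s. 0 \<le> s \<Longrightarrow> s < 1 \<Longrightarrow> (\<integral>\<^sup>+x. (if -2 \<le> x \<and> x \<le> 1 \<and> exp (-x) * s < 1 \<and> 1 - exp (-x) * s \<le> 2 * (1 - s)
        then ennreal ((1 - exp (-x) * s) powr \<kappa>) else 0) \<partial>lborel) \<le> ennreal (C2 * (1 - s) powr (\<kappa> + 1))"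
    using radial_slice_integral[OF \<kappa>] by blast
  show ?thesis
  proof (rule that)
    show "C1 * (40 * C2) > 0" using C1 C2 by simp
    fix G :: "complex^'n \<Rightarrow> ennreal" assume G [measurable]: "G \<in> borel_measurable borel"
    define H where "H q y = (if -2 \<le> fst q \<and> fst q \<le> 1 \<and> norm y < 1 \<and> exp (- fst q) * norm y < 1 \<and>
        1 - exp (- fst q) * norm y \<le> 2 * (1 - norm y) \<and> \<bar>snd q\<bar> \<le> 20 * (1 - norm y)
        then ennreal ((1 - exp (- fst q) * norm y) powr \<kappa>) * (ennreal ((1 - norm y) powr \<gamma>) * G y) else 0)"
      for q :: "real \<times> real" and y :: "complex^'n"
    define W where "W q = exp (Complex (fst q) (snd q))" for q
    have cW: "continuous_on UNIV W" unfolding W_def by (intro continuous_intros continuous_on_Complex)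
    have Wm: "(\<lambda>(q, z::complex^'n). W q *s z) \<in> borel_measurable (borel \<Otimes>\<^sub>M borel)"
    proof -
      have "(\<lambda>p :: (real \<times> real) \<times> (complex^'n). W (fst p) *s snd p) \<in> borel_measurable borel"
        by (intro borel_measurable_continuous_onI continuous_on_smult_vec continuous_on_snd
            continuous_on_compose2[OF cW continuous_on_fst]) (auto intro: continuous_intros)
      then show ?thesis by (simp add: borel_prod case_prod_beta')
    qed
    have Hm: "(\<lambda>(q, y). H q y) \<in> borel_measurable (borel \<Otimes>\<^sub>M borel)"
    proof -
      define M where "M = (borel :: (real \<times> real) measure) \<Otimes>\<^sub>M (borel :: (complex^'n) measure)"
      define a :: "(real \<times> real) \<times> (complex^'n) \<Rightarrow> real" where "a p = fst (fst p)" for p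
      define b :: "(real \<times> real) \<times> (complex^'n) \<Rightarrow> real" where "b p = snd (fst p)" for p
      define n :: "(real \<times> real) \<times> (complex^'n) \<Rightarrow> real" where "n p = norm (snd p)" for p
      define G' :: "(real \<times> real) \<times> (complex^'n) \<Rightarrow> ennreal" where "G' p = G (snd p)" for p
      have "a \<in> borel_measurable M" "b \<in> borel_measurable M" "n \<in> borel_measurable M"
        unfolding a_def b_def n_def M_def borel_prod by (intro borel_measurable_continuous_onI continuous_intros)+
      have "G' \<in> borel_measurable M"
        unfolding G'_def M_def by (rule measurable_compose[OF measurable_snd G])
      have eq: "(\<lambda>(q, y). H q y) = (\<lambda>p. if -2 \<le> a p \<and> a p \<le> 1 \<and> n p < 1 \<and> exp (- a p) * n p < 1 \<and>
        1 - exp (- a p) * n p \<le> 2 * (1 - n p) \<and> \<bar>b p\<bar> \<le> 20 * (1 - n p)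
        then ennreal ((1 - exp (- a p) * n p) powr \<kappa>) * (ennreal ((1 - n p) powr \<gamma>) * G' p) else 0)"
        by (simp add: fun_eq_iff H_def a_def b_def n_def G'_def)
      show ?thesis unfolding M_def[symmetric] eq by (intro measurable_region_kernel) fact+
    qed
    have Hq: "H q \<in> borel_measurable borel" for q
      using measurable_compose[OF measurable_Pair1' Hm, of q] by simp
    have HWm: "(\<lambda>(z, q). H q (W q *s z)) \<in> borel_measurable (lborel \<Otimes>\<^sub>M lborel)"
    proof -
      have X: "(\<lambda>p :: (complex^'n) \<times> (real \<times> real). W (snd p) *s fst p) \<in> borel_measurable (borel \<Otimes>\<^sub>M borel)"
        using measurable_compose[OF measurable_pair_swap' Wm] by (simp add: case_prod_beta')
      from measurable_compose[OF measurable_Pair[OF measurable_snd X] Hm] show ?thesis by (simp add: case_prod_beta')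
    qed
    have "(\<integral>\<^sup>+z. indicator (ball 0 1) z * (ennreal ((1 - norm z) powr \<kappa>) * region_integral \<gamma> G z) \<partial>lborel)
       = (\<integral>\<^sup>+z. (\<integral>\<^sup>+q. H q (W q *s z) \<partial>lborel) \<partial>lborel)"
    proof (rule nn_integral_cong)
      fix z :: "complex^'n"
      have nW: "norm (W q *s z) = exp (fst q) * norm z" for q
        by (simp add: W_def norm_vector_smult_complex)
      show "indicator (ball 0 1) z * (ennreal ((1 - norm z) powr \<kappa>) * region_integral \<gamma> G z) = (\<integral>\<^sup>+q. H q (W q *s z) \<partial>lborel)"
      proof (cases "norm z < 1")
        case True
        let ?F = "\<lambda>w. if approach_region (norm z) w then ennreal ((1 - exp (Re w) * norm z) powr \<gamma>) * G (exp w *s z) else 0"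
        have "(\<lambda>w. exp w *s z) \<in> borel_measurable borel"
          by (intro borel_measurable_continuous_onI continuous_on_smult_vec continuous_intros)
        then have [measurable]: "(\<lambda>w. G (exp w *s z)) \<in> borel_measurable borel" by measurable
        have F: "?F \<in> borel_measurable borel" unfolding approach_region_def by measurable
        have "ennreal ((1 - norm z) powr \<kappa>) * region_integral \<gamma> G z = (\<integral>\<^sup>+q. ennreal ((1 - norm z) powr \<kappa>) * ?F (Complex (fst q) (snd q)) \<partial>lborel)"
          unfolding region_integral_def plane_integral_eq_pair[OF F]
        proof (rule nn_integral_cmult[symmetric])
          have "(\<lambda>q. Complex (fst q) (snd q)) \<in> borel_measurable borel"
            by (intro borel_measurable_continuous_onI continuous_on_Complex continuous_intros)
          from measurable_compose[OF this F] show "(\<lambda>q. ?F (Complex (fst q) (snd q))) \<in> borel_measurable lborel" by simp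
        qed
        also have "\<dots> = (\<integral>\<^sup>+q. H q (W q *s z) \<partial>lborel)"
        proof (rule nn_integral_cong)
          fix q :: "real \<times> real"
          have e: "exp (- fst q) * (exp (fst q) * norm z) = norm z" by (simp add: mult.assoc[symmetric] flip: exp_add)
          show "ennreal ((1 - norm z) powr \<kappa>) * ?F (Complex (fst q) (snd q)) = H q (W q *s z)"
            unfolding H_def nW e approach_region_def using True by (simp add: W_def)
        qed
        finally show ?thesis using True by simp
      next
        case False
        have e: "exp (- fst q) * (exp (fst q) * norm z) = norm z" for q :: "real \<times> real"
          by (simp add: mult.assoc[symmetric] flip: exp_add)
        have "H q (W q *s z) = 0" for q unfolding H_def nW e using False by simp
        then show ?thesis using False by simp
      qed
    qed
    also have "\<dots> = (\<integral>\<^sup>+q. (\<integral>\<^sup>+z. H q (W q *s z) \<partial>lborel) \<partial>lborel)"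
      using lborel_pair.Fubini'[OF HWm] by simp
    also have "\<dots> \<le> (\<integral>\<^sup>+q. ennreal C1 * (\<integral>\<^sup>+y. H q y \<partial>lborel) \<partial>lborel)"
    proof (rule nn_integral_mono)
      fix q :: "real \<times> real"
      show "(\<integral>\<^sup>+z. H q (W q *s z) \<partial>lborel) \<le> ennreal C1 * (\<integral>\<^sup>+y. H q y \<partial>lborel)"
      proof (cases "-2 \<le> fst q")
        case True
        then show ?thesis by (intro C1(2) Hq) (simp add: W_def)
      qed (simp add: H_def)
    qed
    also have "\<dots> = ennreal C1 * (\<integral>\<^sup>+q. (\<integral>\<^sup>+y. H q y \<partial>lborel) \<partial>lborel)"
      by (rule nn_integral_cmult) (use lborel.borel_measurable_nn_integral[of H borel] Hm in simp)
    also have "(\<integral>\<^sup>+q. (\<integral>\<^sup>+y. H q y \<partial>lborel) \<partial>lborel) = (\<integral>\<^sup>+y. (\<integral>\<^sup>+q. H q y \<partial>lborel) \<partial>lborel)"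
      by (rule lborel_pair.Fubini'[symmetric]) (use Hm in simp)
    also have "\<dots> \<le> (\<integral>\<^sup>+y. ennreal (40 * C2) * (indicator (ball 0 1) y * (ennreal ((1 - norm y) powr (\<gamma> + \<kappa> + 2)) * G y)) \<partial>lborel)"
    proof (rule nn_integral_mono)
      fix y :: "complex^'n"
      show "(\<integral>\<^sup>+q. H q y \<partial>lborel) \<le> ennreal (40 * C2) * (indicator (ball 0 1) y * (ennreal ((1 - norm y) powr (\<gamma> + \<kappa> + 2)) * G y))"
      proof (cases "norm y < 1")
        case True
        define \<rho> where "\<rho> = 1 - norm y"
        have \<rho>: "\<rho> > 0" using True by (simp add: \<rho>_def)
        let ?f = "\<lambda>x. if -2 \<le> x \<and> x \<le> 1 \<and> exp (-x) * norm y < 1 \<and> 1 - exp (-x) * norm y \<le> 2 * (1 - norm y)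
            then ennreal ((1 - exp (-x) * norm y) powr \<kappa>) else 0"
        let ?c = "ennreal (\<rho> powr \<gamma>) * G y"
        let ?k = "\<lambda>(x, t). ?f x * (indicator {- (20 * \<rho>)..20 * \<rho>} t * ?c)"
        have fm: "?f \<in> borel_measurable borel" by measurable
        have km: "?k \<in> borel_measurable (lborel \<Otimes>\<^sub>M lborel)" using fm by measurable
        have "(\<integral>\<^sup>+q. H q y \<partial>lborel) = (\<integral>\<^sup>+q. ?k q \<partial>(lborel \<Otimes>\<^sub>M lborel))"
          unfolding lborel_prod
        proof (rule nn_integral_cong)
          fix q :: "real \<times> real"
          have "\<bar>snd q\<bar> \<le> 20 * (1 - norm y) \<longleftrightarrow> snd q \<in> {- (20 * \<rho>)..20 * \<rho>}" by (auto simp: \<rho>_def)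
          then show "H q y = ?k q" unfolding H_def case_prod_beta \<rho>_def[symmetric] using True
            by (auto simp: indicator_def)
        qed
        also have "\<dots> = (\<integral>\<^sup>+x. \<integral>\<^sup>+t. ?f x * (indicator {- (20 * \<rho>)..20 * \<rho>} t * ?c) \<partial>lborel \<partial>lborel)"
          using lborel.nn_integral_fst[OF km] by simp
        also have "\<dots> = (\<integral>\<^sup>+x. ?f x * (ennreal (40 * \<rho>) * ?c) \<partial>lborel)"
        proof (rule nn_integral_cong)
          fix x
          have "(\<integral>\<^sup>+t. ?f x * (indicator {- (20 * \<rho>)..20 * \<rho>} t * ?c) \<partial>lborel) = ?f x * ((\<integral>\<^sup>+t. indicator {- (20 * \<rho>)..20 * \<rho>} t \<partial>lborel) * ?c)"
            by (subst nn_integral_cmult) (auto simp: nn_integral_multc)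
          then show "(\<integral>\<^sup>+t. ?f x * (indicator {- (20 * \<rho>)..20 * \<rho>} t * ?c) \<partial>lborel) = ?f x * (ennreal (40 * \<rho>) * ?c)"
            using \<rho> by simp
        qed
        also have "\<dots> = (\<integral>\<^sup>+x. ?f x \<partial>lborel) * (ennreal (40 * \<rho>) * ?c)"
          by (rule nn_integral_multc) (use fm in simp)
        also have "\<dots> \<le> ennreal (C2 * \<rho> powr (\<kappa> + 1)) * (ennreal (40 * \<rho>) * ?c)"
          using C2(2)[of "norm y"] True unfolding \<rho>_def by (intro mult_right_mono) auto
        also have "\<dots> = ennreal (C2 * \<rho> powr (\<kappa> + 1) * (40 * \<rho>) * \<rho> powr \<gamma>) * G y"
          using C2(1) \<rho> by (simp add: ennreal_mult mult.assoc)
        also have "C2 * \<rho> powr (\<kappa> + 1) * (40 * \<rho>) * \<rho> powr \<gamma> = 40 * C2 * \<rho> powr (\<gamma> + \<kappa> + 2)"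
        proof -
          have "\<rho> powr (\<gamma> + \<kappa> + 2) = \<rho> powr (\<kappa> + 1) * \<rho> powr 1 * \<rho> powr \<gamma>"
            unfolding powr_add[symmetric] by (simp add: algebra_simps)
          then show ?thesis using \<rho> by simp
        qed
        also have "ennreal (40 * C2 * \<rho> powr (\<gamma> + \<kappa> + 2)) * G y = ennreal (40 * C2) * (indicator (ball 0 1) y * (ennreal ((1 - norm y) powr (\<gamma> + \<kappa> + 2)) * G y))"
          using True C2(1) by (simp add: \<rho>_def ennreal_mult mult.assoc)
        finally show ?thesis .
      qed (simp add: H_def)
    qed
    also have "\<dots> = ennreal (40 * C2) * (\<integral>\<^sup>+y. indicator (ball 0 1) y * (ennreal ((1 - norm y) powr (\<gamma> + \<kappa> + 2)) * G y) \<partial>lborel)"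
    proof (rule nn_integral_cmult)
      have [measurable]: "ball (0::complex^'n) 1 \<in> sets borel" by simp
      have "(\<lambda>y::complex^'n. (1 - norm y) powr (\<gamma> + \<kappa> + 2)) \<in> borel_measurable borel"
        by (intro powr_real_measurable borel_measurable_diff borel_measurable_const borel_measurable_norm measurable_ident_sets)
      then have "(\<lambda>y. indicator (ball 0 1) y * (ennreal ((1 - norm y) powr (\<gamma> + \<kappa> + 2)) * G y)) \<in> borel_measurable borel"
        using G by (intro borel_measurable_times_ennreal borel_measurable_indicator measurable_compose[OF _ measurable_ennreal]) auto
      then show "(\<lambda>y. indicator (ball 0 1) y * (ennreal ((1 - norm y) powr (\<gamma> + \<kappa> + 2)) * G y)) \<in> borel_measurable lborel"
        by simp
    qed
    finally show "(\<integral>\<^sup>+z. indicator (ball 0 1) z * (ennreal ((1 - norm z) powr \<kappa>) * region_integral \<gamma> G z) \<partial>lborel)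
      \<le> ennreal (C1 * (40 * C2)) * (\<integral>\<^sup>+z. indicator (ball 0 1) z * (ennreal ((1 - norm z) powr (\<gamma> + \<kappa> + 2)) * G z) \<partial>lborel)"
      using C1(1) C2(1) by (simp add: ennreal_mult mult.assoc mult_left_mono)
  qed
qed

section \<open>Pointwise bounds along slices\<close>

lemma gamma_kernel_has_integral:
  fixes \<sigma> :: real and j :: nat
  assumes "\<sigma> > 0" "j > 0"
  shows "has_bochner_integral lborel (\<lambda>u. indicator {0..} u * (u powr (\<sigma> - 1) * exp (- real j * u))) (Gamma \<sigma> * real j powr (- \<sigma>))"
proof (rule has_bochner_integral_nn_integral)
  let ?f = "\<lambda>t. ennreal (indicator {0..} t * t powr (\<sigma> - 1) / exp t)"
  have "ennreal (Gamma \<sigma>) = integral\<^sup>N lborel ?f" by (rule Gamma_conv_nn_integral_real[OF assms(1)])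
  also have "\<dots> = \<bar>real j\<bar> * (\<integral>\<^sup>+u. ?f (0 + real j * u) \<partial>lborel)"
    by (rule nn_integral_real_affine) (use assms in auto)
  also have "(\<lambda>u. ?f (0 + real j * u)) = (\<lambda>u. ennreal (real j powr (\<sigma> - 1)) * ennreal (indicator {0..} u * (u powr (\<sigma> - 1) * exp (- real j * u))))"
    using assms by (intro ext) (auto simp: indicator_def zero_le_mult_iff powr_mult ennreal_mult'[symmetric] exp_minus field_simps)
  also have "integral\<^sup>N lborel \<dots> = ennreal (real j powr (\<sigma> - 1)) * (\<integral>\<^sup>+u. ennreal (indicator {0..} u * (u powr (\<sigma> - 1) * exp (- real j * u))) \<partial>lborel)"
    by (rule nn_integral_cmult) auto
  finally have *: "ennreal (Gamma \<sigma>) = ennreal (real j) * (ennreal (real j powr (\<sigma> - 1)) *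
      (\<integral>\<^sup>+u. ennreal (indicator {0..} u * (u powr (\<sigma> - 1) * exp (- real j * u))) \<partial>lborel))" by simp
  have jj: "real j powr (- \<sigma>) * (real j * real j powr (\<sigma> - 1)) = 1"
  proof -
    have "real j powr (- \<sigma>) * (real j powr 1 * real j powr (\<sigma> - 1)) = real j powr (- \<sigma> + (1 + (\<sigma> - 1)))"
      by (simp only: powr_add)
    then show ?thesis using assms by simp
  qed
  have "ennreal (Gamma \<sigma> * real j powr (- \<sigma>)) = ennreal (real j powr (- \<sigma>)) * ennreal (Gamma \<sigma>)"
    using Gamma_real_pos[OF assms(1)] by (simp add: ennreal_mult'[symmetric] mult.commute)
  also have "\<dots> = ennreal (real j powr (- \<sigma>) * (real j * real j powr (\<sigma> - 1))) *
      (\<integral>\<^sup>+u. ennreal (indicator {0..} u * (u powr (\<sigma> - 1) * exp (- real j * u))) \<partial>lborel)"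
    unfolding * by (simp add: ennreal_mult' mult.assoc)
  finally show "(\<integral>\<^sup>+u. ennreal (indicator {0..} u * (u powr (\<sigma> - 1) * exp (- real j * u))) \<partial>lborel) = ennreal (Gamma \<sigma> * real j powr (- \<sigma>))"
    unfolding jj by simp
qed (use Gamma_real_pos[OF assms(1)] in auto)

lemma enumerate_multi_indices:
  obtains e :: "nat \<Rightarrow> ('n::finite \<Rightarrow> nat)" where "bij_betw e UNIV UNIV"
  using bij_betw_from_nat_into[OF countableI_type infinite_UNIV_multi_index] by blast

text \<open>
  Termwise, \<open>|m|\<^sup>s = |m|\<^sup>k |m|\<^sup>-\<^sup>\<sigma>\<close> and \<open>\<Gamma>(\<sigma>) |m|\<^sup>-\<^sup>\<sigma>\<close> is the integral of \<open>u\<^sup>(\<^sup>\<sigma>\<^sup>-\<^sup>1\<^sup>) e\<^sup>-\<^sup>u\<^sup>|\<^sup>m\<^sup>|\<close>. The term with \<open>m = 0\<close>,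
  for which this fails, is absent because \<open>g\<close> vanishes at the origin.
\<close>

lemma fractional_integral_bound:
  fixes c :: "('n::finite \<Rightarrow> nat) \<Rightarrow> complex" and s \<sigma> :: real and k :: nat
  assumes g: "mseries c g" and c0: "c (\<lambda>_. 0) = 0"
    and h: "mseries (\<lambda>m. of_real (real (mi_order m) powr s) * c m) h"
    and \<sigma>: "\<sigma> = real k - s" "\<sigma> > 0" and z: "z \<in> ball 0 1"
  shows "ennreal (Gamma \<sigma> * cmod (h z)) \<le>
    (\<integral>\<^sup>+u. indicator {0..} u * ennreal (u powr (\<sigma> - 1) * cmod ((radial_deriv ^^ k) g (of_real (exp (- u)) *s z))) \<partial>lborel)"
proof -
  obtain e :: "nat \<Rightarrow> ('n \<Rightarrow> nat)" where e: "bij_betw e UNIV UNIV" by (rule enumerate_multi_indices)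
  define a where "a m = of_nat (mi_order m) ^ k * c m * mi_power z m" for m
  define \<phi> where "\<phi> j u = indicator {0..} u * (u powr (\<sigma> - 1) * exp (- real j * u))" for j and u :: real
  define f where "f n u = \<phi> (mi_order (e n)) u *\<^sub>R a (e n)" for n u
  have \<Gamma>: "Gamma \<sigma> > 0" by (rule Gamma_real_pos[OF \<sigma>(2)])
  have a0: "a m = 0" if "mi_order m = 0" for m
    using that c0 by (simp add: a_def mi_order_eq_0_iff)
  have key: "of_real (Gamma \<sigma> * real (mi_order m) powr (- \<sigma>)) * a m = of_real (Gamma \<sigma>) * (of_real (real (mi_order m) powr s) * c m * mi_power z m)" for m
  proof (cases "mi_order m = 0")
    case False
    have "real (mi_order m) ^ k = real (mi_order m) powr real k" using False by (simp add: powr_realpow)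
    then have "real (mi_order m) powr (- \<sigma>) * real (mi_order m) ^ k = real (mi_order m) powr (- \<sigma> + real k)"
      by (simp only: powr_add)
    then have *: "real (mi_order m) powr (- \<sigma>) * real (mi_order m) ^ k = real (mi_order m) powr s" using \<sigma> by simp
    show ?thesis unfolding a_def *[symmetric] by (simp add: mult_ac)
  next
    case True
    then show ?thesis using c0 by (simp add: a_def mi_order_eq_0_iff)
  qed
  have fb: "has_bochner_integral lborel (f n) (of_real (Gamma \<sigma>) * (of_real (real (mi_order (e n)) powr s) * c (e n) * mi_power z (e n)))" for n
  proof (cases "mi_order (e n) = 0")
    case False
    then have "has_bochner_integral lborel (\<phi> (mi_order (e n))) (Gamma \<sigma> * real (mi_order (e n)) powr (- \<sigma>))"
      unfolding \<phi>_def by (intro gamma_kernel_has_integral \<sigma>) simp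
    then have "has_bochner_integral lborel (f n) ((Gamma \<sigma> * real (mi_order (e n)) powr (- \<sigma>)) *\<^sub>R a (e n))"
      unfolding f_def by (intro has_bochner_integral_scaleR_left) auto
    then show ?thesis by (simp only: scaleR_conv_of_real key)
  next
    case True
    then have "f n = (\<lambda>_. 0)" by (simp add: f_def a0 fun_eq_iff)
    moreover have "c (e n) = 0" using True c0 by (simp add: mi_order_eq_0_iff)
    ultimately show ?thesis by (simp add: has_bochner_integral_zero)
  qed
  have fn: "(\<integral>u. norm (f n u) \<partial>lborel) = Gamma \<sigma> * norm (of_real (real (mi_order (e n)) powr s) * c (e n) * mi_power z (e n))" for n
  proof (cases "mi_order (e n) = 0")
    case False
    have "has_bochner_integral lborel (\<lambda>u. \<phi> (mi_order (e n)) u * norm (a (e n))) ((Gamma \<sigma> * real (mi_order (e n)) powr (- \<sigma>)) * norm (a (e n)))"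
      unfolding \<phi>_def using False by (intro has_bochner_integral_mult_left gamma_kernel_has_integral \<sigma>) simp
    moreover have "(\<lambda>u. norm (f n u)) = (\<lambda>u. \<phi> (mi_order (e n)) u * norm (a (e n)))" by (simp add: f_def \<phi>_def)
    ultimately have "(\<integral>u. norm (f n u) \<partial>lborel) = (Gamma \<sigma> * real (mi_order (e n)) powr (- \<sigma>)) * norm (a (e n))"
      by (simp only: has_bochner_integral_integral_eq)
    also have "\<dots> = norm (of_real (Gamma \<sigma> * real (mi_order (e n)) powr (- \<sigma>)) * a (e n))"
      unfolding norm_mult[of "of_real _"] norm_of_real using \<Gamma> by simp
    also have "\<dots> = Gamma \<sigma> * norm (of_real (real (mi_order (e n)) powr s) * c (e n) * mi_power z (e n))"
      unfolding key norm_mult[of "of_real (Gamma \<sigma>)"] using \<Gamma> by simp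
    finally show ?thesis .
  next
    case True
    then have "f n = (\<lambda>_. 0)" by (simp add: f_def a0 fun_eq_iff)
    moreover have "c (e n) = 0" using True c0 by (simp add: mi_order_eq_0_iff)
    ultimately show ?thesis by simp
  qed
  have reab: "summable (\<lambda>n. norm (b (e n)))" if "(\<lambda>m. norm (b m)) summable_on UNIV" for b :: "('n \<Rightarrow> nat) \<Rightarrow> complex"
    by (rule summable_on_imp_summable) (rule summable_on_reindex_bij_betw[OF e, THEN iffD2, OF that])
  have resum: "(\<lambda>n. b (e n)) sums l" if "(b has_sum l) UNIV" for b :: "('n \<Rightarrow> nat) \<Rightarrow> complex" and l
    by (rule has_sum_imp_sums) (rule has_sum_reindex_bij_betw[OF e, THEN iffD2, OF that])
  define F where "F u = indicator {0..} u * u powr (\<sigma> - 1)" for u :: real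
  have ball: "of_real (exp (- u)) *s z \<in> ball 0 1" if "u \<ge> 0" for u
  proof -
    have "exp (- u) * norm z \<le> 1 * norm z" using that by (intro mult_right_mono) auto
    then show ?thesis using z by (simp add: norm_vector_smult_complex)
  qed
  have fF: "f n u = of_real (F u) * (of_nat (mi_order (e n)) ^ k * c (e n) * mi_power (of_real (exp (- u)) *s z) (e n))" for n u
  proof -
    have "exp (- real (mi_order (e n)) * u) = exp (- u) ^ mi_order (e n)"
      by (simp add: exp_of_nat_mult[symmetric])
    then show ?thesis by (simp add: f_def \<phi>_def F_def a_def mi_power_smult scaleR_conv_of_real mult_ac)
  qed
  note gk = mseries_radial_deriv_funpow[OF g, of k]
  have pt: "(\<lambda>n. f n u) sums (of_real (F u) * (radial_deriv ^^ k) g (of_real (exp (- u)) *s z))" for u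
  proof (cases "u \<ge> 0")
    case True
    show ?thesis unfolding fF
      by (intro sums_mult resum) (use gk ball[OF True] in \<open>simp add: mseries_def\<close>)
  qed (simp add: fF F_def)
  have ptn: "summable (\<lambda>n. norm (f n u))" for u
  proof (cases "u \<ge> 0")
    case True
    have "(\<lambda>m. norm (of_nat (mi_order m) ^ k * c m * mi_power (of_real (exp (- u)) *s z) m)) summable_on UNIV"
      using gk ball[OF True] unfolding mseries_def
      by (intro summable_on_iff_abs_summable_on_complex[THEN iffD1] has_sum_imp_summable) blast
    from reab[OF this] show ?thesis unfolding fF norm_mult[of "of_real (F u)"] by (rule summable_mult)
  qed (simp add: fF F_def)
  have fin: "summable (\<lambda>n. \<integral>u. norm (f n u) \<partial>lborel)"
    unfolding fn using h z unfolding mseries_def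
    by (intro summable_mult reab summable_on_iff_abs_summable_on_complex[THEN iffD1] has_sum_imp_summable) blast
  have int: "integrable lborel (f n)" for n using fb has_bochner_integral_iff by blast
  have "(\<integral>u. (\<Sum>n. f n u) \<partial>lborel) = (\<Sum>n. \<integral>u. f n u \<partial>lborel)"
    by (rule integral_suminf[OF int _ fin]) (simp add: ptn)
  also have "\<dots> = (\<Sum>n. of_real (Gamma \<sigma>) * (of_real (real (mi_order (e n)) powr s) * c (e n) * mi_power z (e n)))"
    using has_bochner_integral_integral_eq[OF fb] by simp
  also have "\<dots> = of_real (Gamma \<sigma>) * h z"
    by (rule sums_unique[symmetric]) (intro sums_mult resum, use h z in \<open>simp add: mseries_def\<close>)
  finally have eq: "(\<integral>u. of_real (F u) * (radial_deriv ^^ k) g (of_real (exp (- u)) *s z) \<partial>lborel) = of_real (Gamma \<sigma>) * h z"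
    unfolding sums_unique[OF pt, symmetric] .
  have "integrable lborel (\<lambda>u. \<Sum>n. f n u)"
    by (rule integrable_suminf[OF int _ fin]) (simp add: ptn)
  then have "integrable lborel (\<lambda>u. of_real (F u) * (radial_deriv ^^ k) g (of_real (exp (- u)) *s z))"
    unfolding sums_unique[OF pt, symmetric] .
  from integral_norm_bound_ennreal[OF this]
  have "ennreal (norm (of_real (Gamma \<sigma>) * h z)) \<le> (\<integral>\<^sup>+u. norm (of_real (F u) * (radial_deriv ^^ k) g (of_real (exp (- u)) *s z)) \<partial>lborel)"
    unfolding eq .
  also have "norm (of_real (Gamma \<sigma>) * h z) = Gamma \<sigma> * cmod (h z)" using \<Gamma> by (simp add: norm_mult)
  also have "(\<integral>\<^sup>+u. norm (of_real (F u) * (radial_deriv ^^ k) g (of_real (exp (- u)) *s z)) \<partial>lborel) =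
     (\<integral>\<^sup>+u. indicator {0..} u * ennreal (u powr (\<sigma> - 1) * cmod ((radial_deriv ^^ k) g (of_real (exp (- u)) *s z))) \<partial>lborel)"
    by (intro nn_integral_cong) (auto simp: F_def indicator_def norm_mult)
  finally show ?thesis .
qed

lemma mseries_compose_has_derivative:
  fixes g :: "complex^'n::finite \<Rightarrow> complex"
  assumes g: "mseries c g" and \<lambda>: "(l has_field_derivative l') (at w)" and w: "l w *s z \<in> ball 0 1"
  obtains D where "((\<lambda>w. g (l w *s z)) has_field_derivative D (l' *s z)) (at w)"
     "\<And>c v. D (c *s v) = c * D v" "D (l w *s z) = radial_deriv g (l w *s z)"
proof -
  obtain D where D: "(g has_derivative D) (at (l w *s z))" "\<And>c v. D (c *s v) = c * D v" "D (l w *s z) = radial_deriv g (l w *s z)"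
    by (rule mseries_has_derivative_radial[OF g w]) (rule that)
  have "linear (\<lambda>t::complex. t *s z)" by (rule linearI) (simp_all add: vec_eq_iff algebra_simps)
  then have bl: "bounded_linear (\<lambda>t::complex. t *s z)" by (simp add: linear_conv_bounded_linear)
  have "((\<lambda>w. l w *s z) has_derivative (\<lambda>t. (l' * t) *s z)) (at w)"
    using bounded_linear.has_derivative[OF bl \<lambda>[unfolded has_field_derivative_def]] by simp
  from has_derivative_compose[OF this D(1)]
  have "((\<lambda>w. g (l w *s z)) has_derivative (\<lambda>t. D ((l' * t) *s z))) (at w)" .
  moreover have "D ((l' * t) *s z) = D (l' *s z) * t" for t
  proof -
    have "(l' * t) *s z = t *s (l' *s z)" by (simp add: vec_eq_iff mult_ac)
    then show ?thesis using D(2)[of t "l' *s z"] by (simp add: mult.commute)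
  qed
  ultimately have "((\<lambda>w. g (l w *s z)) has_field_derivative D (l' *s z)) (at w)"
    by (simp add: has_field_derivative_def)
  then show ?thesis using D(2,3) that by blast
qed

text \<open>
  The half plane of those \<open>w\<close> for which \<open>e\<^sup>w z\<close> lies in the ball; for \<open>z = 0\<close> it is the whole plane.
\<close>

definition slice_domain :: "complex^'n::finite \<Rightarrow> complex set" where
  "slice_domain z = {w. exp (Re w) * norm z < 1}"

lemma open_slice_domain: "open (slice_domain z)"
  unfolding slice_domain_def by (intro open_Collect_less continuous_intros)

lemma slice_domain_iff: "w \<in> slice_domain z \<longleftrightarrow> exp w *s z \<in> ball 0 1"
  by (simp add: slice_domain_def norm_vector_smult_complex)

lemma mseries_slice_deriv:
  assumes g: "mseries c g" and w: "w \<in> slice_domain z"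
  shows "((\<lambda>w. g (exp w *s z)) has_field_derivative radial_deriv g (exp w *s z)) (at w)"
proof -
  have b: "exp w *s z \<in> ball 0 1" using w by (simp add: slice_domain_iff del: mem_ball)
  obtain D where D: "((\<lambda>w. g (exp w *s z)) has_field_derivative D (exp w *s z)) (at w)"
     "D (exp w *s z) = radial_deriv g (exp w *s z)"
    by (rule mseries_compose_has_derivative[OF g DERIV_exp[of w] b]) (rule that)
  then show ?thesis by simp
qed

lemma mseries_slice_holomorphic:
  "mseries c g \<Longrightarrow> (\<lambda>w. g (exp w *s z)) holomorphic_on slice_domain z"
  using mseries_slice_deriv by (metis holomorphic_on_open open_slice_domain)

lemma mseries_slice_higher_deriv:
  assumes g: "mseries c g" and w: "w \<in> slice_domain z"
  shows "(deriv ^^ j) (\<lambda>w. g (exp w *s z)) w = (radial_deriv ^^ j) g (exp w *s z)"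
  using w
proof (induction j arbitrary: w)
  case (Suc j)
  have "eventually (\<lambda>u. u \<in> slice_domain z) (nhds w)"
    using open_slice_domain Suc.prems by (rule eventually_nhds_in_open)
  then have "eventually (\<lambda>u. (deriv ^^ j) (\<lambda>w. g (exp w *s z)) u = (radial_deriv ^^ j) g (exp u *s z)) (nhds w)"
    by (rule eventually_mono) (rule Suc.IH)
  then have "deriv ((deriv ^^ j) (\<lambda>w. g (exp w *s z))) w = deriv (\<lambda>u. (radial_deriv ^^ j) g (exp u *s z)) w"
    by (rule deriv_cong_ev) simp
  then show ?case
    using DERIV_imp_deriv[OF mseries_slice_deriv[OF mseries_radial_deriv_funpow[OF g] Suc.prems]] by simp
qed simp

text \<open>
  Let \<open>\<rho>0\<close> be the distance of the point with parameter \<open>w0\<close> from the sphere. Moving the parameter by at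
  most \<open>\<rho>0 / 2\<close> changes \<open>ln |e\<^sup>w z|\<close> by at most \<open>\<rho>0 / 2\<close>, which leaves the distance comparable to \<open>\<rho>0\<close>.
\<close>

lemma square_in_slice_domain:
  fixes z :: "complex^'n::finite"
  assumes \<rho>0: "\<rho>0 = 1 - exp (Re w0) * norm z" "\<rho>0 > 0" and w: "w \<in> square w0 (\<rho>0 / 2)"
  shows "\<rho>0 / 2 \<le> 1 - exp (Re w) * norm z" "1 - exp (Re w) * norm z \<le> 3 * \<rho>0 / 2"
proof -
  have \<rho>1: "\<rho>0 \<le> 1" using \<rho>0(1) by (simp add: mult_nonneg_nonneg)
  have d: "\<bar>Re w - Re w0\<bar> \<le> \<rho>0 / 2" using w by (simp add: square_def)
  have eq: "exp (Re w) * norm z = exp (Re w - Re w0) * (1 - \<rho>0)"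
    using \<rho>0 by (simp add: exp_diff)
  have "Re w - Re w0 \<le> \<rho>0 / 2" using d by linarith
  then have "exp (Re w - Re w0) \<le> exp (\<rho>0 / 2)" by simp
  then have 1: "exp (Re w - Re w0) * (1 - \<rho>0) \<le> exp (\<rho>0 / 2) * (1 - \<rho>0)"
    using \<rho>1 by (intro mult_right_mono) auto
  have "exp (\<rho>0 / 2) * (1 - \<rho>0 / 2) \<le> exp (\<rho>0 / 2) * exp (- (\<rho>0 / 2))"
    using exp_ge_add_one_self[of "- (\<rho>0 / 2)"] by (intro mult_left_mono) auto
  then have 2: "exp (\<rho>0 / 2) * (1 - \<rho>0 / 2) \<le> 1" by (simp flip: exp_add)
  have "1 - \<rho>0 \<le> (1 - \<rho>0 / 2) * (1 - \<rho>0 / 2)" by (simp add: algebra_simps)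
  then have 3: "exp (\<rho>0 / 2) * (1 - \<rho>0) \<le> exp (\<rho>0 / 2) * ((1 - \<rho>0 / 2) * (1 - \<rho>0 / 2))"
    by (intro mult_left_mono) auto
  have 4: "exp (\<rho>0 / 2) * ((1 - \<rho>0 / 2) * (1 - \<rho>0 / 2)) \<le> 1 * (1 - \<rho>0 / 2)"
    unfolding mult.assoc[symmetric] using 2 \<rho>1 by (intro mult_right_mono) auto
  show "\<rho>0 / 2 \<le> 1 - exp (Re w) * norm z" unfolding eq
    using order_trans[OF 1 order_trans[OF 3 4]] by simp
  have "1 - \<rho>0 / 2 \<le> exp (Re w - Re w0)" using exp_ge_add_one_self[of "Re w - Re w0"] d by linarith
  then have "(1 - \<rho>0 / 2) * (1 - \<rho>0) \<le> exp (Re w - Re w0) * (1 - \<rho>0)" using \<rho>1 by (intro mult_right_mono) auto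
  moreover have "(1 - \<rho>0 / 2) * (1 - \<rho>0) = 1 - 3 * \<rho>0 / 2 + \<rho>0 * \<rho>0 / 2" by (simp add: field_simps)
  moreover have "\<rho>0 * \<rho>0 / 2 \<ge> 0" by simp
  ultimately show "1 - exp (Re w) * norm z \<le> 3 * \<rho>0 / 2" unfolding eq by linarith
qed

text \<open>
  Cauchy's inequality on the circle of radius \<open>\<rho> / 4\<close> about \<open>w0\<close>, combined with the weak mean value
  property on squares of half side \<open>\<rho> / 4\<close> about the points of that circle; all these squares lie in
  the one of half side \<open>\<rho> / 2\<close> about \<open>w0\<close>.
\<close>

lemma radial_deriv_square_bound:
  fixes p :: real and k :: nat
  assumes p: "p > 0"
  obtains C :: real where "C > 0"
    "\<And>c (g :: complex^'n::finite \<Rightarrow> complex) z w0. mseries c g \<Longrightarrow> w0 \<in> slice_domain z \<Longrightarrow>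
      ennreal (cmod ((radial_deriv ^^ k) g (exp w0 *s z)) powr p * (1 - exp (Re w0) * norm z) powr (p * real k + 2)) \<le>
      ennreal C * plane_integral (\<lambda>w. indicator (square w0 ((1 - exp (Re w0) * norm z) / 2)) w * ennreal (cmod (g (exp w *s z)) powr p))"
proof -
  obtain C1 :: real where C1: "C1 > 0"
    "\<And>h v r. h holomorphic_on square v r \<Longrightarrow> r > 0 \<Longrightarrow>
      ennreal (cmod (h v) powr p * r\<^sup>2) \<le> ennreal C1 * plane_integral (\<lambda>w. indicator (square v r) w * ennreal (cmod (h w) powr p))"
    by (rule weak_mean_value[OF p]) (rule that)
  define C where "C = fact k powr p * 4 powr (p * real k + 2) * C1"
  show ?thesis
  proof (rule that)
    show C: "C > 0" using C1 by (simp add: C_def)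
    fix c and g :: "complex^'n \<Rightarrow> complex" and z :: "complex^'n" and w0
    assume g: "mseries c g" and w0: "w0 \<in> slice_domain z"
    define \<rho> where "\<rho> = 1 - exp (Re w0) * norm z"
    have \<rho>: "\<rho> > 0" using w0 by (simp add: \<rho>_def slice_domain_def)
    define H where "H w = g (exp w *s z)" for w
    define J where "J = plane_integral (\<lambda>w. indicator (square w0 (\<rho> / 2)) w * ennreal (cmod (H w) powr p))"
    have holH: "H holomorphic_on slice_domain z" unfolding H_def by (rule mseries_slice_holomorphic[OF g])
    have sub0: "square w0 (\<rho> / 2) \<subseteq> slice_domain z"
    proof
      fix w assume "w \<in> square w0 (\<rho> / 2)"
      from square_in_slice_domain(1)[OF \<rho>_def \<rho> this] \<rho> show "w \<in> slice_domain z" by (simp add: slice_domain_def)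
    qed
    have "ennreal (cmod ((radial_deriv ^^ k) g (exp w0 *s z)) powr p * \<rho> powr (p * real k + 2)) \<le> ennreal C * J"
    proof (cases "J = top")
      case True
      then show ?thesis using C by (simp add: ennreal_mult_top)
    next
      case False
      then obtain I where I: "J = ennreal I" "I \<ge> 0" by (cases J) auto
      define r where "r = \<rho> / 4"
      have r: "r > 0" using \<rho> by (simp add: r_def)
      define B where "B = (C1 * I / r\<^sup>2) powr (1 / p)"
      have Bb: "cmod (H w) \<le> B" if w: "norm (w0 - w) = r" for w
      proof -
        have dd: "\<bar>Re (w0 - w)\<bar> \<le> r" "\<bar>Im (w0 - w)\<bar> \<le> r" using abs_Re_le_cmod[of "w0 - w"] abs_Im_le_cmod[of "w0 - w"] w by auto
        have sub: "square w r \<subseteq> square w0 (\<rho> / 2)"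
        proof
          fix x assume "x \<in> square w r"
          then have "\<bar>Re (x - w)\<bar> \<le> r" "\<bar>Im (x - w)\<bar> \<le> r" by (auto simp: square_def)
          with dd have "\<bar>Re (x - w0)\<bar> \<le> \<rho> / 2" "\<bar>Im (x - w0)\<bar> \<le> \<rho> / 2"
            unfolding r_def minus_complex.sel by linarith+
          then show "x \<in> square w0 (\<rho> / 2)" by (simp add: square_def)
        qed
        have "ennreal (cmod (H w) powr p * r\<^sup>2) \<le> ennreal C1 * plane_integral (\<lambda>x. indicator (square w r) x * ennreal (cmod (H x) powr p))"
          using holomorphic_on_subset[OF holH] sub sub0 r by (intro C1(2)) auto
        also have "\<dots> \<le> ennreal C1 * J" unfolding J_def
          by (intro mult_left_mono plane_integral_mono mult_right_mono) (use sub in \<open>auto simp: indicator_def\<close>)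
        also have "\<dots> = ennreal (C1 * I)" using I C1 by (simp add: ennreal_mult)
        finally have "cmod (H w) powr p * r\<^sup>2 \<le> C1 * I" using I C1 by (subst (asm) ennreal_le_iff) auto
        then have "cmod (H w) powr p \<le> C1 * I / r\<^sup>2" using r by (simp add: field_simps)
        then have "(cmod (H w) powr p) powr (1 / p) \<le> B" unfolding B_def using p by (intro powr_mono2) auto
        then show ?thesis using p by (simp add: powr_powr)
      qed
      have cb: "cball w0 r \<subseteq> slice_domain z"
      proof
        fix w assume "w \<in> cball w0 r"
        then have "norm (w - w0) \<le> r" by (simp add: dist_norm norm_minus_commute)
        then have "\<bar>Re (w - w0)\<bar> \<le> r" "\<bar>Im (w - w0)\<bar> \<le> r" using abs_Re_le_cmod[of "w - w0"] abs_Im_le_cmod[of "w - w0"] by linarith+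
        then have "w \<in> square w0 (\<rho> / 2)" using r by (simp add: square_def r_def)
        then show "w \<in> slice_domain z" using sub0 by blast
      qed
      have "norm ((deriv ^^ k) H w0) \<le> fact k * B / r ^ k"
        by (rule Cauchy_inequality[OF _ _ r Bb])
           (use holomorphic_on_subset[OF holH] cb ball_subset_cball holomorphic_on_imp_continuous_on in blast)+
      then have "cmod ((radial_deriv ^^ k) g (exp w0 *s z)) \<le> fact k * B / r ^ k"
        unfolding H_def mseries_slice_higher_deriv[OF g w0] .
      then have "cmod ((radial_deriv ^^ k) g (exp w0 *s z)) powr p \<le> (fact k * B / r ^ k) powr p"
        using p by (intro powr_mono2) auto
      also have "\<dots> = fact k powr p * (C1 * I / r\<^sup>2) / r powr (p * real k)"
      proof -
        have "B powr p = C1 * I / r\<^sup>2" unfolding B_def using p C1 I r by (simp add: powr_powr)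
        moreover have "(r ^ k) powr p = r powr (p * real k)" using r by (simp add: powr_realpow[symmetric] powr_powr mult.commute)
        moreover have "B \<ge> 0" by (simp add: B_def)
        ultimately show ?thesis using r by (simp add: powr_divide powr_mult)
      qed
      finally have le: "cmod ((radial_deriv ^^ k) g (exp w0 *s z)) powr p \<le> fact k powr p * (C1 * I / r\<^sup>2) / r powr (p * real k)" .
      have rho: "\<rho> powr (p * real k + 2) = 4 powr (p * real k + 2) * (r powr (p * real k) * r\<^sup>2)"
      proof -
        have "\<rho> = 4 * r" by (simp add: r_def)
        then have "\<rho> powr (p * real k + 2) = 4 powr (p * real k + 2) * r powr (p * real k + 2)" using r by (simp add: powr_mult)
        also have "r powr (p * real k + 2) = r powr (p * real k) * r\<^sup>2" using r by (simp only: powr_add powr_numeral)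
        finally show ?thesis .
      qed
      have "cmod ((radial_deriv ^^ k) g (exp w0 *s z)) powr p * \<rho> powr (p * real k + 2) \<le>
          fact k powr p * (C1 * I / r\<^sup>2) / r powr (p * real k) * \<rho> powr (p * real k + 2)"
        by (rule mult_right_mono[OF le]) simp
      also have "\<dots> = C * I" unfolding rho using r by (simp add: C_def)
      finally show ?thesis unfolding I using C I by (simp add: ennreal_mult[symmetric] ennreal_leI)
    qed
    then show "ennreal (cmod ((radial_deriv ^^ k) g (exp w0 *s z)) powr p * (1 - exp (Re w0) * norm z) powr (p * real k + 2)) \<le>
      ennreal C * plane_integral (\<lambda>w. indicator (square w0 ((1 - exp (Re w0) * norm z) / 2)) w * ennreal (cmod (g (exp w *s z)) powr p))"
      unfolding J_def H_def \<rho>_def .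
  qed
qed

text \<open>
  The points \<open>w0\<close> are those needed later: the segment from \<open>-1\<close> to \<open>0\<close> and the vertical segment above
  \<open>-1\<close>, that is, a piece of the ray through \<open>z\<close> and the circle on which the maximum principle is used.
\<close>

lemma square_in_approach_region:
  fixes z :: "complex^'n::finite"
  assumes z: "norm z < 1" and w0: "-1 \<le> Re w0" "Re w0 \<le> 0" "Im w0 = 0 \<or> Re w0 = -1 \<and> \<bar>Im w0\<bar> \<le> pi"
    and \<rho>0: "\<rho>0 = 1 - exp (Re w0) * norm z" and w: "w \<in> square w0 (\<rho>0 / 2)"
  shows "approach_region (norm z) w"
proof -
  have "exp (Re w0) * norm z \<le> 1 * norm z" using w0 by (intro mult_right_mono) auto
  then have \<rho>: "\<rho>0 \<ge> 1 - norm z" "\<rho>0 > 0" using z \<rho>0 by auto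
  have \<rho>1: "\<rho>0 \<le> 1" using \<rho>0 by simp
  note b = square_in_slice_domain[OF \<rho>0 \<rho>(2) w]
  have d: "\<bar>Re w - Re w0\<bar> \<le> \<rho>0 / 2" "\<bar>Im w - Im w0\<bar> \<le> \<rho>0 / 2" using w by (auto simp: square_def)
  define r where "r = 1 - exp (Re w) * norm z"
  have b': "\<rho>0 / 2 \<le> r" using b(1) by (simp only: r_def)
  have im: "\<bar>Im w\<bar> \<le> 20 * r"
    using w0(3)
  proof
    assume *: "Im w0 = 0"
    then have "\<bar>Im w\<bar> \<le> \<rho>0 / 2" using d(2) by simp
    then show ?thesis using b' \<rho> by linarith
  next
    assume *: "Re w0 = -1 \<and> \<bar>Im w0\<bar> \<le> pi"
    have "exp (-1) * norm z \<le> exp (-1) * 1" using z by (intro mult_left_mono) auto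
    moreover have "exp (-1::real) \<le> 1 / 2" using one_minus_exp_neg_bounds(1)[of 1] by simp
    moreover have "\<rho>0 = 1 - exp (-1) * norm z" using * \<rho>0 by simp
    ultimately have "\<rho>0 \<ge> 1 / 2" by linarith
    moreover have "\<bar>Im w\<bar> \<le> \<rho>0 / 2 + pi" using * d(2) by linarith
    ultimately show ?thesis using b' pi_less_4 by linarith
  qed
  show ?thesis unfolding approach_region_def
  proof (intro conjI im[unfolded r_def])
    show "-2 \<le> Re w" "Re w \<le> 1" using d w0 \<rho>1 by linarith+
    have "r > 0" "1 - norm z \<le> 2 * r" using b' \<rho> by linarith+
    then show "exp (Re w) * norm z < 1" "1 - norm z \<le> 2 * (1 - exp (Re w) * norm z)" unfolding r_def by simp_all
  qed
qed

text \<open>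
  On the square about \<open>w0\<close> the factor \<open>(1 - |e\<^sup>w z|)\<^sup>\<gamma>\<close> is comparable to its value at \<open>w0\<close>. Enlarging the
  square to the approach region makes the right-hand side independent of \<open>w0\<close>, so this is a bound for
  a supremum.
\<close>

lemma radial_deriv_region_bound:
  fixes p \<gamma> :: real and k :: nat
  assumes p: "p > 0"
  obtains C :: real where "C > 0"
    "\<And>c (g :: complex^'n::finite \<Rightarrow> complex) z w0. mseries c g \<Longrightarrow> norm z < 1 \<Longrightarrow> -1 \<le> Re w0 \<Longrightarrow> Re w0 \<le> 0 \<Longrightarrow>
      Im w0 = 0 \<or> Re w0 = -1 \<and> \<bar>Im w0\<bar> \<le> pi \<Longrightarrow>
      ennreal (cmod ((radial_deriv ^^ k) g (exp w0 *s z)) powr p * (1 - exp (Re w0) * norm z) powr (p * real k + 2 + \<gamma>)) \<le>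
      ennreal C * region_integral \<gamma> (\<lambda>y. ennreal (cmod (g y) powr p)) z"
proof -
  obtain C1 :: real where C1: "C1 > 0"
    "\<And>c (g :: complex^'n \<Rightarrow> complex) z w0. mseries c g \<Longrightarrow> w0 \<in> slice_domain z \<Longrightarrow>
      ennreal (cmod ((radial_deriv ^^ k) g (exp w0 *s z)) powr p * (1 - exp (Re w0) * norm z) powr (p * real k + 2)) \<le>
      ennreal C1 * plane_integral (\<lambda>w. indicator (square w0 ((1 - exp (Re w0) * norm z) / 2)) w * ennreal (cmod (g (exp w *s z)) powr p))"
    using radial_deriv_square_bound[OF p, of k] by blast
  define C2 where "C2 = max 1 (4 powr (- \<gamma>)) * 2 powr \<gamma>"
  have C2: "C2 > 0" by (simp add: C2_def)
  show ?thesis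
  proof (rule that)
    show "C1 * C2 > 0" using C1 C2 by simp
    fix c and g :: "complex^'n \<Rightarrow> complex" and z :: "complex^'n" and w0
    assume g: "mseries c g" and z: "norm z < 1" and w0: "-1 \<le> Re w0" "Re w0 \<le> 0"
      and w0': "Im w0 = 0 \<or> Re w0 = -1 \<and> \<bar>Im w0\<bar> \<le> pi"
    define \<rho> where "\<rho> = 1 - exp (Re w0) * norm z"
    have "exp (Re w0) * norm z \<le> 1 * norm z" using w0 by (intro mult_right_mono) auto
    then have \<rho>: "\<rho> > 0" using z by (simp add: \<rho>_def)
    then have dom: "w0 \<in> slice_domain z" by (simp add: \<rho>_def slice_domain_def)
    let ?R = "\<lambda>w. if approach_region (norm z) w then ennreal ((1 - exp (Re w) * norm z) powr \<gamma>) * ennreal (cmod (g (exp w *s z)) powr p) else 0"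
    have ptw: "indicator (square w0 (\<rho> / 2)) w * ennreal (cmod (g (exp w *s z)) powr p) * ennreal (\<rho> powr \<gamma>) \<le> ennreal C2 * ?R w" for w
    proof (cases "w \<in> square w0 (\<rho> / 2)")
      case True
      have reg: "approach_region (norm z) w" by (rule square_in_approach_region[OF z w0 w0' \<rho>_def True])
      define r where "r = 1 - exp (Re w) * norm z"
      have r: "\<rho> / 2 \<le> r" "r \<le> 3 * \<rho> / 2" using square_in_slice_domain[OF \<rho>_def \<rho> True] by (auto simp: r_def)
      have "\<rho> powr \<gamma> \<le> max 1 (4 powr (- \<gamma>)) * (2 * r) powr \<gamma>"
        by (rule powr_comparable) (use r \<rho> in auto)
      also have "\<dots> = C2 * r powr \<gamma>" using r \<rho> by (simp add: C2_def powr_mult)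
      finally have "\<rho> powr \<gamma> \<le> C2 * r powr \<gamma>" .
      then have "ennreal (\<rho> powr \<gamma>) \<le> ennreal C2 * ennreal (r powr \<gamma>)" using C2 by (simp add: ennreal_mult[symmetric] ennreal_leI)
      then have "ennreal (\<rho> powr \<gamma>) * ennreal (cmod (g (exp w *s z)) powr p) \<le> ennreal C2 * ennreal (r powr \<gamma>) * ennreal (cmod (g (exp w *s z)) powr p)"
        by (rule mult_right_mono) simp
      then show ?thesis using True reg by (simp add: r_def mult_ac)
    qed simp
    have hol: "continuous_on (slice_domain z) (\<lambda>w. g (exp w *s z))"
      by (rule holomorphic_on_imp_continuous_on[OF mseries_slice_holomorphic[OF g]])
    have sub: "square w0 (\<rho> / 2) \<subseteq> slice_domain z"
    proof
      fix w assume "w \<in> square w0 (\<rho> / 2)"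
      from square_in_slice_domain(1)[OF \<rho>_def \<rho> this] \<rho> show "w \<in> slice_domain z" by (simp add: slice_domain_def)
    qed
    have sqm: "(\<lambda>w. indicator (square w0 (\<rho> / 2)) w * ennreal (cmod (g (exp w *s z)) powr p)) \<in> borel_measurable borel"
      by (intro measurable_indicator_square continuous_on_powr' continuous_on_norm continuous_on_subset[OF hol sub] continuous_on_const) (use p in auto)
    let ?F = "\<lambda>w. if w \<in> slice_domain z then g (exp w *s z) else 0"
    have "(\<lambda>w. indicator (slice_domain z) w *\<^sub>R g (exp w *s z)) \<in> borel_measurable borel"
      by (intro borel_measurable_continuous_on_indicator hol) (simp add: open_slice_domain)
    also have "(\<lambda>w. indicator (slice_domain z) w *\<^sub>R g (exp w *s z)) = ?F" by (auto simp: indicator_def)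
    finally have [measurable]: "?F \<in> borel_measurable borel" .
    have "?R = (\<lambda>w. if approach_region (norm z) w then ennreal ((1 - exp (Re w) * norm z) powr \<gamma>) * ennreal (cmod (?F w) powr p) else 0)"
      by (auto simp: fun_eq_iff approach_region_def slice_domain_def)
    also have "\<dots> \<in> borel_measurable borel" unfolding approach_region_def by measurable
    finally have Rm: "?R \<in> borel_measurable borel" .
    have "ennreal (cmod ((radial_deriv ^^ k) g (exp w0 *s z)) powr p * \<rho> powr (p * real k + 2 + \<gamma>)) =
       ennreal (\<rho> powr \<gamma>) * ennreal (cmod ((radial_deriv ^^ k) g (exp w0 *s z)) powr p * \<rho> powr (p * real k + 2))"
      by (simp add: powr_add ennreal_mult[symmetric] mult_ac)
    also have "\<dots> \<le> ennreal (\<rho> powr \<gamma>) * (ennreal C1 * plane_integral (\<lambda>w. indicator (square w0 (\<rho> / 2)) w * ennreal (cmod (g (exp w *s z)) powr p)))"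
      unfolding \<rho>_def by (intro mult_left_mono C1(2)[OF g dom]) simp
    also have "\<dots> = ennreal C1 * plane_integral (\<lambda>w. ennreal (\<rho> powr \<gamma>) * (indicator (square w0 (\<rho> / 2)) w * ennreal (cmod (g (exp w *s z)) powr p)))"
      by (simp add: plane_integral_cmult[OF sqm] mult.left_commute)
    also have "\<dots> \<le> ennreal C1 * plane_integral (\<lambda>w. ennreal C2 * ?R w)"
      by (intro mult_left_mono plane_integral_mono) (use ptw in \<open>simp_all add: mult.commute\<close>)
    also have "\<dots> = ennreal (C1 * C2) * plane_integral ?R"
      using C1 C2 by (simp add: plane_integral_cmult[OF Rm] ennreal_mult mult.assoc)
    finally show "ennreal (cmod ((radial_deriv ^^ k) g (exp w0 *s z)) powr p * (1 - exp (Re w0) * norm z) powr (p * real k + 2 + \<gamma>)) \<le>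
      ennreal (C1 * C2) * region_integral \<gamma> (\<lambda>y. ennreal (cmod (g y) powr p)) z"
      unfolding region_integral_def \<rho>_def .
  qed
qed

text \<open>
  Schwarz's lemma for \<open>\<lambda> \<mapsto> g (\<lambda> z)\<close> on the disc of radius \<open>1/e\<close>. It yields integrability of
  \<open>u \<mapsto> g (e\<^sup>-\<^sup>u z)\<close> at infinity from values at points away from the origin, where dilations have bounded
  Jacobian.
\<close>

lemma dilation_Schwarz:
  fixes g :: "complex^'n::finite \<Rightarrow> complex"
  assumes g: "mseries c g" and g0: "g 0 = 0" and z: "norm z < 1"
    and B: "\<And>\<theta>. \<bar>\<theta>\<bar> \<le> pi \<Longrightarrow> cmod (g (exp (Complex (-1) \<theta>) *s z)) \<le> B"
    and u: "u \<ge> 1"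
  shows "cmod (g (of_real (exp (- u)) *s z)) \<le> exp (1 - u) * B"
proof -
  define \<phi> where "\<phi> l = g ((l * of_real (exp (-1))) *s z)" for l :: complex
  have dom: "(l * of_real (exp (-1))) *s z \<in> ball 0 1" if "cmod l \<le> 1" for l :: complex
  proof -
    have "cmod l * (exp (-1) * norm z) \<le> 1 * (1 * norm z)" using that by (intro mult_mono mult_right_mono) auto
    then show ?thesis using z by (simp add: norm_vector_smult_complex norm_mult mult.assoc)
  qed
  have hol: "\<phi> field_differentiable at l" if l: "cmod l \<le> 1" for l
  proof -
    have d: "((\<lambda>l. l * of_real (exp (-1))) has_field_derivative of_real (exp (-1))) (at l)"
      by (auto intro!: derivative_eq_intros)
    obtain D where "((\<lambda>w. g ((w * of_real (exp (-1))) *s z)) has_field_derivative D (of_real (exp (-1)) *s z)) (at l)"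
      by (rule mseries_compose_has_derivative[OF g d dom[OF l]]) (rule that)
    then show ?thesis unfolding \<phi>_def[abs_def] field_differentiable_def by blast
  qed
  have hol1: "\<phi> holomorphic_on ball 0 1" using hol by (auto simp: holomorphic_on_def intro: field_differentiable_at_within)
  have cont: "continuous_on (cball 0 1) \<phi>"
    using hol by (intro holomorphic_on_imp_continuous_on) (auto simp: holomorphic_on_def intro: field_differentiable_at_within)
  have \<phi>0: "\<phi> 0 = 0" using g0 by (simp add: \<phi>_def)
  have circle: "cmod (\<phi> l) \<le> B" if "cmod l = 1" for l
  proof -
    have "l \<noteq> 0" using that by auto
    from Arg_eq[OF this] have "l = exp (\<i> * Arg l)" unfolding that by simp
    then have "l * of_real (exp (-1)) = exp (\<i> * Arg l) * exp (-1)" by (simp add: exp_of_real[symmetric])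
    also have "\<dots> = exp (Complex (-1) (Arg l))" unfolding exp_add[symmetric] by (intro arg_cong[where f = exp]) (simp add: complex_eq_iff)
    finally show ?thesis unfolding \<phi>_def using B[of "Arg l"] Arg_bounded[of l] by auto
  qed
  have disc: "cmod (\<phi> l) \<le> B" if "cmod l \<le> 1" for l
    by (rule maximum_modulus_frontier[where S = "cball 0 1" and f = \<phi>]) (use that hol1 cont circle in auto)
  \<comment> \<open>Schwarz's lemma requires a strict bound, so \<open>B\<close> is approached from above.\<close>
  have "cmod (\<phi> l) \<le> B' * cmod l" if B': "B < B'" and l: "cmod l < 1" for l B'
  proof -
    have "B \<ge> 0" using order_trans[OF norm_ge_zero disc[of 0]] by simp
    then have p: "B' > 0" using B' by simp
    have "norm (\<phi> l / of_real B') \<le> norm l"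
    proof (rule Schwarz_Lemma(1)[where f = "\<lambda>l. \<phi> l / of_real B'"])
      show "(\<lambda>l. \<phi> l / of_real B') holomorphic_on ball 0 1" using p by (intro holomorphic_intros hol1) auto
      show "norm (\<phi> l / of_real B') < 1" if "norm l < 1" for l
        using disc[of l] that B' p by (simp add: norm_divide)
    qed (use \<phi>0 l in auto)
    then show ?thesis using p by (simp add: norm_divide field_simps)
  qed
  then have S: "cmod (\<phi> l) \<le> B * cmod l" if "cmod l < 1" for l
  proof (cases "l = 0")
    case False
    then have "cmod (\<phi> l) / cmod l \<le> B'" if "B < B'" for B'
      using \<open>\<And>l B'. B < B' \<Longrightarrow> cmod l < 1 \<Longrightarrow> cmod (\<phi> l) \<le> B' * cmod l\<close>[OF that \<open>cmod l < 1\<close>] by (simp add: field_simps)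
    then have "cmod (\<phi> l) / cmod l \<le> B" by (rule dense_ge)
    then show ?thesis using False by (simp add: field_simps)
  qed (simp add: \<phi>0)
  have S': "cmod (\<phi> l) \<le> B * cmod l" if "cmod l \<le> 1" for l
    using S[of l] disc[of l] that by (cases "cmod l < 1") auto
  have "of_real (exp (- u)) = of_real (exp (1 - u)) * (of_real (exp (-1)) :: complex)"
    by (simp flip: of_real_mult exp_add)
  then have "g (of_real (exp (- u)) *s z) = \<phi> (of_real (exp (1 - u)))" by (simp add: \<phi>_def)
  then show ?thesis using S'[of "of_real (exp (1 - u))"] u by (simp add: mult.commute)
qed

lemma shifted_power_integral:
  fixes \<delta> \<eta> :: real
  assumes "\<delta> > 0" "\<eta> > 0"
  shows "(\<integral>\<^sup>+u. indicator {0..1} u * ennreal ((\<delta> + u) powr (- 1 - \<eta>)) \<partial>lborel) \<le> ennreal (\<delta> powr (- \<eta>) / \<eta>)"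
proof -
  have "((\<lambda>u. (\<delta> + u) powr (- 1 - \<eta>)) has_integral (- ((\<delta> + 1) powr (- \<eta>) / \<eta>) - - ((\<delta> + 0) powr (- \<eta>) / \<eta>))) {0..1}"
  proof (rule fundamental_theorem_of_calculus)
    fix u :: real assume u: "u \<in> {0..1}"
    have "((\<lambda>u. - ((\<delta> + u) powr (- \<eta>) / \<eta>)) has_real_derivative (\<delta> + u) powr (- 1 - \<eta>)) (at u within {0..1})"
    proof -
      have "((\<lambda>u. (\<delta> + u) powr (- \<eta>)) has_real_derivative (- \<eta> * (\<delta> + u) powr (- \<eta> - of_nat 1) * 1)) (at u)"
        by (rule DERIV_fun_powr) (use u assms in \<open>auto intro!: derivative_eq_intros\<close>)
      then have "((\<lambda>u. (- 1 / \<eta>) * (\<delta> + u) powr (- \<eta>)) has_real_derivative (- 1 / \<eta>) * (- \<eta> * (\<delta> + u) powr (- \<eta> - of_nat 1) * 1)) (at u)"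
        by (rule DERIV_cmult)
      moreover have "(- 1 / \<eta>) * (- \<eta> * (\<delta> + u) powr (- \<eta> - of_nat 1) * 1) = (\<delta> + u) powr (- 1 - \<eta>)"
      proof -
        have e: "- \<eta> - of_nat 1 = - 1 - \<eta>" by simp
        show ?thesis unfolding e using assms by simp
      qed
      ultimately have "((\<lambda>u. (- 1 / \<eta>) * (\<delta> + u) powr (- \<eta>)) has_real_derivative (\<delta> + u) powr (- 1 - \<eta>)) (at u)"
        by (simp only:)
      then show ?thesis by (simp add: has_field_derivative_at_within)
    qed
    then show "((\<lambda>u. - ((\<delta> + u) powr (- \<eta>) / \<eta>)) has_vector_derivative (\<delta> + u) powr (- 1 - \<eta>)) (at u within {0..1})"
      by (simp add: has_real_derivative_iff_has_vector_derivative)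
  qed simp
  from nn_integral_has_integral_lebesgue[OF _ this]
  have "(\<integral>\<^sup>+u. ennreal (indicator {0..1} u * (\<delta> + u) powr (- 1 - \<eta>)) \<partial>lborel) = ennreal (\<delta> powr (- \<eta>) / \<eta> - (\<delta> + 1) powr (- \<eta>) / \<eta>)" by simp
  also have "\<dots> \<le> ennreal (\<delta> powr (- \<eta>) / \<eta>)" using assms by (intro ennreal_leI) simp
  also have "(\<integral>\<^sup>+u. ennreal (indicator {0..1} u * (\<delta> + u) powr (- 1 - \<eta>)) \<partial>lborel) = (\<integral>\<^sup>+u. indicator {0..1} u * ennreal ((\<delta> + u) powr (- 1 - \<eta>)) \<partial>lborel)"
    by (intro nn_integral_cong) (auto simp: indicator_def)
  finally show ?thesis .
qed

text \<open>
  With \<open>\<eta> = \<epsilon> / p\<close>, the bound by the region integral reads \<open>|R\<^sup>k g (y)| \<le> K (1 - |y|)\<^sup>-\<^sup>(\<^sup>\<sigma>\<^sup>+\<^sup>\<eta>\<^sup>)\<close> at the points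
  \<open>y = e\<^sup>-\<^sup>u z\<close> with \<open>0 \<le> u \<le> 1\<close>, where \<open>K\<^sup>p\<close> is a multiple of that integral. Inserting it into the
  fractional integral leaves a multiple of
  \<open>\<integral> (1 - |z| + u)\<^sup>(\<^sup>-\<^sup>1\<^sup>-\<^sup>\<eta>\<^sup>) du\<close> over \<open>[0, 1]\<close>, which is at most \<open>(1 - |z|)\<^sup>-\<^sup>\<eta> / \<eta>\<close>; without the extra \<open>\<eta>\<close> the integral
  would grow logarithmically as \<open>|z|\<close> tends to \<open>1\<close>. The part \<open>u > 1\<close> is controlled by Schwarz's lemma.
\<close>

lemma multiplier_pointwise_bound:
  fixes p s \<epsilon> :: real
  assumes p: "p > 0" and \<epsilon>: "\<epsilon> > 0"
  obtains C :: real where "C > 0"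
    "\<And>c (g :: complex^'n::finite \<Rightarrow> complex) h z. mseries c g \<Longrightarrow> c (\<lambda>_. 0) = 0 \<Longrightarrow>
      mseries (\<lambda>m. of_real (real (mi_order m) powr s) * c m) h \<Longrightarrow> norm z < 1 \<Longrightarrow>
      ennreal (cmod (h z) powr p) \<le>
      ennreal (C * (1 - norm z) powr (- \<epsilon>)) * region_integral (\<epsilon> - 2 - p * s) (\<lambda>y. ennreal (cmod (g y) powr p)) z"
proof -
  \<comment> \<open>With \<open>\<sigma> \<ge> 1\<close> the power \<open>u\<^sup>(\<^sup>\<sigma>\<^sup>-\<^sup>1\<^sup>)\<close> is nondecreasing and can be estimated by the distance from the boundary.\<close>
  obtain k :: nat where k: "s + 1 \<le> real k" using real_arch_simple by blast
  define \<sigma> where "\<sigma> = real k - s"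
  have \<sigma>: "\<sigma> \<ge> 1" using k by (simp add: \<sigma>_def)
  define \<eta> where "\<eta> = \<epsilon> / p"
  have \<eta>: "\<eta> > 0" "\<eta> * p = \<epsilon>" using p \<epsilon> by (simp_all add: \<eta>_def)
  define \<gamma> where "\<gamma> = \<epsilon> - 2 - p * s"
  have expo: "p * real k + 2 + \<gamma> = (\<sigma> + \<eta>) * p" unfolding \<gamma>_def \<sigma>_def \<eta>(2)[symmetric] by (simp add: algebra_simps)
  have \<Gamma>: "Gamma \<sigma> > 0" using \<sigma> by (intro Gamma_real_pos) simp
  obtain C1 :: real where C1: "C1 > 0"
    "\<And>c (g :: complex^'n \<Rightarrow> complex) z w0. mseries c g \<Longrightarrow> norm z < 1 \<Longrightarrow> -1 \<le> Re w0 \<Longrightarrow> Re w0 \<le> 0 \<Longrightarrow>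
      Im w0 = 0 \<or> Re w0 = -1 \<and> \<bar>Im w0\<bar> \<le> pi \<Longrightarrow>
      ennreal (cmod ((radial_deriv ^^ k) g (exp w0 *s z)) powr p * (1 - exp (Re w0) * norm z) powr (p * real k + 2 + \<gamma>)) \<le>
      ennreal C1 * region_integral \<gamma> (\<lambda>y. ennreal (cmod (g y) powr p)) z"
    by (rule radial_deriv_region_bound[OF p, of k \<gamma>]) (rule that)
  define c1 where "c1 = 2 powr (\<sigma> - 1) * 4 powr (1 + \<eta>)"
  define C3 where "C3 = c1 / \<eta> + exp 1 * 2 powr (\<sigma> + \<eta>) * Gamma \<sigma>"
  have c1: "c1 > 0" by (simp add: c1_def)
  have C3: "C3 > 0" unfolding C3_def using c1 \<eta> \<Gamma> by (intro add_pos_pos) auto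
  define C where "C = (C3 / Gamma \<sigma>) powr p * C1"
  have C: "C > 0" unfolding C_def using C3 \<Gamma> C1 by simp
  show ?thesis
  proof (rule that[OF C])
    fix c and g h :: "complex^'n \<Rightarrow> complex" and z :: "complex^'n"
    assume g: "mseries c g" and c0: "c (\<lambda>_. 0) = 0"
      and h: "mseries (\<lambda>m. of_real (real (mi_order m) powr s) * c m) h" and z: "norm z < 1"
    define \<delta> where "\<delta> = 1 - norm z"
    have \<delta>: "\<delta> > 0" "\<delta> \<le> 1" using z by (auto simp: \<delta>_def)
    define RI where "RI = region_integral \<gamma> (\<lambda>y. ennreal (cmod (g y) powr p)) z"
    let ?R = "(radial_deriv ^^ k) g"
    have "ennreal (cmod (h z) powr p) \<le> ennreal (C * \<delta> powr (- \<epsilon>)) * RI"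
    proof (cases "RI = top")
      case True
      then show ?thesis using C \<delta> by (simp add: ennreal_mult_top)
    next
      case False
      then obtain I where I: "RI = ennreal I" "I \<ge> 0" by (cases RI) auto
      define K where "K = (C1 * I) powr (1 / p)"
      have K: "K \<ge> 0" by (simp add: K_def)
      have Kp: "K powr p = C1 * I" unfolding K_def using p C1 I by (simp add: powr_powr)
      have Rb: "cmod (?R (exp w0 *s z)) \<le> K * (1 - exp (Re w0) * norm z) powr (- (\<sigma> + \<eta>))"
        if w0: "-1 \<le> Re w0" "Re w0 \<le> 0" "Im w0 = 0 \<or> Re w0 = -1 \<and> \<bar>Im w0\<bar> \<le> pi" for w0
      proof -
        define \<rho> where "\<rho> = 1 - exp (Re w0) * norm z"
        have "exp (Re w0) * norm z \<le> 1 * norm z" using w0 by (intro mult_right_mono) auto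
        then have \<rho>: "\<rho> > 0" using z by (simp add: \<rho>_def)
        have "ennreal (cmod (?R (exp w0 *s z)) powr p * \<rho> powr (p * real k + 2 + \<gamma>)) \<le> ennreal C1 * RI"
          unfolding \<rho>_def RI_def by (rule C1(2)[OF g z w0])
        also have "\<dots> = ennreal (C1 * I)" using I C1 by (simp add: ennreal_mult)
        finally have "cmod (?R (exp w0 *s z)) powr p * \<rho> powr (p * real k + 2 + \<gamma>) \<le> C1 * I"
          using I C1 by (subst (asm) ennreal_le_iff) auto
        then have "(cmod (?R (exp w0 *s z)) * \<rho> powr (\<sigma> + \<eta>)) powr p \<le> C1 * I"
          unfolding expo using \<rho> by (simp add: powr_mult powr_powr)
        then have "((cmod (?R (exp w0 *s z)) * \<rho> powr (\<sigma> + \<eta>)) powr p) powr (1 / p) \<le> K"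
          unfolding K_def using p by (intro powr_mono2) auto
        then have "cmod (?R (exp w0 *s z)) * \<rho> powr (\<sigma> + \<eta>) \<le> K" using p by (simp add: powr_powr)
        then show ?thesis unfolding \<rho>_def[symmetric] powr_minus_divide using \<rho> by (simp add: pos_le_divide_eq)
      qed
      define B where "B = K * 2 powr (\<sigma> + \<eta>)"
      have B: "B \<ge> 0" using K by (simp add: B_def)
      have gk: "mseries (\<lambda>m. of_nat (mi_order m) ^ k * c m) ?R" by (rule mseries_radial_deriv_funpow[OF g])
      have gk0: "?R 0 = 0" using mseries_at_0[OF gk] c0 by simp
      have circ: "cmod (?R (exp (Complex (-1) \<theta>) *s z)) \<le> B" if "\<bar>\<theta>\<bar> \<le> pi" for \<theta>
      proof -
        have "exp (-1) * norm z \<le> exp (-1) * 1" using z by (intro mult_left_mono) auto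
        moreover have "exp (-1::real) \<le> 1 / 2" using one_minus_exp_neg_bounds(1)[of 1] by simp
        ultimately have half: "1 / 2 \<le> 1 - exp (-1) * norm z" by linarith
        have "cmod (?R (exp (Complex (-1) \<theta>) *s z)) \<le> K * (1 - exp (-1) * norm z) powr (- (\<sigma> + \<eta>))"
          using Rb[of "Complex (-1) \<theta>"] that by simp
        also have "\<dots> \<le> K * (1 / 2) powr (- (\<sigma> + \<eta>))"
          using half K \<sigma> \<eta> by (intro mult_left_mono powr_mono2') auto
        also have "(1 / 2 :: real) powr (- (\<sigma> + \<eta>)) = 2 powr (\<sigma> + \<eta>)"
        proof -
          have "(1 / 2 :: real) = 2 powr (-1)" by (simp add: powr_minus_divide)
          then have "(1 / 2 :: real) powr (- (\<sigma> + \<eta>)) = 2 powr (-1 * (- (\<sigma> + \<eta>)))" by (simp only: powr_powr)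
          then show ?thesis by (simp add: add.commute)
        qed
        finally show ?thesis by (simp add: B_def)
      qed
      let ?f1 = "\<lambda>u. indicator {0..1} u * ennreal ((\<delta> + u) powr (- 1 - \<eta>))"
      let ?f2 = "\<lambda>u. ennreal (indicator {0..} u * u powr (\<sigma> - 1) / exp u)"
      have ptw: "indicator {0..} u * ennreal (u powr (\<sigma> - 1) * cmod (?R (of_real (exp (- u)) *s z))) \<le>
          ennreal (K * c1) * ?f1 u + ennreal (exp 1 * B) * ?f2 u" for u
      proof (cases "0 \<le> u")
        case u0: True
        show ?thesis
        proof (cases "u \<le> 1")
          case True
          define \<rho> where "\<rho> = 1 - exp (- u) * norm z"
          have half: "u / 2 \<le> 1 - exp (- u)" using one_minus_exp_neg_bounds(1)[of u] True u0 by (cases "u = 0") auto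
          have "exp (- u) * norm z \<le> exp (- u) * 1" "exp (- u) * norm z \<le> 1 * norm z"
            using z u0 by (intro mult_left_mono mult_right_mono; simp)+
          then have r1: "u / 2 \<le> \<rho>" "\<delta> \<le> \<rho>" using half unfolding \<rho>_def \<delta>_def by linarith+
          have r0: "\<rho> > 0" using r1 \<delta> by linarith
          have "cmod (?R (of_real (exp (- u)) *s z)) \<le> K * \<rho> powr (- (\<sigma> + \<eta>))"
            using Rb[of "of_real (- u)", unfolded exp_of_real] True u0 by (simp only: \<rho>_def Re_complex_of_real Im_complex_of_real) simp
          then have "u powr (\<sigma> - 1) * cmod (?R (of_real (exp (- u)) *s z)) \<le> (2 * \<rho>) powr (\<sigma> - 1) * (K * \<rho> powr (- (\<sigma> + \<eta>)))"
            using r1 u0 \<sigma> by (intro mult_mono powr_mono2) auto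
          also have "\<dots> = K * 2 powr (\<sigma> - 1) * (\<rho> powr (\<sigma> - 1) * \<rho> powr (- (\<sigma> + \<eta>)))"
            using r0 by (simp add: powr_mult)
          also have "\<rho> powr (\<sigma> - 1) * \<rho> powr (- (\<sigma> + \<eta>)) = \<rho> powr (- 1 - \<eta>)"
            by (simp flip: powr_add)
          also have "K * 2 powr (\<sigma> - 1) * \<rho> powr (- 1 - \<eta>) \<le> K * 2 powr (\<sigma> - 1) * (4 powr (1 + \<eta>) * (\<delta> + u) powr (- 1 - \<eta>))"
          proof (rule mult_left_mono)
            have "\<rho> powr (- 1 - \<eta>) \<le> ((\<delta> + u) / 4) powr (- 1 - \<eta>)"
              using r1 \<delta> u0 \<eta> by (intro powr_mono2') auto
            also have "((\<delta> + u) / 4) powr (- 1 - \<eta>) = 4 powr (1 + \<eta>) * (\<delta> + u) powr (- 1 - \<eta>)"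
            proof -
              have "(4::real) powr (- 1 - \<eta>) = 1 / 4 powr (1 + \<eta>)" by (simp add: powr_minus_divide[symmetric] algebra_simps)
              then show ?thesis using \<delta> u0 by (simp add: powr_divide)
            qed
            finally show "\<rho> powr (- 1 - \<eta>) \<le> 4 powr (1 + \<eta>) * (\<delta> + u) powr (- 1 - \<eta>)" .
          qed (use K in simp)
          finally have "u powr (\<sigma> - 1) * cmod (?R (of_real (exp (- u)) *s z)) \<le> K * c1 * (\<delta> + u) powr (- 1 - \<eta>)"
            by (simp only: c1_def mult.assoc)
          then have "ennreal (u powr (\<sigma> - 1) * cmod (?R (of_real (exp (- u)) *s z))) \<le> ennreal (K * c1) * ?f1 u"
            using True u0 K c1 by (simp add: ennreal_mult[symmetric] ennreal_leI)
          then show ?thesis using u0 by (simp add: add_increasing2)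
        next
          case False
          then have "cmod (?R (of_real (exp (- u)) *s z)) \<le> exp (1 - u) * B"
            by (intro dilation_Schwarz[OF gk gk0 z circ]) auto
          then have "u powr (\<sigma> - 1) * cmod (?R (of_real (exp (- u)) *s z)) \<le> u powr (\<sigma> - 1) * (exp (1 - u) * B)"
            by (rule mult_left_mono) simp
          also have "\<dots> = exp 1 * B * (u powr (\<sigma> - 1) / exp u)" by (simp add: exp_diff)
          finally have "ennreal (u powr (\<sigma> - 1) * cmod (?R (of_real (exp (- u)) *s z))) \<le> ennreal (exp 1 * B) * ?f2 u"
            using u0 B by (simp add: ennreal_mult[symmetric] ennreal_leI)
          then show ?thesis using u0 by (simp add: add_increasing)
        qed
      qed simp
      have "ennreal (Gamma \<sigma> * cmod (h z)) \<le>
         (\<integral>\<^sup>+u. indicator {0..} u * ennreal (u powr (\<sigma> - 1) * cmod (?R (of_real (exp (- u)) *s z))) \<partial>lborel)"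
        by (rule fractional_integral_bound[OF g c0 h \<sigma>_def]) (use \<sigma> z in auto)
      also have "\<dots> \<le> (\<integral>\<^sup>+u. ennreal (K * c1) * ?f1 u + ennreal (exp 1 * B) * ?f2 u \<partial>lborel)"
        by (intro nn_integral_mono ptw)
      also have "\<dots> = ennreal (K * c1) * (\<integral>\<^sup>+u. ?f1 u \<partial>lborel) + ennreal (exp 1 * B) * (\<integral>\<^sup>+u. ?f2 u \<partial>lborel)"
        by (simp add: nn_integral_add nn_integral_cmult)
      also have "\<dots> \<le> ennreal (K * c1) * ennreal (\<delta> powr (- \<eta>) / \<eta>) + ennreal (exp 1 * B) * ennreal (Gamma \<sigma>)"
        using Gamma_conv_nn_integral_real[of \<sigma>] \<sigma>
        by (intro add_mono mult_left_mono shifted_power_integral \<delta> \<eta>) auto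
      also have "\<dots> = ennreal (K * c1 * (\<delta> powr (- \<eta>) / \<eta>) + exp 1 * B * Gamma \<sigma>)"
        using K c1 \<eta> B \<Gamma> by (simp add: ennreal_mult[symmetric] ennreal_plus[symmetric] del: ennreal_plus)
      finally have "Gamma \<sigma> * cmod (h z) \<le> K * c1 * (\<delta> powr (- \<eta>) / \<eta>) + exp 1 * B * Gamma \<sigma>"
        using K c1 \<eta> B \<Gamma> by (subst (asm) ennreal_le_iff) auto
      also have "\<dots> \<le> K * c1 * (\<delta> powr (- \<eta>) / \<eta>) + exp 1 * B * Gamma \<sigma> * \<delta> powr (- \<eta>)"
      proof -
        have "1 powr (- \<eta>) \<le> \<delta> powr (- \<eta>)" using \<delta> \<eta> by (intro powr_mono2') auto
        then have "exp 1 * B * Gamma \<sigma> * 1 \<le> exp 1 * B * Gamma \<sigma> * \<delta> powr (- \<eta>)"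
          using B \<Gamma> by (intro mult_left_mono) auto
        then show ?thesis by simp
      qed
      also have "\<dots> = K * C3 * \<delta> powr (- \<eta>)" by (simp add: C3_def B_def algebra_simps)
      finally have "cmod (h z) \<le> C3 / Gamma \<sigma> * (K * \<delta> powr (- \<eta>))" using \<Gamma> by (simp add: field_simps)
      then have "cmod (h z) powr p \<le> (C3 / Gamma \<sigma> * (K * \<delta> powr (- \<eta>))) powr p"
        using p by (intro powr_mono2) auto
      also have "\<dots> = (C3 / Gamma \<sigma>) powr p * (K powr p * \<delta> powr (- \<eta> * p))"
        using C3 \<Gamma> K \<delta> by (simp add: powr_mult powr_powr powr_divide)
      also have "\<dots> = C * \<delta> powr (- \<epsilon>) * I" unfolding Kp using \<eta>(2) by (simp add: C_def)
      finally show ?thesis unfolding I(1) using C I(2) by (simp add: ennreal_mult'[symmetric] ennreal_leI)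
    qed
    then show "ennreal (cmod (h z) powr p) \<le>
      ennreal (C * (1 - norm z) powr (- \<epsilon>)) * region_integral (\<epsilon> - 2 - p * s) (\<lambda>y. ennreal (cmod (g y) powr p)) z"
      unfolding RI_def \<gamma>_def \<delta>_def .
  qed
qed

section \<open>The weighted norm inequality for multipliers\<close>

lemma region_integral_cong:
  assumes "\<And>y. norm y < 1 \<Longrightarrow> G y = G' y"
  shows "region_integral \<gamma> G z = region_integral \<gamma> G' z"
  unfolding region_integral_def approach_region_def
  by (intro arg_cong[where f = plane_integral] ext if_cong refl arg_cong2[where f = "(*)"] assms)
     (auto simp: norm_vector_smult_complex)

lemma region_integral_cmult:
  fixes G :: "complex^'n::finite \<Rightarrow> ennreal"
  assumes G: "G \<in> borel_measurable borel"
  shows "region_integral \<gamma> (\<lambda>y. c * G y) z = c * region_integral \<gamma> G z"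
proof -
  have "(\<lambda>w. exp w *s z) \<in> borel_measurable borel"
    by (intro borel_measurable_continuous_onI continuous_on_smult_vec continuous_intros)
  from measurable_compose[OF this G] have [measurable]: "(\<lambda>w. G (exp w *s z)) \<in> borel_measurable borel" .
  let ?F = "\<lambda>w. if approach_region (norm z) w then ennreal ((1 - exp (Re w) * norm z) powr \<gamma>) * G (exp w *s z) else 0"
  have F: "?F \<in> borel_measurable borel" unfolding approach_region_def by measurable
  have "(\<lambda>w. if approach_region (norm z) w then ennreal ((1 - exp (Re w) * norm z) powr \<gamma>) * (c * G (exp w *s z)) else 0) = (\<lambda>w. c * ?F w)"
    by (simp add: fun_eq_iff mult.left_commute)
  then show ?thesis unfolding region_integral_def by (simp only: plane_integral_cmult[OF F])
qed

lemma mseries_continuous_on: "mseries c f \<Longrightarrow> continuous_on (ball 0 1) f"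
  by (intro continuous_at_imp_continuous_on ballI has_derivative_continuous[OF mseries_has_derivative])

lemma one_minus_square_bounds:
  fixes x :: real assumes "0 \<le> x" "x < 1"
  shows "1 - x \<le> 1 - x\<^sup>2" "1 - x\<^sup>2 \<le> 2 * (1 - x)" "1 - x\<^sup>2 > 0" "1 - x\<^sup>2 \<le> 1"
proof -
  have "x\<^sup>2 \<le> 1 * x" unfolding power2_eq_square using assms by (intro mult_right_mono) auto
  then show "1 - x \<le> 1 - x\<^sup>2" "1 - x\<^sup>2 > 0" using assms by auto
  have "0 \<le> (1 - x)\<^sup>2" by simp
  then show "1 - x\<^sup>2 \<le> 2 * (1 - x)" by (simp add: power2_eq_square algebra_simps)
qed simp

text \<open>
  The weight is not normalized, and the value may be infinite; both are convenient because only finiteness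
  and inequalities up to constants matter.
\<close>

definition weighted_integral :: "real \<Rightarrow> real \<Rightarrow> (complex^'n::finite \<Rightarrow> complex) \<Rightarrow> ennreal" where
  "weighted_integral p b f =
     (\<integral>\<^sup>+z. indicator (ball 0 1) z * ennreal ((1 - (norm z)\<^sup>2) powr b * cmod (f z) powr p) \<partial>lborel)"

lemma weighted_integral_integrand_measurable:
  fixes f :: "complex^'n::finite \<Rightarrow> complex"
  assumes f: "continuous_on (ball 0 1) f" and p: "p > 0"
  shows "(\<lambda>z. indicator (ball 0 1) z * ennreal ((1 - (norm z)\<^sup>2) powr b * cmod (f z) powr p)) \<in> borel_measurable borel"
proof -
  have "\<forall>z\<in>ball (0::complex^'n) 1. 1 - (norm z)\<^sup>2 \<noteq> 0"
    using one_minus_square_bounds(3)[OF norm_ge_zero] by fastforce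
  then have "continuous_on (ball (0::complex^'n) 1) (\<lambda>z. (1 - (norm z)\<^sup>2) powr b)"
    by (intro continuous_on_powr continuous_on_diff continuous_on_const continuous_on_power continuous_on_norm continuous_on_id)
  moreover have "continuous_on (ball 0 1) (\<lambda>z. cmod (f z) powr p)"
    by (rule continuous_on_powr'[OF continuous_on_norm[OF f] continuous_on_const]) (use p in auto)
  ultimately have "continuous_on (ball 0 1) (\<lambda>z. (1 - (norm z)\<^sup>2) powr b * cmod (f z) powr p)"
    by (rule continuous_on_mult)
  then have "(\<lambda>z. indicator (ball 0 1) z *\<^sub>R ((1 - (norm z)\<^sup>2) powr b * cmod (f z) powr p)) \<in> borel_measurable borel"
    by (intro borel_measurable_continuous_on_indicator) auto
  then have "(\<lambda>z. ennreal (indicator (ball 0 1) z *\<^sub>R ((1 - (norm z)\<^sup>2) powr b * cmod (f z) powr p))) \<in> borel_measurable borel"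
    by simp
  also have "(\<lambda>z. ennreal (indicator (ball 0 1) z *\<^sub>R ((1 - (norm z)\<^sup>2) powr b * cmod (f z) powr p))) =
     (\<lambda>z. indicator (ball 0 1) z * ennreal ((1 - (norm z)\<^sup>2) powr b * cmod (f z) powr p))"
    by (auto simp: indicator_def)
  finally show ?thesis .
qed

text \<open>
  Integrate the pointwise bound. The loss \<open>\<epsilon> = (b + 1) / 2\<close> is half of what is available, so
  \<open>\<kappa> = b - \<epsilon>\<close> is still larger than \<open>-1\<close>, and it is compensated by the exponent \<open>\<gamma>\<close> of the region integral.
\<close>

lemma weighted_integral_multiplier_vanishing:
  fixes p b s :: real
  assumes p: "p > 0" and b: "b > -1"
  obtains C :: real where "C > 0"
    "\<And>c (g :: complex^'n::finite \<Rightarrow> complex) h. mseries c g \<Longrightarrow> c (\<lambda>_. 0) = 0 \<Longrightarrow>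
      mseries (\<lambda>m. of_real (real (mi_order m) powr s) * c m) h \<Longrightarrow>
      weighted_integral p b h \<le> ennreal C * weighted_integral p (b - p * s) g"
proof -
  define \<epsilon> where "\<epsilon> = (b + 1) / 2"
  define \<kappa> where "\<kappa> = b - \<epsilon>"
  define \<gamma> where "\<gamma> = \<epsilon> - 2 - p * s"
  have e: "\<epsilon> > 0" "\<kappa> > -1" using b by (simp_all add: \<epsilon>_def \<kappa>_def field_simps)
  have ex: "\<gamma> + \<kappa> + 2 = b - p * s" by (simp add: \<gamma>_def \<kappa>_def)
  obtain C1 :: real where C1: "C1 > 0"
    "\<And>c (g :: complex^'n \<Rightarrow> complex) h z. mseries c g \<Longrightarrow> c (\<lambda>_. 0) = 0 \<Longrightarrow>
      mseries (\<lambda>m. of_real (real (mi_order m) powr s) * c m) h \<Longrightarrow> norm z < 1 \<Longrightarrow>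
      ennreal (cmod (h z) powr p) \<le>
      ennreal (C1 * (1 - norm z) powr (- \<epsilon>)) * region_integral \<gamma> (\<lambda>y. ennreal (cmod (g y) powr p)) z"
    by (rule multiplier_pointwise_bound[OF p e(1), of s, folded \<gamma>_def]) (rule that)
  obtain C2 :: real where C2: "C2 > 0"
    "\<And>G :: complex^'n \<Rightarrow> ennreal. G \<in> borel_measurable borel \<Longrightarrow>
      (\<integral>\<^sup>+z. indicator (ball 0 1) z * (ennreal ((1 - norm z) powr \<kappa>) * region_integral \<gamma> G z) \<partial>lborel)
      \<le> ennreal C2 * (\<integral>\<^sup>+z. indicator (ball 0 1) z * (ennreal ((1 - norm z) powr (\<gamma> + \<kappa> + 2)) * G z) \<partial>lborel)"
    by (rule integral_region_integral_le[OF e(2), of \<gamma>]) (rule that)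
  define K1 where "K1 = max 1 (2 powr (- b)) * 2 powr b"
  define K2 where "K2 = max 1 (2 powr (- (b - p * s)))"
  have K: "K1 > 0" "K2 > 0" by (auto simp: K1_def K2_def intro: less_le_trans[OF zero_less_one max.cobounded1])
  show ?thesis
  proof (rule that)
    show "C2 * (K2 * (K1 * C1)) > 0" using C1 C2 K by simp
    fix c and g h :: "complex^'n \<Rightarrow> complex"
    assume g: "mseries c g" and c0: "c (\<lambda>_. 0) = 0" and h: "mseries (\<lambda>m. of_real (real (mi_order m) powr s) * c m) h"
    define G where "G y = indicator (ball 0 1) y * ennreal (cmod (g y) powr p)" for y
    have G: "G \<in> borel_measurable borel"
      using weighted_integral_integrand_measurable[OF mseries_continuous_on[OF g] p, of 0]
    proof (rule measurable_cong[THEN iffD1, rotated])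
      fix z :: "complex^'n"
      show "indicator (ball 0 1) z * ennreal ((1 - (norm z)\<^sup>2) powr 0 * cmod (g z) powr p) = G z"
        using one_minus_square_bounds(3)[of "norm z"] by (auto simp: G_def indicator_def)
    qed
    have Gb: "ennreal (cmod (g y) powr p) = G y" if "norm y < 1" for y using that by (simp add: G_def)
    have "weighted_integral p b h \<le> (\<integral>\<^sup>+z. indicator (ball 0 1) z * (ennreal ((1 - norm z) powr \<kappa>) *
        region_integral \<gamma> (\<lambda>y. ennreal (K1 * C1) * G y) z) \<partial>lborel)"
      unfolding weighted_integral_def
    proof (rule nn_integral_mono)
      fix z :: "complex^'n"
      show "indicator (ball 0 1) z * ennreal ((1 - (norm z)\<^sup>2) powr b * cmod (h z) powr p) \<le>
        indicator (ball 0 1) z * (ennreal ((1 - norm z) powr \<kappa>) * region_integral \<gamma> (\<lambda>y. ennreal (K1 * C1) * G y) z)"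
      proof (cases "norm z < 1")
        case True
        note ob = one_minus_square_bounds[OF norm_ge_zero True]
        have "(1 - (norm z)\<^sup>2) powr b \<le> max 1 (2 powr (- b)) * (2 * (1 - norm z)) powr b"
          by (rule powr_comparable) (use ob True in auto)
        also have "\<dots> = K1 * (1 - norm z) powr b" by (subst powr_mult) (use True in \<open>auto simp: K1_def\<close>)
        finally have w: "(1 - (norm z)\<^sup>2) powr b \<le> K1 * (1 - norm z) powr b" .
        have "ennreal ((1 - (norm z)\<^sup>2) powr b * cmod (h z) powr p) \<le> ennreal (K1 * (1 - norm z) powr b) * ennreal (cmod (h z) powr p)"
          using w K by (simp add: ennreal_mult[symmetric] ennreal_leI mult_right_mono)
        also have "\<dots> \<le> ennreal (K1 * (1 - norm z) powr b) * (ennreal (C1 * (1 - norm z) powr (- \<epsilon>)) * region_integral \<gamma> (\<lambda>y. ennreal (cmod (g y) powr p)) z)"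
          by (intro mult_left_mono C1(2)[OF g c0 h True]) simp
        also have "region_integral \<gamma> (\<lambda>y. ennreal (cmod (g y) powr p)) z = region_integral \<gamma> G z"
          by (rule region_integral_cong[OF Gb])
        also have "ennreal (K1 * (1 - norm z) powr b) * (ennreal (C1 * (1 - norm z) powr (- \<epsilon>)) * region_integral \<gamma> G z) =
          ennreal ((1 - norm z) powr \<kappa>) * (ennreal (K1 * C1) * region_integral \<gamma> G z)"
        proof -
          have "K1 * (1 - norm z) powr b * (C1 * (1 - norm z) powr (- \<epsilon>)) = (1 - norm z) powr \<kappa> * (K1 * C1)"
            by (simp add: \<kappa>_def powr_diff powr_minus field_simps)
          then have *: "ennreal (K1 * (1 - norm z) powr b) * ennreal (C1 * (1 - norm z) powr (- \<epsilon>)) = ennreal ((1 - norm z) powr \<kappa>) * ennreal (K1 * C1)"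
            using K(1) C1(1) by (simp add: ennreal_mult[symmetric])
          show ?thesis unfolding mult.assoc[symmetric, of "ennreal _" "ennreal _" "region_integral \<gamma> G z"] * ..
        qed
        finally show ?thesis using True by (simp add: region_integral_cmult[OF G])
      qed simp
    qed
    also have "\<dots> \<le> ennreal C2 * (\<integral>\<^sup>+z. indicator (ball 0 1) z * (ennreal ((1 - norm z) powr (\<gamma> + \<kappa> + 2)) * (ennreal (K1 * C1) * G z)) \<partial>lborel)"
      by (rule C2(2)) (use G in measurable)
    also have "\<dots> \<le> ennreal C2 * (\<integral>\<^sup>+z. ennreal (K2 * (K1 * C1)) * (indicator (ball 0 1) z * ennreal ((1 - (norm z)\<^sup>2) powr (b - p * s) * cmod (g z) powr p)) \<partial>lborel)"
    proof (intro mult_left_mono nn_integral_mono)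
      fix z :: "complex^'n"
      show "indicator (ball 0 1) z * (ennreal ((1 - norm z) powr (\<gamma> + \<kappa> + 2)) * (ennreal (K1 * C1) * G z)) \<le>
        ennreal (K2 * (K1 * C1)) * (indicator (ball 0 1) z * ennreal ((1 - (norm z)\<^sup>2) powr (b - p * s) * cmod (g z) powr p))"
      proof (cases "norm z < 1")
        case True
        note ob = one_minus_square_bounds[OF norm_ge_zero True]
        have w: "(1 - norm z) powr (b - p * s) \<le> K2 * (1 - (norm z)\<^sup>2) powr (b - p * s)"
          unfolding K2_def by (rule powr_comparable) (use ob in auto)
        have "(1 - norm z) powr (b - p * s) * (K1 * C1 * cmod (g z) powr p) \<le> K2 * (1 - (norm z)\<^sup>2) powr (b - p * s) * (K1 * C1 * cmod (g z) powr p)"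
          using K C1 by (intro mult_right_mono w) auto
        then show ?thesis using True K C1 unfolding ex G_def
          by (simp add: ennreal_mult'[symmetric] ennreal_leI mult_ac)
      qed simp
    qed simp
    also have "\<dots> = ennreal (C2 * (K2 * (K1 * C1))) * weighted_integral p (b - p * s) g"
      unfolding weighted_integral_def using C1 C2 K
        weighted_integral_integrand_measurable[OF mseries_continuous_on[OF g] p, of "b - p * s"]
      by (subst nn_integral_cmult) (simp_all add: ennreal_mult mult.assoc)
    finally show "weighted_integral p b h \<le> ennreal (C2 * (K2 * (K1 * C1))) * weighted_integral p (b - p * s) g" .
  qed
qed

text \<open>
  The integration over dilations applied to constants: the region integral of \<open>1\<close> is bounded below,
  since the region contains a fixed square, while on the other side the exponent \<open>b + 2\<close> is positive.
\<close>

lemma weighted_integral_one_finite: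
  assumes b: "b > -1" shows "weighted_integral p b (\<lambda>_ :: complex^'n::finite. 1) < top"
proof -
  obtain C2 :: real where C2: "C2 > 0"
    "\<And>G :: complex^'n \<Rightarrow> ennreal. G \<in> borel_measurable borel \<Longrightarrow>
      (\<integral>\<^sup>+z. indicator (ball 0 1) z * (ennreal ((1 - norm z) powr b) * region_integral 0 G z) \<partial>lborel)
      \<le> ennreal C2 * (\<integral>\<^sup>+z. indicator (ball 0 1) z * (ennreal ((1 - norm z) powr (0 + b + 2)) * G z) \<partial>lborel)"
    by (rule integral_region_integral_le[OF b, of 0]) (rule that)
  define K1 where "K1 = max 1 (2 powr (- b)) * 2 powr b"
  have K1: "K1 > 0" by (auto simp: K1_def intro: less_le_trans[OF zero_less_one max.cobounded1])
  have reg: "region_integral 0 (\<lambda>_. ennreal K1) z \<ge> ennreal K1" if z: "norm z < 1" for z :: "complex^'n"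
  proof -
    have "ennreal K1 = (\<integral>\<^sup>+x. \<integral>\<^sup>+y. ennreal K1 * (indicator {-2..-1::real} x * indicator {0..1::real} y) \<partial>lborel \<partial>lborel)"
      by (simp add: nn_integral_cmult)
    also have "\<dots> \<le> region_integral 0 (\<lambda>_. ennreal K1) z"
      unfolding region_integral_def plane_integral_def
    proof (intro nn_integral_mono)
      fix x y :: real
      show "ennreal K1 * (indicator {-2..-1::real} x * indicator {0..1::real} y) \<le> (if approach_region (norm z) (Complex x y)
        then ennreal ((1 - exp (Re (Complex x y)) * norm z) powr 0) * ennreal K1 else 0)"
      proof (cases "x \<in> {-2..-1} \<and> y \<in> {0..1}")
        case True
        have "exp x \<le> exp (-1)" using True by simp
        also have "exp (-1::real) \<le> 1 / 2" using one_minus_exp_neg_bounds(1)[of 1] by simp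
        finally have "exp x * norm z \<le> 1 / 2 * 1" using z by (intro mult_mono) auto
        then have r: "1 / 2 \<le> 1 - exp x * norm z" by simp
        have "approach_region (norm z) (Complex x y)"
          unfolding approach_region_def complex.sel
        proof (intro conjI)
          have "1 \<le> 2 * (1 - exp x * norm z)" using r by simp
          moreover have "1 - norm z \<le> 1" by simp
          ultimately show "1 - norm z \<le> 2 * (1 - exp x * norm z)" by (rule order_trans[rotated])
          have "1 \<le> 20 * (1 - exp x * norm z)" using r by simp
          moreover have "\<bar>y\<bar> \<le> 1" using True by auto
          ultimately show "\<bar>y\<bar> \<le> 20 * (1 - exp x * norm z)" by (rule order_trans[rotated])
          show "-2 \<le> x" "x \<le> 1" using True by auto
          show "exp x * norm z < 1" using r by simp
        qed
        then show ?thesis using r True by (auto simp: indicator_def)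
      qed auto
    qed
    finally show ?thesis .
  qed
  have "weighted_integral p b (\<lambda>_ :: complex^'n. 1) \<le>
     (\<integral>\<^sup>+z. indicator (ball (0::complex^'n) 1) z * (ennreal ((1 - norm z) powr b) * region_integral 0 (\<lambda>_. ennreal K1) z) \<partial>lborel)"
    unfolding weighted_integral_def
  proof (rule nn_integral_mono)
    fix z :: "complex^'n"
    show "indicator (ball 0 1) z * ennreal ((1 - (norm z)\<^sup>2) powr b * cmod 1 powr p) \<le>
      indicator (ball 0 1) z * (ennreal ((1 - norm z) powr b) * region_integral 0 (\<lambda>_. ennreal K1) z)"
    proof (cases "norm z < 1")
      case True
      note ob = one_minus_square_bounds[OF norm_ge_zero True]
      have "(1 - (norm z)\<^sup>2) powr b \<le> max 1 (2 powr (- b)) * (2 * (1 - norm z)) powr b"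
        by (rule powr_comparable) (use ob True in auto)
      also have "\<dots> = (1 - norm z) powr b * K1" by (subst powr_mult) (use True in \<open>auto simp: K1_def\<close>)
      finally have "ennreal ((1 - (norm z)\<^sup>2) powr b) \<le> ennreal ((1 - norm z) powr b) * ennreal K1"
        using K1 by (simp add: ennreal_mult[symmetric] ennreal_leI)
      also have "\<dots> \<le> ennreal ((1 - norm z) powr b) * region_integral 0 (\<lambda>_. ennreal K1) z"
        by (intro mult_left_mono reg[OF True]) simp
      finally show ?thesis using True by simp
    qed simp
  qed
  also have "\<dots> \<le> ennreal C2 * (\<integral>\<^sup>+z. indicator (ball (0::complex^'n) 1) z * (ennreal ((1 - norm z) powr (0 + b + 2)) * ennreal K1) \<partial>lborel)"
    by (rule C2(2)) simp
  also have "\<dots> \<le> ennreal C2 * (\<integral>\<^sup>+z. ennreal K1 * indicator (ball (0::complex^'n) 1) z \<partial>lborel)"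
  proof (intro mult_left_mono nn_integral_mono)
    fix z :: "complex^'n"
    show "indicator (ball 0 1) z * (ennreal ((1 - norm z) powr (0 + b + 2)) * ennreal K1) \<le> ennreal K1 * indicator (ball 0 1) z"
    proof (cases "norm z < 1")
      case True
      have "(1 - norm z) powr (0 + b + 2) \<le> 1" using True b by (intro powr_le1) auto
      then have "(1 - norm z) powr (0 + b + 2) * K1 \<le> 1 * K1" using K1 by (intro mult_right_mono) auto
      then show ?thesis using True K1 by (simp add: ennreal_mult[symmetric] ennreal_leI)
    qed simp
  qed simp
  also have "\<dots> = ennreal C2 * (ennreal K1 * emeasure lborel (ball (0::complex^'n) 1))"
    by (simp add: nn_integral_cmult_indicator)
  also have "\<dots> < top" using emeasure_lborel_ball_finite[of "0::complex^'n" 1] by (simp add: ennreal_mult_less_top)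
  finally show ?thesis .
qed

lemma powr_add_le:
  fixes x y p :: real
  assumes "0 \<le> x" "0 \<le> y" "0 < p"
  shows "(x + y) powr p \<le> 2 powr p * (x powr p + y powr p)"
proof -
  have "(x + y) powr p \<le> (2 * max x y) powr p" using assms by (intro powr_mono2) auto
  also have "\<dots> = 2 powr p * max x y powr p" using assms by (intro powr_mult)
  also have "\<dots> \<le> 2 powr p * (x powr p + y powr p)" by (intro mult_left_mono) (auto simp: max_def)
  finally show ?thesis .
qed

lemma weighted_integral_add_const:
  fixes f :: "complex^'n::finite \<Rightarrow> complex"
  assumes f: "continuous_on (ball 0 1) f" and p: "p > 0"
  shows "weighted_integral p b (\<lambda>z. f z + k) \<le>
    ennreal (2 powr p) * (weighted_integral p b f + ennreal (cmod k powr p) * weighted_integral p b (\<lambda>_ :: complex^'n. 1))"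
proof -
  let ?w = "\<lambda>g (z :: complex^'n). indicator (ball 0 1) z * ennreal ((1 - (norm z)\<^sup>2) powr b * cmod (g z) powr p)"
  have m: "?w f \<in> borel_measurable borel" "?w (\<lambda>_. 1) \<in> borel_measurable borel"
    by (rule weighted_integral_integrand_measurable[OF f p], rule weighted_integral_integrand_measurable[OF continuous_on_const p])
  have "weighted_integral p b (\<lambda>z. f z + k) \<le> (\<integral>\<^sup>+z. ennreal (2 powr p) * (?w f z + ennreal (cmod k powr p) * ?w (\<lambda>_. 1) z) \<partial>lborel)"
    unfolding weighted_integral_def
  proof (rule nn_integral_mono)
    fix z :: "complex^'n"
    have "cmod (f z + k) powr p \<le> (cmod (f z) + cmod k) powr p" using p by (intro powr_mono2 norm_triangle_ineq) auto
    also have "\<dots> \<le> 2 powr p * (cmod (f z) powr p + cmod k powr p)" using p by (intro powr_add_le) auto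
    finally have "(1 - (norm z)\<^sup>2) powr b * cmod (f z + k) powr p \<le> (1 - (norm z)\<^sup>2) powr b * (2 powr p * (cmod (f z) powr p + cmod k powr p))"
      by (rule mult_left_mono) simp
    also have "\<dots> = 2 powr p * ((1 - (norm z)\<^sup>2) powr b * cmod (f z) powr p + cmod k powr p * ((1 - (norm z)\<^sup>2) powr b * cmod 1 powr p))"
      by (simp add: algebra_simps)
    finally have "ennreal ((1 - (norm z)\<^sup>2) powr b * cmod (f z + k) powr p) \<le>
      ennreal (2 powr p) * (ennreal ((1 - (norm z)\<^sup>2) powr b * cmod (f z) powr p) + ennreal (cmod k powr p) * ennreal ((1 - (norm z)\<^sup>2) powr b * cmod 1 powr p))"
      by (simp only: ennreal_leI ennreal_mult[symmetric] ennreal_plus[symmetric] powr_ge_zero mult_nonneg_nonneg add_nonneg_nonneg)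
    then show "?w (\<lambda>z. f z + k) z \<le> ennreal (2 powr p) * (?w f z + ennreal (cmod k powr p) * ?w (\<lambda>_. 1) z)"
      by (auto simp: indicator_def)
  qed
  also have "\<dots> = ennreal (2 powr p) * (weighted_integral p b f + ennreal (cmod k powr p) * weighted_integral p b (\<lambda>_ :: complex^'n. 1))"
    unfolding weighted_integral_def using m by (simp add: nn_integral_cmult nn_integral_add)
  finally show ?thesis .
qed

lemma mseries_add_const:
  fixes f :: "complex^'n::finite \<Rightarrow> complex"
  assumes "mseries c f"
  shows "mseries (\<lambda>m. c m + (if m = (\<lambda>_. 0) then k else 0)) (\<lambda>z. f z + k)"
  unfolding mseries_def
proof
  fix z :: "complex^'n" assume z: "z \<in> ball 0 1"
  have "((\<lambda>m. (if m = (\<lambda>_. 0) then k else 0) * mi_power z m) has_sum k) {\<lambda>_. 0}"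
    by (simp add: has_sum_finite_iff)
  moreover have "((\<lambda>m. (if m = (\<lambda>_. 0) then k else 0) * mi_power z m) has_sum k) {\<lambda>_. 0} \<longleftrightarrow>
      ((\<lambda>m. (if m = (\<lambda>_. 0) then k else 0) * mi_power z m) has_sum k) UNIV"
    by (rule has_sum_cong_neutral) auto
  ultimately have "((\<lambda>m. c m * mi_power z m + (if m = (\<lambda>_. 0) then k else 0) * mi_power z m) has_sum (f z + k)) UNIV"
    using assms z unfolding mseries_def by (intro has_sum_add) blast+
  then show "((\<lambda>m. (c m + (if m = (\<lambda>_. 0) then k else 0)) * mi_power z m) has_sum (f z + k)) UNIV"
    by (simp only: distrib_right)
qed

text \<open>
  Constant terms are split off and treated separately, which requires constants to be integrable
  for both weights.
\<close>

lemma weighted_integral_multiplier: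
  fixes p b s :: real
  assumes p: "p > 0" and b: "b > -1" "b - p * s > -1"
  obtains C :: real where "C > 0"
    "\<And>c c' (g :: complex^'n::finite \<Rightarrow> complex) h. mseries c g \<Longrightarrow> mseries c' h \<Longrightarrow>
      \<forall>m. m \<noteq> (\<lambda>_. 0) \<longrightarrow> c' m = of_real (real (mi_order m) powr s) * c m \<Longrightarrow>
      weighted_integral p b h \<le> ennreal C * (weighted_integral p (b - p * s) g +
        (ennreal (cmod (c (\<lambda>_. 0)) powr p) + ennreal (cmod (c' (\<lambda>_. 0)) powr p)))"
proof -
  obtain C1 :: real where C1: "C1 > 0"
    "\<And>c (g :: complex^'n \<Rightarrow> complex) h. mseries c g \<Longrightarrow> c (\<lambda>_. 0) = 0 \<Longrightarrow>
      mseries (\<lambda>m. of_real (real (mi_order m) powr s) * c m) h \<Longrightarrow>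
      weighted_integral p b h \<le> ennreal C1 * weighted_integral p (b - p * s) g"
    by (rule weighted_integral_multiplier_vanishing[OF p b(1), of s]) (rule that)
  let ?one = "\<lambda>_ :: complex^'n. 1"
  obtain A where A: "weighted_integral p b ?one = ennreal A" "A \<ge> 0"
    using weighted_integral_one_finite[OF b(1), of p, where 'n = 'n] by (cases "weighted_integral p b ?one") auto
  obtain B where B: "weighted_integral p (b - p * s) ?one = ennreal B" "B \<ge> 0"
    using weighted_integral_one_finite[OF b(2), of p, where 'n = 'n] by (cases "weighted_integral p (b - p * s) ?one") auto
  define C where "C = 2 powr p * (C1 * 2 powr p * (1 + B) + A)"
  have "C1 * 2 powr p * (1 + B) > 0" using C1 B by simp
  from add_pos_nonneg[OF this A(2)] have C: "C > 0" unfolding C_def by simp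
  show ?thesis
  proof (rule that[OF C])
    fix c c' and g h :: "complex^'n \<Rightarrow> complex"
    assume g: "mseries c g" and h: "mseries c' h"
      and cc: "\<forall>m. m \<noteq> (\<lambda>_. 0) \<longrightarrow> c' m = of_real (real (mi_order m) powr s) * c m"
    define k where "k = c (\<lambda>_. 0)"
    define k' where "k' = c' (\<lambda>_. 0)"
    let ?J = "weighted_integral p (b - p * s) g"
    have g1: "mseries (\<lambda>m. c m + (if m = (\<lambda>_. 0) then - k else 0)) (\<lambda>z. g z + - k)" by (rule mseries_add_const[OF g])
    have h1: "mseries (\<lambda>m. c' m + (if m = (\<lambda>_. 0) then - k' else 0)) (\<lambda>z. h z + - k')" by (rule mseries_add_const[OF h])
    have eq: "(\<lambda>m. c' m + (if m = (\<lambda>_. 0) then - k' else 0)) = (\<lambda>m. of_real (real (mi_order m) powr s) * (c m + (if m = (\<lambda>_. 0) then - k else 0)))"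
    proof
      fix m
      show "c' m + (if m = (\<lambda>_. 0) then - k' else 0) = of_real (real (mi_order m) powr s) * (c m + (if m = (\<lambda>_. 0) then - k else 0))"
        using cc by (cases "m = (\<lambda>_. 0)") (simp_all add: k_def k'_def)
    qed
    have 1: "weighted_integral p b (\<lambda>z. h z + - k') \<le> ennreal C1 * weighted_integral p (b - p * s) (\<lambda>z. g z + - k)"
      by (rule C1(2)[OF g1]) (use h1 eq in \<open>simp_all add: k_def\<close>)
    have 2: "weighted_integral p (b - p * s) (\<lambda>z. g z + - k) \<le> ennreal (2 powr p) * (?J + ennreal (cmod k powr p) * ennreal B)"
      using weighted_integral_add_const[OF mseries_continuous_on[OF g] p, of "b - p * s" "- k"] B by simp
    have 3: "weighted_integral p b h \<le> ennreal (2 powr p) * (weighted_integral p b (\<lambda>z. h z + - k') + ennreal (cmod k' powr p) * ennreal A)"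
      using weighted_integral_add_const[OF mseries_continuous_on[OF h1] p, of b k'] A by simp
    show "weighted_integral p b h \<le> ennreal C * (?J + (ennreal (cmod (c (\<lambda>_. 0)) powr p) + ennreal (cmod (c' (\<lambda>_. 0)) powr p)))"
    proof (cases "?J = top")
      case True
      then show ?thesis using C by (simp add: ennreal_mult_top)
    next
      case False
      then obtain J where J: "?J = ennreal J" "J \<ge> 0" by (cases ?J) auto
      define x y where "x = cmod k powr p" and "y = cmod k' powr p"
      have xy: "x \<ge> 0" "y \<ge> 0" by (simp_all add: x_def y_def)
      have "weighted_integral p b h \<le> ennreal (2 powr p) * (weighted_integral p b (\<lambda>z. h z + - k') + ennreal y * ennreal A)"
        using 3 unfolding y_def .
      also have "\<dots> \<le> ennreal (2 powr p) * (ennreal C1 * weighted_integral p (b - p * s) (\<lambda>z. g z + - k) + ennreal y * ennreal A)"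
        by (intro mult_left_mono add_right_mono 1) simp
      also have "\<dots> \<le> ennreal (2 powr p) * (ennreal C1 * (ennreal (2 powr p) * (ennreal J + ennreal x * ennreal B)) + ennreal y * ennreal A)"
        by (intro mult_left_mono add_right_mono 2[unfolded J(1) x_def[symmetric]]) simp_all
      also have "\<dots> = ennreal (2 powr p * (C1 * (2 powr p * (J + x * B)) + y * A))"
        using C1 J xy A B by (simp add: ennreal_mult[symmetric] ennreal_plus[symmetric] del: ennreal_plus)
      also have "\<dots> \<le> ennreal (C * (J + (x + y)))"
      proof (rule ennreal_leI)
        have "J + x * B \<le> (1 + B) * (J + (x + y))" using J xy B by (simp add: algebra_simps)
        then have "C1 * (2 powr p * (J + x * B)) \<le> C1 * (2 powr p * ((1 + B) * (J + (x + y))))"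
          using C1 by (intro mult_left_mono) auto
        moreover have "y * A \<le> A * (J + (x + y))" using J xy A by (simp add: algebra_simps)
        ultimately have "C1 * (2 powr p * (J + x * B)) + y * A \<le> C1 * (2 powr p * ((1 + B) * (J + (x + y)))) + A * (J + (x + y))"
          by (rule add_mono)
        then have "2 powr p * (C1 * (2 powr p * (J + x * B)) + y * A) \<le> 2 powr p * (C1 * (2 powr p * ((1 + B) * (J + (x + y)))) + A * (J + (x + y)))"
          by (rule mult_left_mono) simp
        also have "\<dots> = C * (J + (x + y))" by (simp add: C_def algebra_simps)
        finally show "2 powr p * (C1 * (2 powr p * (J + x * B)) + y * A) \<le> C * (J + (x + y))" .
      qed
      also have "\<dots> = ennreal C * (?J + (ennreal x + ennreal y))"
        using C J xy by (simp add: ennreal_mult[symmetric] ennreal_plus[symmetric] del: ennreal_plus)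
      finally show ?thesis unfolding x_def y_def k_def k'_def .
    qed
  qed
qed

section \<open>Bergman spaces\<close>

lemma emeasure_weighted_volume_pos:
  "emeasure (weighted_volume \<alpha> :: (complex^'n::finite) measure) (space (weighted_volume \<alpha>)) > 0" (is "?e > 0")
  and emeasure_weighted_volume_finite:
  "\<alpha> > -1 \<Longrightarrow> emeasure (weighted_volume \<alpha> :: (complex^'n::finite) measure) (space (weighted_volume \<alpha>)) < top"
  and weighted_volume_nn_integral:
  "F \<in> borel_measurable (restrict_space lborel (ball 0 1)) \<Longrightarrow> (\<integral>\<^sup>+z. F z \<partial>(weighted_volume \<alpha> :: (complex^'n::finite) measure)) =
     (\<integral>\<^sup>+z. indicator (ball 0 1) z * (ennreal ((1 - (norm z)\<^sup>2) powr \<alpha>) * F z) \<partial>lborel)"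
proof -
  let ?M = "restrict_space lborel (ball (0 :: complex^'n) 1)"
  have "\<forall>z\<in>ball (0::complex^'n) 1. 1 - (norm z)\<^sup>2 \<noteq> 0"
    using one_minus_square_bounds(3)[OF norm_ge_zero] by fastforce
  then have "continuous_on (ball (0::complex^'n) 1) (\<lambda>z. (1 - (norm z)\<^sup>2) powr \<alpha>)"
    by (intro continuous_on_powr continuous_on_diff continuous_on_const continuous_on_power continuous_on_norm continuous_on_id)
  then have "(\<lambda>z. (1 - (norm z)\<^sup>2) powr \<alpha>) \<in> borel_measurable (restrict_space borel (ball (0::complex^'n) 1))"
    by (rule borel_measurable_continuous_on_restrict)
  then have w: "(\<lambda>z. ennreal ((1 - (norm z)\<^sup>2) powr \<alpha>)) \<in> borel_measurable ?M"
    by (simp add: measurable_cong_sets[OF sets_restrict_space_cong[OF sets_lborel] refl])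
  show int: "(\<integral>\<^sup>+z. F z \<partial>weighted_volume \<alpha>) = (\<integral>\<^sup>+z. indicator (ball 0 1) z * (ennreal ((1 - (norm z)\<^sup>2) powr \<alpha>) * F z) \<partial>lborel)"
    if F: "F \<in> borel_measurable ?M" for F
    unfolding weighted_volume_def nn_integral_density[OF w F]
    by (subst nn_integral_restrict_space) (simp_all add: mult.commute)
  have "?e = (\<integral>\<^sup>+z. 1 \<partial>(weighted_volume \<alpha> :: (complex^'n) measure))" by simp
  also have "\<dots> = (\<integral>\<^sup>+z. indicator (ball (0::complex^'n) 1) z * (ennreal ((1 - (norm z)\<^sup>2) powr \<alpha>) * 1) \<partial>lborel)"
    by (rule int) simp
  also have "\<dots> = weighted_integral 1 \<alpha> (\<lambda>_ :: complex^'n. 1)" unfolding weighted_integral_def by simp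
  finally have e: "?e = weighted_integral 1 \<alpha> (\<lambda>_ :: complex^'n. 1)" .
  show "?e < top" if "\<alpha> > -1" unfolding e by (rule weighted_integral_one_finite[OF that])
  \<comment> \<open>A lower bound for the weight on the ball of radius \<open>1/2\<close>, for either sign of \<open>\<alpha>\<close>.\<close>
  define K where "K = min 1 ((3/4::real) powr \<alpha>)"
  have K: "K > 0" by (simp add: K_def)
  have "0 < ennreal K * emeasure lborel (ball (0::complex^'n) (1/2))"
    using K by (simp add: emeasure_ball ennreal_zero_less_mult_iff)
  also have "\<dots> = (\<integral>\<^sup>+z. ennreal K * indicator (ball (0::complex^'n) (1/2)) z \<partial>lborel)"
    by (simp add: nn_integral_cmult_indicator)
  also have "\<dots> \<le> ?e" unfolding e weighted_integral_def
  proof (rule nn_integral_mono)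
    fix z :: "complex^'n"
    show "ennreal K * indicator (ball 0 (1/2)) z \<le> indicator (ball 0 1) z * ennreal ((1 - (norm z)\<^sup>2) powr \<alpha> * cmod 1 powr 1)"
    proof (cases "norm z < 1/2")
      case True
      have "(norm z)\<^sup>2 \<le> (1/2)\<^sup>2" using True by (intro power_mono) auto
      then have q: "3/4 \<le> 1 - (norm z)\<^sup>2" by (simp add: power2_eq_square)
      have "K \<le> (1 - (norm z)\<^sup>2) powr \<alpha>"
      proof (cases "\<alpha> \<ge> 0")
        case True
        then have "(3/4) powr \<alpha> \<le> (1 - (norm z)\<^sup>2) powr \<alpha>" using q by (intro powr_mono2) auto
        then show ?thesis by (simp add: K_def)
      next
        case False
        then have "1 powr \<alpha> \<le> (1 - (norm z)\<^sup>2) powr \<alpha>" using q by (intro powr_mono2') auto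
        then show ?thesis by (simp add: K_def)
      qed
      then show ?thesis using True by (simp add: ennreal_leI)
    qed simp
  qed
  finally show "?e > 0" .
qed

lemma sets_v_measure: "sets (v_measure \<alpha> :: (complex^'n::finite) measure) = sets (restrict_space borel (ball 0 1))"
  by (simp add: v_measure_def Let_def weighted_volume_def sets_restrict_space_cong[OF sets_lborel])

lemma borel_measurable_v_measure:
  fixes f :: "complex^'n::finite \<Rightarrow> 'b::topological_space"
  assumes "continuous_on (ball 0 1) f" shows "f \<in> borel_measurable (v_measure \<alpha>)"
  using borel_measurable_continuous_on_restrict[OF assms]
  by (simp add: measurable_cong_sets[OF sets_v_measure refl])

text \<open>
  For \<open>\<alpha> > -1\<close> the total mass is finite and positive, so normalization changes integrals by a
  positive constant only; otherwise the constant is \<open>1\<close>.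
\<close>

lemma v_measure_nn_integral:
  obtains \<kappa> :: real where "\<kappa> > 0"
    "\<And>F :: complex^'n::finite \<Rightarrow> ennreal. F \<in> borel_measurable (v_measure \<alpha>) \<Longrightarrow> (\<integral>\<^sup>+z. F z \<partial>v_measure \<alpha>) =
      ennreal \<kappa> * (\<integral>\<^sup>+z. indicator (ball 0 1) z * (ennreal ((1 - (norm z)\<^sup>2) powr \<alpha>) * F z) \<partial>lborel)"
proof -
  let ?V = "weighted_volume \<alpha> :: (complex^'n) measure"
  have ms: "F \<in> borel_measurable (v_measure \<alpha>) \<longleftrightarrow> F \<in> borel_measurable (restrict_space lborel (ball 0 1))"
    "F \<in> borel_measurable ?V \<longleftrightarrow> F \<in> borel_measurable (restrict_space lborel (ball 0 1))" for F :: "complex^'n \<Rightarrow> ennreal"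
    by (simp_all add: measurable_cong_sets[OF sets_v_measure refl] weighted_volume_def measurable_cong_sets[OF sets_restrict_space_cong[OF sets_lborel] refl])
  show ?thesis
  proof (cases "\<alpha> > -1")
    case True
    let ?e = "emeasure ?V (space ?V)"
    obtain x where x: "?e = ennreal x" "x > 0"
      using emeasure_weighted_volume_pos[of \<alpha>, where 'n = 'n] emeasure_weighted_volume_finite[OF True, where 'n = 'n]
      by (cases ?e) auto
    show ?thesis
    proof (rule that)
      show "1 / x > 0" using x by simp
      fix F :: "complex^'n \<Rightarrow> ennreal" assume F: "F \<in> borel_measurable (v_measure \<alpha>)"
      have "v_measure \<alpha> = scale_measure (inverse ?e) ?V" using True by (simp add: v_measure_def Let_def)
      then have "(\<integral>\<^sup>+z. F z \<partial>v_measure \<alpha>) = inverse ?e * (\<integral>\<^sup>+z. F z \<partial>?V)"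
        using F ms by (simp add: nn_integral_scale_measure)
      also have "inverse ?e = ennreal (1 / x)" unfolding x(1) using x(2) by (simp add: inverse_ennreal inverse_eq_divide)
      finally show "(\<integral>\<^sup>+z. F z \<partial>v_measure \<alpha>) = ennreal (1 / x) * (\<integral>\<^sup>+z. indicator (ball 0 1) z * (ennreal ((1 - (norm z)\<^sup>2) powr \<alpha>) * F z) \<partial>lborel)"
        using F ms by (simp add: weighted_volume_nn_integral)
    qed
  next
    case False
    show ?thesis
    proof (rule that[of 1])
      fix F :: "complex^'n \<Rightarrow> ennreal" assume F: "F \<in> borel_measurable (v_measure \<alpha>)"
      have "v_measure \<alpha> = ?V" using False by (simp add: v_measure_def Let_def)
      then show "(\<integral>\<^sup>+z. F z \<partial>v_measure \<alpha>) = ennreal 1 * (\<integral>\<^sup>+z. indicator (ball 0 1) z * (ennreal ((1 - (norm z)\<^sup>2) powr \<alpha>) * F z) \<partial>lborel)"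
        using F ms by (simp add: weighted_volume_nn_integral)
    qed simp
  qed
qed

lemma in_Lp_iff_weighted_integral:
  fixes f :: "complex^'n::finite \<Rightarrow> complex"
  assumes f: "continuous_on (ball 0 1) f" and p: "p > 0"
  shows "in_Lp p (v_measure \<alpha>) (\<lambda>z. of_real ((1 - (norm z)\<^sup>2) ^ k) * f z) \<longleftrightarrow>
    weighted_integral p (p * real k + \<alpha>) f < top"
proof -
  obtain \<kappa> :: real where \<kappa>: "\<kappa> > 0"
    "\<And>F :: complex^'n \<Rightarrow> ennreal. F \<in> borel_measurable (v_measure \<alpha>) \<Longrightarrow> (\<integral>\<^sup>+z. F z \<partial>v_measure \<alpha>) =
      ennreal \<kappa> * (\<integral>\<^sup>+z. indicator (ball 0 1) z * (ennreal ((1 - (norm z)\<^sup>2) powr \<alpha>) * F z) \<partial>lborel)"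
    by (rule v_measure_nn_integral[of \<alpha>]) (rule that)
  let ?g = "\<lambda>z. of_real ((1 - (norm z)\<^sup>2) ^ k) * f z"
  have gc: "continuous_on (ball 0 1) ?g" by (intro continuous_intros f)
  have g: "?g \<in> borel_measurable (v_measure \<alpha>)" by (rule borel_measurable_v_measure[OF gc])
  then have gp: "(\<lambda>z. cmod (?g z) powr p) \<in> borel_measurable (v_measure \<alpha>)" by measurable
  have "in_Lp p (v_measure \<alpha>) ?g \<longleftrightarrow> (\<integral>\<^sup>+z. ennreal (cmod (?g z) powr p) \<partial>v_measure \<alpha>) < top"
    unfolding in_Lp_def integrable_iff_bounded using g gp by simp
  also have "(\<integral>\<^sup>+z. ennreal (cmod (?g z) powr p) \<partial>v_measure \<alpha>) =
      ennreal \<kappa> * (\<integral>\<^sup>+z. indicator (ball 0 1) z * (ennreal ((1 - (norm z)\<^sup>2) powr \<alpha>) * ennreal (cmod (?g z) powr p)) \<partial>lborel)"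
    by (rule \<kappa>(2)) (use gp in measurable)
  also have "(\<integral>\<^sup>+z. indicator (ball 0 1) z * (ennreal ((1 - (norm z)\<^sup>2) powr \<alpha>) * ennreal (cmod (?g z) powr p)) \<partial>lborel) =
      weighted_integral p (p * real k + \<alpha>) f"
    unfolding weighted_integral_def
  proof (rule nn_integral_cong)
    fix z :: "complex^'n"
    show "indicator (ball 0 1) z * (ennreal ((1 - (norm z)\<^sup>2) powr \<alpha>) * ennreal (cmod (?g z) powr p)) =
      indicator (ball 0 1) z * ennreal ((1 - (norm z)\<^sup>2) powr (p * real k + \<alpha>) * cmod (f z) powr p)"
    proof (cases "norm z < 1")
      case True
      define r where "r = 1 - (norm z)\<^sup>2"
      have r: "r > 0" using one_minus_square_bounds(3)[OF norm_ge_zero True] by (simp add: r_def)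
      have "cmod (?g z) = r ^ k * cmod (f z)" unfolding r_def[symmetric] using r by (simp add: norm_mult norm_power)
      then have "cmod (?g z) powr p = r powr (p * real k) * cmod (f z) powr p"
        using r by (simp add: powr_mult powr_realpow[symmetric] powr_powr mult.commute)
      then have "r powr \<alpha> * cmod (?g z) powr p = r powr (p * real k + \<alpha>) * cmod (f z) powr p"
        by (simp add: powr_add)
      then show ?thesis unfolding r_def[symmetric] by (simp only: ennreal_mult[symmetric] powr_ge_zero)
    qed simp
  qed
  finally show ?thesis using \<kappa>(1) by (auto simp: ennreal_mult_less_top)
qed

lemma bergman_norm_eq:
  obtains \<kappa> :: real where "\<kappa> > 0"
    "\<And>f :: complex^'n::finite \<Rightarrow> complex. continuous_on (ball 0 1) ((radial_deriv ^^ bergman_index p \<alpha>) f) \<Longrightarrow>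
      bergman_norm p \<alpha> f = cmod (f 0) +
       (\<kappa> * enn2real (weighted_integral p (p * real (bergman_index p \<alpha>) + \<alpha>) ((radial_deriv ^^ bergman_index p \<alpha>) f))) powr (1 / p)"
proof -
  obtain \<kappa> :: real where \<kappa>: "\<kappa> > 0"
    "\<And>F :: complex^'n \<Rightarrow> ennreal. F \<in> borel_measurable (v_measure \<alpha>) \<Longrightarrow> (\<integral>\<^sup>+z. F z \<partial>v_measure \<alpha>) =
      ennreal \<kappa> * (\<integral>\<^sup>+z. indicator (ball 0 1) z * (ennreal ((1 - (norm z)\<^sup>2) powr \<alpha>) * F z) \<partial>lborel)"
    by (rule v_measure_nn_integral[of \<alpha>]) (rule that)
  show ?thesis
  proof (rule that[OF \<kappa>(1)])
    fix f :: "complex^'n \<Rightarrow> complex"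
    define N where "N = bergman_index p \<alpha>"
    define h where "h = (radial_deriv ^^ N) f"
    assume "continuous_on (ball 0 1) ((radial_deriv ^^ bergman_index p \<alpha>) f)"
    then have h: "continuous_on (ball 0 1) h" by (simp add: h_def N_def)
    let ?g = "\<lambda>z. (1 - (norm z)\<^sup>2) powr (p * real N) * cmod (h z) powr p"
    have m1: "(\<lambda>z. cmod (h z) powr p) \<in> borel_measurable (v_measure \<alpha>)"
      using borel_measurable_v_measure[OF h, of \<alpha>] by measurable
    have "(\<lambda>z. 1 - (norm z)\<^sup>2) \<in> borel_measurable (v_measure \<alpha> :: (complex^'n) measure)"
      by (intro borel_measurable_v_measure continuous_intros)
    then have "(\<lambda>z. (1 - (norm z)\<^sup>2) powr (p * real N)) \<in> borel_measurable (v_measure \<alpha> :: (complex^'n) measure)"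
      by measurable
    with m1 have g: "?g \<in> borel_measurable (v_measure \<alpha>)" by (rule borel_measurable_times[rotated])
    have "(\<integral>z. ?g z \<partial>v_measure \<alpha>) = enn2real (\<integral>\<^sup>+z. ennreal (?g z) \<partial>v_measure \<alpha>)"
      by (rule integral_eq_nn_integral[OF g]) simp
    also have "(\<integral>\<^sup>+z. ennreal (?g z) \<partial>v_measure \<alpha>) = ennreal \<kappa> * (\<integral>\<^sup>+z. indicator (ball 0 1) z * (ennreal ((1 - (norm z)\<^sup>2) powr \<alpha>) * ennreal (?g z)) \<partial>lborel)"
      by (rule \<kappa>(2)) (use g in measurable)
    also have "(\<integral>\<^sup>+z. indicator (ball 0 1) z * (ennreal ((1 - (norm z)\<^sup>2) powr \<alpha>) * ennreal (?g z)) \<partial>lborel) = weighted_integral p (p * real N + \<alpha>) h"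
      unfolding weighted_integral_def
    proof (rule nn_integral_cong)
      fix z :: "complex^'n"
      have "(1 - (norm z)\<^sup>2) powr \<alpha> * ?g z = (1 - (norm z)\<^sup>2) powr (p * real N + \<alpha>) * cmod (h z) powr p"
        by (simp add: powr_add)
      then show "indicator (ball 0 1) z * (ennreal ((1 - (norm z)\<^sup>2) powr \<alpha>) * ennreal (?g z)) =
        indicator (ball 0 1) z * ennreal ((1 - (norm z)\<^sup>2) powr (p * real N + \<alpha>) * cmod (h z) powr p)"
        by (simp only: ennreal_mult[symmetric] powr_ge_zero mult_nonneg_nonneg)
    qed
    finally have "(\<integral>z. ?g z \<partial>v_measure \<alpha>) = \<kappa> * enn2real (weighted_integral p (p * real N + \<alpha>) h)"
      using \<kappa>(1) by (simp add: enn2real_mult)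
    then show "bergman_norm p \<alpha> f = cmod (f 0) +
       (\<kappa> * enn2real (weighted_integral p (p * real (bergman_index p \<alpha>) + \<alpha>) ((radial_deriv ^^ bergman_index p \<alpha>) f))) powr (1 / p)"
      unfolding bergman_norm_def Let_def h_def N_def by simp
  qed
qed

lemma bergman_index_admissible:
  assumes "p > 0" shows "p * real (bergman_index p \<alpha>) + \<alpha> > -1"
proof -
  obtain N :: nat where "(- 1 - \<alpha>) / p < real N" using reals_Archimedean2 by blast
  then have "p * real N + \<alpha> > -1" using assms by (simp add: field_simps)
  then show ?thesis unfolding bergman_index_def by (rule LeastI)
qed

lemma bergman_space_iff:
  assumes p: "p > 0"
  shows "f \<in> bergman_space p \<alpha> \<longleftrightarrow> f \<in> hol_ball \<and>
    (\<exists>k::nat. p * real k + \<alpha> > -1 \<and> weighted_integral p (p * real k + \<alpha>) ((radial_deriv ^^ k) f) < top)"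
proof (cases "f \<in> hol_ball")
  case True
  have "continuous_on (ball 0 1) ((radial_deriv ^^ k) f)" for k
    by (rule mseries_continuous_on[OF mseries_radial_deriv_funpow[OF hol_ball_mseries[OF True]]])
  from in_Lp_iff_weighted_integral[OF this p] show ?thesis unfolding bergman_space_def by simp
qed (simp add: bergman_space_def)

definition multiplier_coeff :: "real \<Rightarrow> (('n::finite \<Rightarrow> nat) \<Rightarrow> complex) \<Rightarrow> ('n \<Rightarrow> nat) \<Rightarrow> complex" where
  "multiplier_coeff s c m = (if m = (\<lambda>_. 0) then c m else of_real (real (mi_order m) powr s) * c m)"

lemma T_op_mseries:
  fixes f :: "complex^'n::finite \<Rightarrow> complex"
  assumes f: "f \<in> hol_ball"
  shows "mseries (multiplier_coeff ((\<beta> - \<alpha>) / p) (taylor_coeff f)) (T_op p \<alpha> \<beta> f)"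
proof -
  define s where "s = (\<beta> - \<alpha>) / p"
  define c where "c = taylor_coeff f"
  have c: "mseries c f" unfolding c_def by (rule hol_ball_mseries[OF f])
  define h where "h z = (\<Sum>\<^sub>\<infinity>m. of_real (real (mi_order m) powr s) * c m * mi_power z m)" for z
  have "mseries (\<lambda>m. of_real (real (mi_order m) powr s) * c m) h"
    by (rule mseries_multiplier[OF c subexponential_powr]) (simp add: h_def)
  from mseries_add_const[OF this, of "f 0"]
  have 1: "mseries (multiplier_coeff s c) (\<lambda>z. h z + f 0)"
  proof (rule back_subst[of "\<lambda>c. mseries c _"])
    show "(\<lambda>m. of_real (real (mi_order m) powr s) * c m + (if m = (\<lambda>_. 0) then f 0 else 0)) = multiplier_coeff s c"
    proof
      fix m
      show "of_real (real (mi_order m) powr s) * c m + (if m = (\<lambda>_. 0) then f 0 else 0) = multiplier_coeff s c m"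
        by (cases "m = (\<lambda>_. 0)") (simp_all add: multiplier_coeff_def mseries_at_0[OF c] mi_order_def)
    qed
  qed
  have 2: "T_op p \<alpha> \<beta> f z = h z + f 0" if z: "z \<in> ball 0 1" for z
  proof -
    have "(\<Sum>\<^sub>\<infinity>m\<in>{m. mi_order m > 0}. of_real (real (mi_order m) powr s) * c m * mi_power z m) = h z"
      unfolding h_def by (rule infsum_cong_neutral) auto
    then show ?thesis using z by (simp add: T_op_def s_def c_def)
  qed
  show ?thesis using 1 2 unfolding mseries_def s_def c_def by simp
qed

lemma T_op_hol_ball:
  fixes f :: "complex^'n::finite \<Rightarrow> complex"
  assumes f: "f \<in> hol_ball" shows "T_op p \<alpha> \<beta> f \<in> hol_ball"
proof -
  have "\<exists>D. (T_op p \<alpha> \<beta> f has_derivative D) (at z) \<and> (\<forall>c v. D (c *s v) = c * D v)" if "z \<in> ball 0 1" for z :: "complex^'n"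
    by (rule mseries_has_derivative_radial[OF T_op_mseries[OF f] that]) blast
  moreover have "T_op p \<alpha> \<beta> f \<in> extensional (ball 0 1)" by (simp add: T_op_def)
  ultimately show ?thesis unfolding hol_ball_def by blast
qed

text \<open>
  The multipliers of the two operators are reciprocal for \<open>m \<noteq> 0\<close> and equal to \<open>1\<close> for \<open>m = 0\<close>, and a
  holomorphic function is determined by its coefficients.
\<close>

lemma T_op_inverse:
  fixes f :: "complex^'n::finite \<Rightarrow> complex"
  assumes f: "f \<in> hol_ball" shows "T_op p \<alpha> \<beta> (T_op p \<beta> \<alpha> f) = f"
proof -
  let ?g = "T_op p \<beta> \<alpha> f"
  define s where "s = (\<beta> - \<alpha>) / p"
  have s': "(\<alpha> - \<beta>) / p = - s" by (simp add: s_def minus_divide_left)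
  have g: "mseries (multiplier_coeff (- s) (taylor_coeff f)) ?g" using T_op_mseries[OF f, of \<alpha> \<beta> p] unfolding s' .
  then have tg: "taylor_coeff ?g = multiplier_coeff (- s) (taylor_coeff f)" by (intro ext mseries_taylor_coeff)
  have "multiplier_coeff s (taylor_coeff ?g) = taylor_coeff f"
  proof
    fix m
    show "multiplier_coeff s (taylor_coeff ?g) m = taylor_coeff f m"
    proof (cases "m = (\<lambda>_. 0)")
      case False
      then have "mi_order m \<noteq> 0" by (simp add: mi_order_eq_0_iff)
      then have "real (mi_order m) powr s * real (mi_order m) powr (- s) = 1" by (simp flip: powr_add)
      then have "complex_of_real (real (mi_order m) powr s) * of_real (real (mi_order m) powr (- s)) = 1"
        by (metis of_real_1 of_real_mult)
      then show ?thesis using False unfolding tg multiplier_coeff_def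
        by (simp only: if_False mult.assoc[symmetric] mult_1)
    qed (simp add: tg multiplier_coeff_def)
  qed
  then have "mseries (taylor_coeff f) (T_op p \<alpha> \<beta> ?g)"
    using T_op_mseries[OF T_op_hol_ball[OF f, of p \<beta> \<alpha>], of \<beta> \<alpha> p] by (simp add: s_def)
  then have "T_op p \<alpha> \<beta> ?g z = f z" if "z \<in> ball 0 1" for z
    using hol_ball_mseries[OF f] that unfolding mseries_def by (blast intro: has_sum_unique)
  moreover have "T_op p \<alpha> \<beta> ?g \<in> extensional (ball 0 1)" "f \<in> extensional (ball 0 1)"
    using f by (simp_all add: T_op_def hol_ball_def)
  ultimately show ?thesis by (intro extensionalityI) auto
qed

text \<open>
  The coefficients of \<open>R\<^sup>l h\<close> and \<open>R\<^sup>k f\<close> differ by the multiplier with exponent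
  \<open>t = l + (\<beta> - \<alpha>) / p - k\<close>. For \<open>\<alpha> = \<beta>\<close> it compares different \<open>k\<close> for the same function.
\<close>

lemma weighted_integral_radial_deriv:
  fixes p \<alpha> \<beta> :: real and k l :: nat
  assumes p: "p > 0" and k: "p * real k + \<alpha> > -1" and l: "p * real l + \<beta> > -1"
  obtains C :: real where "C > 0"
    "\<And>c (f :: complex^'n::finite \<Rightarrow> complex) h. mseries c f \<Longrightarrow> mseries (multiplier_coeff ((\<beta> - \<alpha>) / p) c) h \<Longrightarrow>
      weighted_integral p (p * real l + \<beta>) ((radial_deriv ^^ l) h) \<le>
      ennreal C * (weighted_integral p (p * real k + \<alpha>) ((radial_deriv ^^ k) f) + ennreal (2 * cmod (f 0) powr p))"
proof -
  define s where "s = (\<beta> - \<alpha>) / p"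
  define t where "t = real l + s - real k"
  have bt: "p * real l + \<beta> - p * t = p * real k + \<alpha>" using p by (simp add: t_def s_def field_simps)
  obtain C :: real where C: "C > 0"
    "\<And>c c' (g :: complex^'n \<Rightarrow> complex) h. mseries c g \<Longrightarrow> mseries c' h \<Longrightarrow>
      \<forall>m. m \<noteq> (\<lambda>_. 0) \<longrightarrow> c' m = of_real (real (mi_order m) powr t) * c m \<Longrightarrow>
      weighted_integral p (p * real l + \<beta>) h \<le> ennreal C * (weighted_integral p (p * real k + \<alpha>) g +
        (ennreal (cmod (c (\<lambda>_. 0)) powr p) + ennreal (cmod (c' (\<lambda>_. 0)) powr p)))"
    by (rule weighted_integral_multiplier[OF p l, of t, unfolded bt, OF k]) (rule that)
  show ?thesis
  proof (rule that[OF C(1)])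
    fix c and f h :: "complex^'n \<Rightarrow> complex"
    assume f: "mseries c f" and h: "mseries (multiplier_coeff ((\<beta> - \<alpha>) / p) c) h"
    define d where "d = multiplier_coeff s c"
    have h': "mseries d h" using h by (simp add: d_def s_def)
    have d0: "d (\<lambda>_. 0) = f 0" "c (\<lambda>_. 0) = f 0" using mseries_at_0[OF f] by (simp_all add: d_def multiplier_coeff_def)
    have n0: "cmod (of_nat (mi_order (\<lambda>_::'n. 0)) ^ j * f 0) powr p \<le> cmod (f 0) powr p" for j
      using p by (cases j) (auto simp: mi_order_def)
    have "weighted_integral p (p * real l + \<beta>) ((radial_deriv ^^ l) h) \<le> ennreal C * (weighted_integral p (p * real k + \<alpha>) ((radial_deriv ^^ k) f) +
        (ennreal (cmod (of_nat (mi_order (\<lambda>_::'n. 0)) ^ k * c (\<lambda>_. 0)) powr p) + ennreal (cmod (of_nat (mi_order (\<lambda>_::'n. 0)) ^ l * d (\<lambda>_. 0)) powr p)))"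
    proof (rule C(2)[OF mseries_radial_deriv_funpow[OF f, of k] mseries_radial_deriv_funpow[OF h', of l]], intro allI impI)
      fix m :: "'n \<Rightarrow> nat" assume m: "m \<noteq> (\<lambda>_. 0)"
      define x where "x = real (mi_order m)"
      have "mi_order m \<noteq> 0" using m by (simp add: mi_order_eq_0_iff)
      then have x: "x > 0" by (simp add: x_def)
      have "x powr t * x ^ k = x ^ l * x powr s"
        using x by (simp add: t_def powr_realpow[symmetric] flip: powr_add)
      then have "of_real (x powr t) * of_real (x ^ k) = of_real (x ^ l) * (of_real (x powr s) :: complex)"
        by (simp only: of_real_mult[symmetric])
      then have e: "of_real (x powr t) * of_nat (mi_order m) ^ k = of_nat (mi_order m) ^ l * (of_real (x powr s) :: complex)"
        by (simp add: x_def)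
      have "of_nat (mi_order m) ^ l * d m = of_nat (mi_order m) ^ l * of_real (x powr s) * c m"
        using m by (simp add: d_def multiplier_coeff_def x_def)
      also have "\<dots> = of_real (x powr t) * (of_nat (mi_order m) ^ k * c m)" unfolding e[symmetric] by (rule mult.assoc)
      finally show "of_nat (mi_order m) ^ l * d m = of_real (real (mi_order m) powr t) * (of_nat (mi_order m) ^ k * c m)"
        unfolding x_def .
    qed
    also have "\<dots> \<le> ennreal C * (weighted_integral p (p * real k + \<alpha>) ((radial_deriv ^^ k) f) + ennreal (2 * cmod (f 0) powr p))"
    proof (intro mult_left_mono add_left_mono)
      have "ennreal (cmod (of_nat (mi_order (\<lambda>_::'n. 0)) ^ k * c (\<lambda>_. 0)) powr p) + ennreal (cmod (of_nat (mi_order (\<lambda>_::'n. 0)) ^ l * d (\<lambda>_. 0)) powr p)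
        \<le> ennreal (cmod (f 0) powr p) + ennreal (cmod (f 0) powr p)"
        unfolding d0 by (intro add_mono ennreal_leI n0)
      also have "\<dots> = ennreal (2 * cmod (f 0) powr p)" by (simp flip: ennreal_plus)
      finally show "ennreal (cmod (of_nat (mi_order (\<lambda>_::'n. 0)) ^ k * c (\<lambda>_. 0)) powr p) + ennreal (cmod (of_nat (mi_order (\<lambda>_::'n. 0)) ^ l * d (\<lambda>_. 0)) powr p)
        \<le> ennreal (2 * cmod (f 0) powr p)" .
    qed simp
    finally show "weighted_integral p (p * real l + \<beta>) ((radial_deriv ^^ l) h) \<le>
      ennreal C * (weighted_integral p (p * real k + \<alpha>) ((radial_deriv ^^ k) f) + ennreal (2 * cmod (f 0) powr p))" .
  qed
qed

lemma T_op_bergman_space: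
  fixes f :: "complex^'n::finite \<Rightarrow> complex"
  assumes p: "p > 0" and f: "f \<in> bergman_space p \<alpha>"
  shows "T_op p \<alpha> \<beta> f \<in> bergman_space p \<beta>"
proof -
  obtain k where fh: "f \<in> hol_ball" and k: "p * real k + \<alpha> > -1" "weighted_integral p (p * real k + \<alpha>) ((radial_deriv ^^ k) f) < top"
    using f unfolding bergman_space_iff[OF p] by blast
  define N where "N = bergman_index p \<beta>"
  have N: "p * real N + \<beta> > -1" unfolding N_def by (rule bergman_index_admissible[OF p])
  obtain C :: real where C:
    "\<And>c (f :: complex^'n \<Rightarrow> complex) h. mseries c f \<Longrightarrow> mseries (multiplier_coeff ((\<beta> - \<alpha>) / p) c) h \<Longrightarrow>
      weighted_integral p (p * real N + \<beta>) ((radial_deriv ^^ N) h) \<le>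
      ennreal C * (weighted_integral p (p * real k + \<alpha>) ((radial_deriv ^^ k) f) + ennreal (2 * cmod (f 0) powr p))"
    by (rule weighted_integral_radial_deriv[OF p k(1) N]) (rule that)
  have "weighted_integral p (p * real N + \<beta>) ((radial_deriv ^^ N) (T_op p \<alpha> \<beta> f)) \<le>
      ennreal C * (weighted_integral p (p * real k + \<alpha>) ((radial_deriv ^^ k) f) + ennreal (2 * cmod (f 0) powr p))"
    by (rule C[OF hol_ball_mseries[OF fh] T_op_mseries[OF fh]])
  also have "\<dots> < top" using k(2) by (simp add: ennreal_mult_less_top)
  finally show ?thesis unfolding bergman_space_iff[OF p] using T_op_hol_ball[OF fh] N by blast
qed

lemma weighted_integral_bergman_index_finite:
  fixes f :: "complex^'n::finite \<Rightarrow> complex"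
  assumes p: "p > 0" and f: "f \<in> bergman_space p \<alpha>"
  shows "weighted_integral p (p * real (bergman_index p \<alpha>) + \<alpha>) ((radial_deriv ^^ bergman_index p \<alpha>) f) < top"
proof -
  obtain k where fh: "f \<in> hol_ball" and k: "p * real k + \<alpha> > -1" "weighted_integral p (p * real k + \<alpha>) ((radial_deriv ^^ k) f) < top"
    using f unfolding bergman_space_iff[OF p] by blast
  have f': "mseries (multiplier_coeff ((\<alpha> - \<alpha>) / p) (taylor_coeff f)) f"
  proof -
    have "multiplier_coeff ((\<alpha> - \<alpha>) / p) (taylor_coeff f) = taylor_coeff f"
    proof
      fix m :: "'n \<Rightarrow> nat"
      show "multiplier_coeff ((\<alpha> - \<alpha>) / p) (taylor_coeff f) m = taylor_coeff f m"
        by (cases "m = (\<lambda>_. 0)") (auto simp: multiplier_coeff_def mi_order_eq_0_iff)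
    qed
    then show ?thesis using hol_ball_mseries[OF fh] by simp
  qed
  obtain C :: real where C:
    "\<And>c (f :: complex^'n \<Rightarrow> complex) h. mseries c f \<Longrightarrow> mseries (multiplier_coeff ((\<alpha> - \<alpha>) / p) c) h \<Longrightarrow>
      weighted_integral p (p * real (bergman_index p \<alpha>) + \<alpha>) ((radial_deriv ^^ bergman_index p \<alpha>) h) \<le>
      ennreal C * (weighted_integral p (p * real k + \<alpha>) ((radial_deriv ^^ k) f) + ennreal (2 * cmod (f 0) powr p))"
    by (rule weighted_integral_radial_deriv[OF p k(1) bergman_index_admissible[OF p]]) (rule that)
  from C[OF hol_ball_mseries[OF fh] f']
  have "weighted_integral p (p * real (bergman_index p \<alpha>) + \<alpha>) ((radial_deriv ^^ bergman_index p \<alpha>) f) \<le>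
      ennreal C * (weighted_integral p (p * real k + \<alpha>) ((radial_deriv ^^ k) f) + ennreal (2 * cmod (f 0) powr p))" .
  also have "\<dots> < top" using k(2) by (simp add: ennreal_mult_less_top)
  finally show ?thesis .
qed

text \<open>
  The inequality for the minimal indices of both norms. Passing to \<open>p\<close>-th roots uses
  \<open>(x + y)\<^sup>q \<le> 2\<^sup>q (x\<^sup>q + y\<^sup>q)\<close> with \<open>q = 1 / p\<close>, which holds for every \<open>q > 0\<close>.
\<close>

lemma T_op_bounded:
  assumes p: "p > 0"
  shows "\<exists>C. \<forall>f \<in> (bergman_space p \<alpha> :: (complex^'n::finite \<Rightarrow> complex) set).
       bergman_norm p \<beta> (T_op p \<alpha> \<beta> f) \<le> C * bergman_norm p \<alpha> f"
proof -
  define M N where "M = bergman_index p \<alpha>" and "N = bergman_index p \<beta>"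
  have M: "p * real M + \<alpha> > -1" unfolding M_def by (rule bergman_index_admissible[OF p])
  have N: "p * real N + \<beta> > -1" unfolding N_def by (rule bergman_index_admissible[OF p])
  let ?X = "\<lambda>f :: complex^'n \<Rightarrow> complex. weighted_integral p (p * real M + \<alpha>) ((radial_deriv ^^ M) f)"
  let ?Y = "\<lambda>f :: complex^'n \<Rightarrow> complex. weighted_integral p (p * real N + \<beta>) ((radial_deriv ^^ N) f)"
  obtain C :: real where C: "C > 0"
    "\<And>c (f :: complex^'n \<Rightarrow> complex) h. mseries c f \<Longrightarrow> mseries (multiplier_coeff ((\<beta> - \<alpha>) / p) c) h \<Longrightarrow>
      ?Y h \<le> ennreal C * (?X f + ennreal (2 * cmod (f 0) powr p))"
    by (rule weighted_integral_radial_deriv[OF p M N]) (rule that)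
  obtain a :: real where a: "a > 0" "\<And>f :: complex^'n \<Rightarrow> complex. continuous_on (ball 0 1) ((radial_deriv ^^ M) f) \<Longrightarrow>
      bergman_norm p \<alpha> f = cmod (f 0) + (a * enn2real (?X f)) powr (1 / p)"
    by (rule bergman_norm_eq[of p \<alpha>, folded M_def]) (rule that)
  obtain b :: real where b: "b > 0" "\<And>f :: complex^'n \<Rightarrow> complex. continuous_on (ball 0 1) ((radial_deriv ^^ N) f) \<Longrightarrow>
      bergman_norm p \<beta> f = cmod (f 0) + (b * enn2real (?Y f)) powr (1 / p)"
    by (rule bergman_norm_eq[of p \<beta>, folded N_def]) (rule that)
  define q where "q = 1 / p"
  have q: "q > 0" "p * q = 1" using p by (simp_all add: q_def)
  define D1 where "D1 = 2 powr q * (b * C / a) powr q"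
  define D2 where "D2 = 2 powr q * (b * C * 2) powr q"
  show ?thesis
  proof (intro exI ballI)
    fix f :: "complex^'n \<Rightarrow> complex" assume f: "f \<in> bergman_space p \<alpha>"
    have fh: "f \<in> hol_ball" using f by (simp add: bergman_space_def)
    let ?T = "T_op p \<alpha> \<beta> f"
    note cf = hol_ball_mseries[OF fh] and cT = T_op_mseries[OF fh, of \<beta> \<alpha> p]
    obtain X where X: "?X f = ennreal X" "X \<ge> 0"
      using weighted_integral_bergman_index_finite[OF p f] unfolding M_def[symmetric] by (cases "?X f") auto
    define t where "t = cmod (f 0)"
    have t: "t \<ge> 0" by (simp add: t_def)
    have "?Y ?T \<le> ennreal C * (?X f + ennreal (2 * cmod (f 0) powr p))" by (rule C(2)[OF cf cT])
    also have "\<dots> = ennreal (C * (X + 2 * t powr p))" using C(1) X t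
      by (simp add: t_def ennreal_mult[symmetric] ennreal_plus[symmetric] del: ennreal_plus)
    finally have Y: "enn2real (?Y ?T) \<le> C * (X + 2 * t powr p)" using C(1) X t by (intro enn2real_leI) auto
    have T0: "?T 0 = f 0" using mseries_at_0[OF cT] mseries_at_0[OF cf] by (simp add: multiplier_coeff_def)
    have nf: "bergman_norm p \<alpha> f = t + (a * X) powr q"
      using a(2)[OF mseries_continuous_on[OF mseries_radial_deriv_funpow[OF cf]]] X by (simp add: t_def q_def)
    have nT: "bergman_norm p \<beta> ?T = t + (b * enn2real (?Y ?T)) powr q"
      using b(2)[OF mseries_continuous_on[OF mseries_radial_deriv_funpow[OF cT]]] by (simp add: t_def q_def T0)
    have "(b * enn2real (?Y ?T)) powr q \<le> (b * C * X + b * C * 2 * t powr p) powr q"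
proof (rule powr_mono2)
      have "b * enn2real (?Y ?T) \<le> b * (C * (X + 2 * t powr p))" using Y b(1) by (intro mult_left_mono) auto
      then show "b * enn2real (?Y ?T) \<le> b * C * X + b * C * 2 * t powr p" by (simp add: algebra_simps)
    qed (use b(1) q in auto)
    also have "\<dots> \<le> 2 powr q * ((b * C * X) powr q + (b * C * 2 * t powr p) powr q)"
      using b(1) C(1) X(2) q by (intro powr_add_le) auto
    also have "(b * C * X) powr q = (b * C / a) powr q * (a * X) powr q"
    proof -
      have "b * C * X = b * C / a * (a * X)" using a(1) by simp
      then have "(b * C * X) powr q = (b * C / a * (a * X)) powr q" by (rule arg_cong)
      also have "\<dots> = (b * C / a) powr q * (a * X) powr q" by (rule powr_mult)
      finally show ?thesis .
    qed
    also have "(b * C * 2 * t powr p) powr q = (b * C * 2) powr q * t"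
    proof -
      have "(t powr p) powr q = t" using t q(2) by (simp add: powr_powr)
      then show ?thesis using powr_mult[of "b * C * 2" "t powr p" q] b(1) C(1) by simp
    qed
    also have "2 powr q * ((b * C / a) powr q * (a * X) powr q + (b * C * 2) powr q * t) = D1 * (a * X) powr q + D2 * t"
      by (simp add: D1_def D2_def algebra_simps)
    finally have "bergman_norm p \<beta> ?T \<le> t + (D1 * (a * X) powr q + D2 * t)" unfolding nT by simp
    also have "\<dots> \<le> (1 + D1 + D2) * bergman_norm p \<alpha> f"
    proof -
      have "0 \<le> D1" "0 \<le> D2" by (simp_all add: D1_def D2_def)
      then show ?thesis unfolding nf using t by (simp add: algebra_simps)
    qed
    finally show "bergman_norm p \<beta> ?T \<le> (1 + D1 + D2) * bergman_norm p \<alpha> f" .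
  qed
qed

theorem theorem59:
  fixes \<alpha> \<beta> p :: real
  assumes "p > 0"
  shows "T_op p \<alpha> \<beta> ` (bergman_space p \<alpha> :: (complex^'n::finite \<Rightarrow> complex) set) = bergman_space p \<beta> \<and>
    (\<exists>C. \<forall>f \<in> (bergman_space p \<alpha> :: (complex^'n \<Rightarrow> complex) set).
       bergman_norm p \<beta> (T_op p \<alpha> \<beta> f) \<le> C * bergman_norm p \<alpha> f)"
proof
  show "T_op p \<alpha> \<beta> ` (bergman_space p \<alpha> :: (complex^'n \<Rightarrow> complex) set) = bergman_space p \<beta>"
  proof (intro equalityI subsetI)
    fix f :: "complex^'n \<Rightarrow> complex" assume f: "f \<in> bergman_space p \<beta>"
    then have "T_op p \<alpha> \<beta> (T_op p \<beta> \<alpha> f) = f" by (intro T_op_inverse) (simp add: bergman_space_def)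
    moreover have "T_op p \<beta> \<alpha> f \<in> bergman_space p \<alpha>" by (rule T_op_bergman_space[OF assms f])
    ultimately show "f \<in> T_op p \<alpha> \<beta> ` bergman_space p \<alpha>" by (metis imageI)
  qed (auto intro: T_op_bergman_space[OF assms])
qed (rule T_op_bounded[OF assms])

end
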